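(* Let $Q$ be a real-valued $C^1$ function on the unit circle $\mathbf{T}$ such that $t\mapsto Q\bigl(e^{\sqrt{-1}t}\bigr)-\frac{\rho}{2}t^2$ is convex on $\mathbf{R}$ with a constant $\rho>-1/2$. Then, for every Borel probability measure $\mu\in\mathcal{M}(\mathbf{T})$, $$\widetilde{\Sigma}_Q(\mu)\le\frac{1}{1+2\rho}\,F_Q(\mu).$$
   Context: $\mathcal{M}(\mathbf{T})$ is the set of Borel probability measures on the unit circle $\mathbf{T}$; $d\zeta=d\theta/2\pi$ ($\zeta=e^{\sqrt{-1}\theta}$) is the Haar probability measure on $\mathbf{T}$. Free entropy: $\Sigma(\mu):=\iint_{\mathbf{T}^2}\log|\zeta-\eta|\,d\mu(\zeta)\,d\mu(\eta)\in[-\infty,\infty)$. Relative free entropy: for a real-valued continuous $Q$ on $\mathbf{T}$, the functional $-\Sigma(\mu)+\int_{\mathbf{T}}Q\,d\mu$ on $\mathcal{M}(\mathbf{T})$ has a unique minimizer $\mu_Q$ with finite value; set $B(Q):=\Sigma(\mu_Q)-\int_{\mathbf{T}}Q\,d\mu_Q$ and $$\widetilde{\Sigma}_Q(\mu):=-\Sigma(\mu)+\int_{\mathbf{T}}Q(\zeta)\,d\mu(\zeta)+B(Q).$$ Hilbert transform: for a density $p$ on $\mathbf{T}$, $$(Hp)\bigl(e^{\sqrt{-1}\theta}\bigr):=\lim_{\varepsilon\searrow0}\int_{\varepsilon\le|t|<\pi}\frac{p\bigl(e^{\sqrt{-1}(\theta-t)}\bigr)}{\tan(t/2)}\,\frac{dt}{2\pi}$$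 (the limit exists for a.e. $\theta$). Relative free Fisher information: for $Q\in C^1(\mathbf{T})$ real-valued, write $Q'(e^{\sqrt{-1}\theta})=\frac{d}{d\theta}Q(e^{\sqrt{-1}\theta})$. If $\mu$ has a density $p=d\mu/d\zeta\in L^3(\mathbf{T},d\zeta)$, then $$F_Q(\mu):=\int_{\mathbf{T}}\bigl((Hp)(\zeta)-Q'(\zeta)\bigr)^2d\mu(\zeta)-\Bigl(\int_{\mathbf{T}}Q'(\zeta)\,d\mu(\zeta)\Bigr)^2;$$ otherwise $F_Q(\mu):=+\infty$. *)

theory Defs
  imports "HOL-Probability.Probability"
begin

definition circle_borel :: "complex measure" where
  "circle_borel = restrict_space borel (sphere 0 1)"

definition circle_prob_measures :: "complex measure set" where
  "circle_prob_measures = {M. prob_space M \<and> sets M = sets circle_borel}"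

definition circle_haar :: "complex measure" where
  "circle_haar = distr (uniform_measure lborel {0..2 * pi}) circle_borel cis"

(* The case split is essential: in HOL ln 0 = 0, whereas the kernel log |z - w| is -\<infinity>
   on the diagonal (so that measures with atoms have free entropy -\<infinity>). *)
definition log_kernel :: "complex \<Rightarrow> complex \<Rightarrow> ereal" where
  "log_kernel z w = (if z = w then - \<infinity> else ereal (ln (cmod (z - w))))"

(* The integral of log_kernel over the product measure, as positive part minus negative part.
   On the circle the kernel is at most ln 2, so for a probability measure the first term is
   finite and the difference is an honest element of [-\<infinity>, \<infinity>). *)
definition free_entropy :: "complex measure \<Rightarrow> ereal" where
  "free_entropy M =
     enn2ereal (\<integral>\<^sup>+ (z, w). e2ennreal (log_kernel z w) \<partial>(M \<Otimes>\<^sub>M M))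
     - enn2ereal (\<integral>\<^sup>+ (z, w). e2ennreal (- log_kernel z w) \<partial>(M \<Otimes>\<^sub>M M))"

definition weighted_energy :: "(complex \<Rightarrow> real) \<Rightarrow> complex measure \<Rightarrow> ereal" where
  "weighted_energy Q M = - free_entropy M + ereal (\<integral>z. Q z \<partial>M)"

(* For Q continuous on the circle the minimizer exists and is unique, so the choice made by
   arg_min_on is no choice at all. *)
definition equilibrium_measure :: "(complex \<Rightarrow> real) \<Rightarrow> complex measure" where
  "equilibrium_measure Q = arg_min_on (weighted_energy Q) circle_prob_measures"

definition equilibrium_const :: "(complex \<Rightarrow> real) \<Rightarrow> ereal" where
  "equilibrium_const Q =
     free_entropy (equilibrium_measure Q) - ereal (\<integral>z. Q z \<partial>equilibrium_measure Q)"

definition rel_free_entropy :: "(complex \<Rightarrow> real) \<Rightarrow> complex measure \<Rightarrow> ereal" where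
  "rel_free_entropy Q M =
     - free_entropy M + ereal (\<integral>z. Q z \<partial>M) + equilibrium_const Q"

(* Principal value; for z = cis \<theta> the argument z * cis (- t) is cis (\<theta> - t). *)
definition circle_hilbert :: "(complex \<Rightarrow> real) \<Rightarrow> complex \<Rightarrow> real" where
  "circle_hilbert p z =
     Lim (at_right 0) (\<lambda>\<epsilon>.
       (LINT t:{t. \<epsilon> \<le> \<bar>t\<bar> \<and> \<bar>t\<bar> < pi}|lborel. p (z * cis (- t)) / tan (t / 2)) / (2 * pi))"

definition circle_deriv :: "(complex \<Rightarrow> real) \<Rightarrow> complex \<Rightarrow> real" where
  "circle_deriv Q z = deriv (\<lambda>t. Q (cis t)) (Arg z)"

definition circle_density :: "complex measure \<Rightarrow> complex \<Rightarrow> real" where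
  "circle_density M z = enn2real (RN_deriv circle_haar M z)"

definition has_L3_density :: "complex measure \<Rightarrow> bool" where
  "has_L3_density M \<longleftrightarrow>
     absolutely_continuous circle_haar M \<and> integrable circle_haar (\<lambda>z. circle_density M z ^ 3)"

(* The first integrand is nonnegative, so its integral is taken in [0, \<infinity>]. *)
definition rel_free_fisher :: "(complex \<Rightarrow> real) \<Rightarrow> complex measure \<Rightarrow> ereal" where
  "rel_free_fisher Q M =
     (if has_L3_density M then
        enn2ereal (\<integral>\<^sup>+ z. ennreal ((circle_hilbert (circle_density M) z - circle_deriv Q z)\<^sup>2) \<partial>M)
        - ereal ((\<integral>z. circle_deriv Q z \<partial>M)\<^sup>2)
      else \<infinity>)"

end

theory Submission
  imports Defs "HOL-Complex_Analysis.Complex_Analysis"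
begin

text \<open>
  The argument is mass transport, and it compares \<open>\<mu>\<close> with any measure \<open>\<nu>\<close> of finite free entropy;
  of the equilibrium measure only its existence matters. Lift \<open>\<mu>\<close> and \<open>\<nu>\<close> to the line by quantile
  functions \<open>X\<close> and \<open>Y\<close> of a common parameter, rotated so that \<open>\<theta> = Y - X\<close> has mean zero. As \<open>ln sin\<close>
  is uniformly concave on \<open>(0, \<pi>)\<close>,
  \<open>ln sin (u + v) - ln sin u \<le> v cot u - v\<^sup>2 / 2\<close>;
  with \<open>u\<close>, \<open>v\<close> half the increments of \<open>X\<close>, \<open>\<theta>\<close>, integration gives
  \<open>\<Sigma>(\<nu>) - \<Sigma>(\<mu>) \<le> \<integral> \<theta> Hp d\<mu> - 1/4 \<integral> \<theta>\<^sup>2 d\<mu>\<close>. Adding the convexity bound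
  \<open>Q(Y) - Q(X) \<ge> Q'(X) \<theta> + \<rho>/2 \<theta>\<^sup>2\<close> and completing the square in \<open>\<theta>\<close> yields the claim, the term
  \<open>(\<integral> Q' d\<mu>)\<^sup>2\<close> appearing because \<open>\<theta>\<close> is centred and \<open>\<integral> Hp d\<mu> = 0\<close>.

  The singular kernel \<open>cot\<close> is handled by multiplying the pointwise inequality with a weight in
  \<open>[0, 1]\<close> that turns it into the conjugate Poisson kernel. For \<open>p \<in> L\<^sup>2\<close> the conjugate Poisson
  integrals converge in \<open>L\<^sup>2\<close>, since by the mean value property of \<open>(F\<^sub>r - F\<^sub>s)\<^sup>2\<close> they are at the same
  mutual distance as the Poisson integrals; comparing kernels at Lebesgue points identifies the
  limit with the principal value \<open>Hp\<close> almost everywhere.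
\<close>

section \<open>The circle and its Haar measure\<close>

text \<open>The constant is a sum of two curvatures. Concavity of \<open>ln sin\<close> contributes
  1/4 to the coefficient of the squared displacement and the potential contributes \<rho>/2,
  together (1 + 2\<rho>)/4. Completing the square against this coefficient gives 1/(1 + 2\<rho>),
  and \<rho> > -1/2 says exactly that it is positive. As Q is periodic along \<open>cis\<close>,
  \<rho> > 0 cannot occur, so all positive curvature comes from the kernel. The obstacle is rotation
  invariance: the double integral sees only differences \<theta>(s) - \<theta>(t), hence controls
  the variance of \<theta> and not its mean square. This forces a coupling with mean displacement
  zero. A constant cannot simply be added to Y, since that would rotate \<nu>; shifting the
  parameter of a lifted Y keeps both marginals and the monotonicity. Monotonicity is used for pairs
  of parameters only: the increments of X and Y have the same sign and length at most 2\<pi>, so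
  their halves lie where \<open>ln sin\<close> is concave. No smoothness of the transport
  enters.\<close>

lemma space_circle_borel [simp]: "space circle_borel = sphere 0 1"
  by (simp add: circle_borel_def space_restrict_space)

lemma cis_measurable [measurable]: "cis \<in> borel \<rightarrow>\<^sub>M circle_borel"
  unfolding circle_borel_def
  by (intro measurable_restrict_space2 borel_measurable_continuous_onI continuous_intros) auto

lemma borel_measurable_circle_borel:
  "f \<in> borel_measurable borel \<Longrightarrow> f \<in> borel_measurable circle_borel"
  unfolding circle_borel_def by (rule measurable_restrict_space1)

lemma id_measurable_circle_borel [measurable]: "(\<lambda>z. z) \<in> circle_borel \<rightarrow>\<^sub>M borel"
  by (rule borel_measurable_circle_borel) simp

lemma Arg_measurable [measurable]: "Arg \<in> circle_borel \<rightarrow>\<^sub>M borel"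
proof -
  have "(\<lambda>z. Im (Ln z)) \<in> borel_measurable circle_borel"
    by (rule borel_measurable_circle_borel) measurable
  moreover have "Im (Ln z) = Arg z" if "z \<in> space circle_borel" for z
    using that Arg_eq_Im_Ln[of z] by (cases "z = 0") auto
  ultimately show ?thesis
    using measurable_cong[of circle_borel "\<lambda>z. Im (Ln z)" Arg borel] by blast
qed

lemma cis_Arg_circle: "z \<in> sphere 0 1 \<Longrightarrow> cis (Arg z) = z"
  using cis_Arg[of z] by (cases "z = 0") (auto simp: sgn_div_norm)

lemma cis_plus_2pi [simp]: "cis (t + 2 * pi) = cis t"
  by (simp add: cis.ctr)

text \<open>The part of one window that sticks out of the other is moved by one period; windows
  further apart are first brought together by whole periods. Half-open windows make the pieces fit
  exactly.\<close>

lemma nn_integral_periodic_shift: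
  fixes g :: "real \<Rightarrow> ennreal"
  assumes [measurable]: "g \<in> borel_measurable borel" and T: "T > 0" and per: "\<And>x. g (x + T) = g x"
  shows "(\<integral>\<^sup>+x. g x * indicator {a..<a+T} x \<partial>lborel) = (\<integral>\<^sup>+x. g x * indicator {b..<b+T} x \<partial>lborel)"
proof -
  define I where "I a = (\<integral>\<^sup>+x. g x * indicator {a..<a+T} x \<partial>lborel)" for a
  have shift: "(\<integral>\<^sup>+x. g x * indicator {a+T..<c+T} x \<partial>lborel) = (\<integral>\<^sup>+x. g x * indicator {a..<c} x \<partial>lborel)" for a c
    by (subst nn_integral_real_affine[where c = 1 and t = T])
       (auto intro!: nn_integral_cong simp: per add.commute[of T] split: split_indicator)
  have step: "I (a + T) = I a" for a
    unfolding I_def by (rule shift)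
  have steps: "I (a + real n * T) = I a" for a n
  proof (induction n)
    case (Suc n)
    have "a + real (Suc n) * T = (a + real n * T) + T"
      by (simp add: algebra_simps)
    then show ?case
      using Suc step[of "a + real n * T"] by (simp add: add.assoc)
  qed simp
  have near: "I a = I c" if "a \<le> c" "c \<le> a + T" for a c
  proof -
    have "I a = (\<integral>\<^sup>+x. g x * indicator {a..<c} x + g x * indicator {c..<a+T} x \<partial>lborel)"
      unfolding I_def using that by (intro nn_integral_cong) (auto split: split_indicator)
    also have "\<dots> = (\<integral>\<^sup>+x. g x * indicator {a..<c} x \<partial>lborel) + (\<integral>\<^sup>+x. g x * indicator {c..<a+T} x \<partial>lborel)"
      by (rule nn_integral_add) auto
    also have "(\<integral>\<^sup>+x. g x * indicator {a..<c} x \<partial>lborel) = (\<integral>\<^sup>+x. g x * indicator {a+T..<c+T} x \<partial>lborel)"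
      by (rule shift[symmetric])
    also have "\<dots> + (\<integral>\<^sup>+x. g x * indicator {c..<a+T} x \<partial>lborel)
        = (\<integral>\<^sup>+x. g x * indicator {a+T..<c+T} x + g x * indicator {c..<a+T} x \<partial>lborel)"
      by (rule nn_integral_add[symmetric]) auto
    also have "\<dots> = I c"
      unfolding I_def using that by (intro nn_integral_cong) (auto split: split_indicator)
    finally show ?thesis .
  qed
  have le: "I a = I c" if "a \<le> c" for a c
  proof -
    define n where "n = nat \<lfloor>(c - a) / T\<rfloor>"
    have n: "real n = of_int \<lfloor>(c - a) / T\<rfloor>"
      using that T by (simp add: n_def)
    have "real n \<le> (c - a) / T" "(c - a) / T \<le> real n + 1"
      unfolding n by linarith+
    then have "real n * T \<le> c - a" "c - a \<le> (real n + 1) * T"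
      using T by (simp_all add: field_simps)
    then have "I (a + real n * T) = I c"
      by (intro near) (simp_all add: algebra_simps)
    then show ?thesis
      using steps[of a n] by metis
  qed
  show ?thesis
    using le[of a b] le[of b a] unfolding I_def by (metis linear)
qed

lemma sets_circle_haar [measurable_cong, simp]: "sets circle_haar = sets circle_borel"
  by (simp add: circle_haar_def)

lemma space_circle_haar [simp]: "space circle_haar = sphere 0 1"
  by (simp add: circle_haar_def)

text \<open>The base point \<open>a\<close> stays free, so that the cut of the parametrisation can
  later be put at -pi or opposite a chosen point of the circle.\<close>

lemma nn_integral_circle_haar:
  assumes [measurable]: "f \<in> borel_measurable circle_borel"
  shows "(\<integral>\<^sup>+z. f z \<partial>circle_haar) = (\<integral>\<^sup>+t. f (cis t) * indicator {a..<a + 2 * pi} t \<partial>lborel) / ennreal (2 * pi)"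
proof -
  have "(\<integral>\<^sup>+z. f z \<partial>circle_haar) = (\<integral>\<^sup>+t. f (cis t) \<partial>uniform_measure lborel {0..2 * pi})"
    unfolding circle_haar_def by (subst nn_integral_distr) auto
  also have "\<dots> = (\<integral>\<^sup>+t. f (cis t) * indicator {0..2 * pi} t \<partial>lborel) / emeasure lborel {0..2*pi}"
    by (subst nn_integral_uniform_measure) auto
  \<comment> \<open>The Haar measure is defined with a closed interval; its right end point is a
    null set.\<close>
  also have "(\<integral>\<^sup>+t. f (cis t) * indicator {0..2 * pi} t \<partial>lborel) = (\<integral>\<^sup>+t. f (cis t) * indicator {0..<0 + 2 * pi} t \<partial>lborel)"
    by (intro nn_integral_cong_AE) (use AE_lborel_singleton[of "2 * pi"] in \<open>auto split: split_indicator elim!: eventually_mono\<close>)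
  also have "\<dots> = (\<integral>\<^sup>+t. f (cis t) * indicator {a..<a + 2 * pi} t \<partial>lborel)"
    by (rule nn_integral_periodic_shift) auto
  finally show ?thesis by simp
qed

lemma circle_haar_eq_distr:
  "circle_haar = distr (uniform_measure lborel {a..<a + 2 * pi}) circle_borel cis"
proof (rule measure_eqI)
  fix A assume "A \<in> sets circle_haar"
  then have A [measurable]: "A \<in> sets circle_borel" by simp
  have "emeasure circle_haar A = (\<integral>\<^sup>+z. indicator A z \<partial>circle_haar)"
    by simp
  also have "\<dots> = (\<integral>\<^sup>+t. indicator A (cis t) * indicator {a..<a + 2 * pi} t \<partial>lborel) / ennreal (2 * pi)"
    by (rule nn_integral_circle_haar) auto
  also have "\<dots> = (\<integral>\<^sup>+z. indicator A z \<partial>distr (uniform_measure lborel {a..<a + 2 * pi}) circle_borel cis)"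
    by (subst nn_integral_distr, simp, simp, subst nn_integral_uniform_measure) auto
  finally show "emeasure circle_haar A = emeasure (distr (uniform_measure lborel {a..<a + 2 * pi}) circle_borel cis) A"
    by (simp add: A)
qed simp

lemma prob_space_circle_haar: "prob_space circle_haar"
  unfolding circle_haar_def by (intro prob_space.prob_space_distr prob_space_uniform_measure) auto

interpretation haar: prob_space circle_haar
  by (rule prob_space_circle_haar)

lemma uniform_Ico_2pi_eq_density:
  "uniform_measure lborel {a..<a + 2 * pi} = density lborel (\<lambda>t. ennreal (indicator {a..<a + 2 * pi} t / (2 * pi)))"
  unfolding uniform_measure_def
  by (intro density_cong) (use divide_ennreal[of 1 "2 * pi"] in \<open>auto split: split_indicator\<close>)

lemma integral_circle_haar:
  fixes f :: "complex \<Rightarrow> 'b::{banach, second_countable_topology}"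
  assumes [measurable]: "f \<in> borel_measurable circle_borel"
  shows "(\<integral>z. f z \<partial>circle_haar) = (LINT t:{a..<a + 2 * pi}|lborel. f (cis t)) /\<^sub>R (2 * pi)"
proof -
  have "(\<integral>z. f z \<partial>circle_haar) = (\<integral>t. f (cis t) \<partial>uniform_measure lborel {a..<a + 2 * pi})"
    unfolding circle_haar_eq_distr[of a] by (subst integral_distr) auto
  also have "\<dots> = (\<integral>t. (indicator {a..<a + 2 * pi} t / (2 * pi)) *\<^sub>R f (cis t) \<partial>lborel)"
    unfolding uniform_Ico_2pi_eq_density by (subst integral_density) auto
  also have "\<dots> = (LINT t:{a..<a + 2 * pi}|lborel. f (cis t)) /\<^sub>R (2 * pi)"
    unfolding set_lebesgue_integral_def
    by (subst integral_scaleR_right[symmetric], intro Bochner_Integration.integral_cong) (auto simp: field_simps)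
  finally show ?thesis .
qed

lemma integrable_scaleR_right_iff:
  fixes f :: "'a \<Rightarrow> 'b::{banach, second_countable_topology}"
  assumes "c \<noteq> 0"
  shows "integrable M (\<lambda>x. c *\<^sub>R f x) \<longleftrightarrow> integrable M f"
proof
  assume "integrable M (\<lambda>x. c *\<^sub>R f x)"
  then have "integrable M (\<lambda>x. (1 / c) *\<^sub>R (c *\<^sub>R f x))"
    by (rule integrable_scaleR_right)
  then show "integrable M f"
    using assms by simp
qed (rule integrable_scaleR_right)

lemma integrable_circle_haar_iff:
  fixes f :: "complex \<Rightarrow> 'b::{banach, second_countable_topology}"
  assumes [measurable]: "f \<in> borel_measurable circle_borel"
  shows "integrable circle_haar f \<longleftrightarrow> set_integrable lborel {a..<a + 2 * pi} (\<lambda>t. f (cis t))"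
proof -
  have "integrable circle_haar f \<longleftrightarrow> integrable (uniform_measure lborel {a..<a + 2 * pi}) (\<lambda>t. f (cis t))"
    unfolding circle_haar_eq_distr[of a] by (subst integrable_distr_eq) auto
  also have "\<dots> \<longleftrightarrow> integrable lborel (\<lambda>t. (indicator {a..<a + 2 * pi} t / (2 * pi)) *\<^sub>R f (cis t))"
    unfolding uniform_Ico_2pi_eq_density by (subst integrable_density) auto
  also have "\<dots> \<longleftrightarrow> integrable lborel (\<lambda>t. (1 / (2 * pi)) *\<^sub>R (indicator {a..<a + 2 * pi} t *\<^sub>R f (cis t)))"
    by simp
  also have "\<dots> \<longleftrightarrow> set_integrable lborel {a..<a + 2 * pi} (\<lambda>t. f (cis t))"
    unfolding set_integrable_def by (rule integrable_scaleR_right_iff) simp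
  finally show ?thesis .
qed

text \<open>Version for measurable predicates, from which the one for arbitrary predicates is
  obtained by means of \<open>Arg\<close>.\<close>

lemma AE_circle_haar_predI:
  assumes "AE t in lborel. t \<in> {-pi<..<pi} \<longrightarrow> P (cis t)"
    and [measurable]: "Measurable.pred circle_borel P"
  shows "AE z in circle_haar. P z"
proof -
  have "AE t in lborel. t \<noteq> -pi"
    by (rule AE_lborel_singleton)
  with assms(1) have "AE t in lborel. t \<in> {-pi..<-pi + 2 * pi} \<longrightarrow> P (cis t)"
    by eventually_elim auto
  then have "AE t in uniform_measure lborel {-pi..<-pi + 2 * pi}. P (cis t)"
    by (intro AE_uniform_measureI) auto
  then show ?thesis
    unfolding circle_haar_eq_distr[of "-pi"]
    by (subst AE_distr_iff) (use assms(2) in \<open>simp_all add: pred_def\<close>)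
qed

subsection \<open>The mean value property\<close>

text \<open>This is Cauchy's integral formula at the centre. With \<open>R > 1\<close> the function
  is holomorphic across the circle and no boundary values enter; functions on the disc are brought
  into this form by dilation.\<close>

lemma mean_value_haar:
  assumes h: "h holomorphic_on ball 0 R" and R: "R > 1"
  shows "(\<integral>z. h z \<partial>circle_haar) = h 0"
proof -
  have cont: "continuous_on (cball 0 1) h" and "h holomorphic_on ball 0 1"
    using h R by (auto intro!: holomorphic_on_imp_continuous_on holomorphic_on_subset[OF h])
  then have "((\<lambda>u. h u / (u - 0)) has_contour_integral (2 * of_real pi * \<i>) * h 0) (circlepath 0 1)"
    by (intro Cauchy_integral_circlepath) auto
  then have "((\<lambda>x. h (exp (2 * of_real pi * \<i> * x)) * (2 * of_real pi * \<i>)) has_integral (2 * of_real pi * \<i>) * h 0) {0..1::real}"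
    unfolding has_contour_integral_def
    by (rule has_integral_eq[rotated]) (auto simp: vector_derivative_circlepath01, auto simp: circlepath)
  from has_integral_mult_left[OF this, of "1 / (2 * of_real pi * \<i>)"]
  have I01: "((\<lambda>x. h (cis (2 * pi * x))) has_integral h 0) {0..1::real}"
    by (simp add: cis_conv_exp mult_ac)
  then have I2: "((\<lambda>x. h (cis x)) has_integral (2 * pi) *\<^sub>R h 0) {0..2*pi}"
  proof -
    have img: "(\<lambda>x::real. x * (pi * 2)) ` {0..1} = {0..2 * pi}"
      using image_mult_atLeastAtMost[of "2*pi" 0 1] by (simp add: mult.commute)
    show ?thesis
      using has_integral_affinity[of "\<lambda>x. h (cis (2 * pi * x))" "h 0" 0 1 "1 / (2 * pi)" 0] I01
      by (simp add: img mult_ac)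
  qed
  have hb: "h \<in> borel_measurable circle_borel"
    unfolding circle_borel_def using cont
    by (intro borel_measurable_continuous_on_restrict) (auto intro: continuous_on_subset)
  have c: "continuous_on {0..2*pi} (\<lambda>x. h (cis x))"
    by (intro continuous_on_compose2[OF cont] continuous_intros) auto
  have "set_integrable lborel {0..2*pi} (\<lambda>x. h (cis x))"
    by (rule borel_integrable_atLeastAtMost'[OF c])
  then have "(LINT t:{0..2*pi}|lborel. h (cis t)) = integral {0..2*pi} (\<lambda>x. h (cis x))"
    by (rule set_borel_integral_eq_integral)
  then have *: "(LINT t:{0..2*pi}|lborel. h (cis t)) = (2 * pi) *\<^sub>R h 0"
    using I2 by (simp add: integral_unique)
  have "(LINT t:{0..<0+2*pi}|lborel. h (cis t)) = (LINT t:{0..2*pi}|lborel. h (cis t))"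
    unfolding set_lebesgue_integral_def
  proof (rule integral_cong_AE)
    show "AE x in lborel. indicat_real {0..<0 + 2 * pi} x *\<^sub>R h (cis x) = indicat_real {0..2 * pi} x *\<^sub>R h (cis x)"
      using AE_lborel_singleton[of "2 * pi"] by eventually_elim (auto split: split_indicator)
  qed (use hb in measurable)
  then show ?thesis
    using integral_circle_haar[OF hb, of 0] * by simp
qed

section \<open>The Herglotz kernel\<close>

text \<open>The Schwarz-Herglotz kernel, with \<open>z\<close> in the disc and \<open>w\<close> on
  the circle. For real integrable \<open>f\<close>, the function \<open>herglotz_int f\<close> is
  holomorphic in the disc; its real part is the Poisson integral of \<open>f\<close> and its
  imaginary part the harmonic conjugate that vanishes at 0.\<close>

definition herglotz :: "complex \<Rightarrow> complex \<Rightarrow> complex" where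
  "herglotz z w = (w + z) / (w - z)"

definition herglotz_int :: "(complex \<Rightarrow> real) \<Rightarrow> complex \<Rightarrow> complex" where
  "herglotz_int f z = (\<integral>w. of_real (f w) * herglotz z w \<partial>circle_haar)"

abbreviation poisson :: "complex \<Rightarrow> complex \<Rightarrow> real" where
  "poisson z w \<equiv> Re (herglotz z w)"

abbreviation conj_poisson :: "complex \<Rightarrow> complex \<Rightarrow> real" where
  "conj_poisson z w \<equiv> Im (herglotz z w)"

lemma herglotz_measurable [measurable]:
  "f \<in> borel_measurable M \<Longrightarrow> g \<in> borel_measurable M \<Longrightarrow> (\<lambda>x. herglotz (f x) (g x)) \<in> borel_measurable M"
  unfolding herglotz_def
  by (intro borel_measurable_divide borel_measurable_add borel_measurable_diff)

text \<open>On the circle, conjugation is inversion. So the Poisson kernel is symmetric in its two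
  boundary points, which is used with Fubini, and the conjugate kernel is antisymmetric, which is
  used to symmetrise the transport inequality.\<close>

lemma herglotz_swap:
  assumes "cmod \<zeta> = 1" "cmod w = 1"
  shows "herglotz (of_real r * \<zeta>) w = cnj (herglotz (of_real r * w) \<zeta>)"
proof -
  have z: "\<zeta> * cnj \<zeta> = 1" "w * cnj w = 1"
    using assms by (simp_all add: complex_norm_square[symmetric])
  then have nz: "\<zeta> \<noteq> 0" "w \<noteq> 0" by auto
  have c: "cnj \<zeta> = 1 / \<zeta>" "cnj w = 1 / w"
    using z nz by (simp_all add: field_simps)
  have "1 / \<zeta> + of_real r * (1 / w) = (w + of_real r * \<zeta>) / (\<zeta> * w)"
    "1 / \<zeta> - of_real r * (1 / w) = (w - of_real r * \<zeta>) / (\<zeta> * w)"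
    using nz by (simp_all add: field_simps)
  then show ?thesis
    using nz by (simp add: herglotz_def c)
qed

lemma norm_diff_ge_circle: "cmod w = 1 \<Longrightarrow> 1 - cmod z \<le> cmod (w - z)"
  using norm_triangle_ineq2[of w z] by simp

lemma norm_herglotz_le:
  assumes "cmod z < 1" "cmod w = 1"
  shows "cmod (herglotz z w) \<le> 2 / (1 - cmod z)"
  unfolding herglotz_def norm_divide
  using assms norm_triangle_ineq[of w z] norm_diff_ge_circle[of w z] by (intro frac_le) auto

lemma poisson_eq:
  assumes "cmod w = 1"
  shows "poisson z w = (1 - (cmod z)\<^sup>2) / (cmod (w - z))\<^sup>2"
proof -
  have "(Re w)\<^sup>2 + (Im w)\<^sup>2 = 1"
    using assms by (simp add: cmod_power2[symmetric])
  then show ?thesis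
    unfolding herglotz_def Re_divide cmod_power2 by (simp add: algebra_simps power2_eq_square)
qed

lemma poisson_nonneg: "cmod w = 1 \<Longrightarrow> cmod z < 1 \<Longrightarrow> 0 \<le> poisson z w"
  by (subst poisson_eq) (auto intro!: divide_nonneg_nonneg simp: power_le_one)

lemma integrable_circle_haar_continuous:
  fixes g :: "complex \<Rightarrow> 'b::{banach, second_countable_topology}"
  assumes "continuous_on (sphere 0 1) g"
  shows "integrable circle_haar g"
proof -
  have "compact (g ` sphere 0 1)"
    using assms by (intro compact_continuous_image) auto
  then obtain B where B: "\<And>z. z \<in> sphere 0 1 \<Longrightarrow> norm (g z) \<le> B"
    using compact_imp_bounded bounded_iff by (metis imageI)
  have "g \<in> borel_measurable circle_borel"
    unfolding circle_borel_def using assms by (rule borel_measurable_continuous_on_restrict)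
  then show ?thesis
    using B by (intro haar.integrable_const_bound[of _ B]) auto
qed

lemma integrable_mult_bounded_haar:
  fixes f g :: "complex \<Rightarrow> 'b::{real_normed_algebra, banach, second_countable_topology}"
  assumes f: "integrable circle_haar f" and [measurable]: "g \<in> borel_measurable circle_borel"
    and B: "\<And>z. cmod z = 1 \<Longrightarrow> norm (g z) \<le> B"
  shows "integrable circle_haar (\<lambda>z. f z * g z)"
proof (rule Bochner_Integration.integrable_bound)
  show "integrable circle_haar (\<lambda>z. B * norm (f z))"
    using f by simp
  show "AE z in circle_haar. norm (f z * g z) \<le> norm (B * norm (f z))"
  proof (rule AE_I2)
    fix z assume "z \<in> space circle_haar"
    then have z: "norm (g z) \<le> B" using B by simp
    have "norm (f z * g z) \<le> norm (f z) * norm (g z)" by (rule norm_mult_ineq)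
    also have "\<dots> \<le> norm (f z) * B" by (intro mult_left_mono z) simp
    also have "\<dots> \<le> norm (B * norm (f z))" by (simp add: mult.commute[of _ B] abs_mult mult_right_mono)
    finally show "norm (f z * g z) \<le> norm (B * norm (f z))" .
  qed
  show "(\<lambda>z. f z * g z) \<in> borel_measurable circle_haar"
    using borel_measurable_integrable[OF f] by measurable
qed

lemma integrable_times_herglotz:
  fixes f :: "complex \<Rightarrow> real"
  assumes "integrable circle_haar f" "cmod z < 1"
  shows "integrable circle_haar (\<lambda>w. of_real (f w) * herglotz z w)"
  using assms norm_herglotz_le[OF assms(2)]
  by (intro integrable_mult_bounded_haar[where B="2 / (1 - cmod z)"]) auto

lemma Re_herglotz_int:
  assumes "integrable circle_haar f" "cmod z < 1"
  shows "Re (herglotz_int f z) = (\<integral>w. f w * poisson z w \<partial>circle_haar)"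
  unfolding herglotz_int_def
  by (subst integral_Re[symmetric]) (use integrable_times_herglotz[OF assms] in auto)

lemma Im_herglotz_int:
  assumes "integrable circle_haar f" "cmod z < 1"
  shows "Im (herglotz_int f z) = (\<integral>w. f w * conj_poisson z w \<partial>circle_haar)"
  unfolding herglotz_int_def
  by (subst integral_Im[symmetric]) (use integrable_times_herglotz[OF assms] in auto)

lemma integrable_times_poisson:
  fixes f :: "complex \<Rightarrow> real"
  assumes "integrable circle_haar f" "cmod z < 1"
  shows "integrable circle_haar (\<lambda>w. f w * poisson z w)"
    and "integrable circle_haar (\<lambda>w. f w * conj_poisson z w)"
  using integrable_Re[OF integrable_times_herglotz[OF assms]] integrable_Im[OF integrable_times_herglotz[OF assms]]
  by simp_all

text \<open>The kernel is twice the geometric series in \<open>z / w\<close> minus 1. Integrating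
  term by term represents \<open>(herglotz_int f z + c 0) / 2\<close> as a power series whose
  coefficients \<open>c n\<close> are Fourier coefficients of \<open>f\<close>.\<close>

lemma herglotz_int_holomorphic:
  assumes f: "integrable circle_haar f"
  shows "herglotz_int f holomorphic_on ball 0 1"
proof -
  define c where "c n = (\<integral>w. of_real (f w) / w ^ n \<partial>circle_haar)" for n
  have [measurable]: "f \<in> borel_measurable circle_borel"
    using borel_measurable_integrable[OF f] by simp
  have int: "integrable circle_haar (\<lambda>w. of_real (f w) * (z / w) ^ n)" for z n
    using f by (intro integrable_mult_bounded_haar[where B="cmod z ^ n"])
      (auto simp: norm_power norm_divide)
  have c0: "c 0 = (\<integral>w. of_real (f w) \<partial>circle_haar)"
    by (simp add: c_def)
  have sums: "(\<lambda>n. c n * (z - 0) ^ n) sums ((herglotz_int f z + c 0) / 2)" if "z \<in> ball 0 1" for z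
  proof -
    from that have z: "cmod z < 1" by simp
    have "(\<lambda>n. \<integral>w. of_real (f w) * (z / w) ^ n \<partial>circle_haar) sums (\<integral>w. (\<Sum>n. of_real (f w) * (z / w) ^ n) \<partial>circle_haar)"
    proof (rule sums_integral)
      show "AE w in circle_haar. summable (\<lambda>n. norm (complex_of_real (f w) * (z / w) ^ n))"
        using z by (intro AE_I2) (auto simp: norm_mult norm_power norm_divide intro!: summable_mult summable_geometric)
      have "(\<lambda>n. (LINT w|circle_haar. norm (complex_of_real (f w) * (z / w) ^ n))) = (\<lambda>n. (LINT w|circle_haar. \<bar>f w\<bar>) * cmod z ^ n)"
      proof
        fix n
        have "(LINT w|circle_haar. norm (complex_of_real (f w) * (z / w) ^ n)) = (LINT w|circle_haar. \<bar>f w\<bar> * cmod z ^ n)"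
          by (intro Bochner_Integration.integral_cong) (auto simp: norm_mult norm_power norm_divide)
        then show "(LINT w|circle_haar. norm (complex_of_real (f w) * (z / w) ^ n)) = (LINT w|circle_haar. \<bar>f w\<bar>) * cmod z ^ n"
          by simp
      qed
      then show "summable (\<lambda>n. (LINT w|circle_haar. norm (complex_of_real (f w) * (z / w) ^ n)))"
        using z by (auto intro!: summable_mult summable_geometric)
    qed (rule int)
    also have "(\<integral>w. (\<Sum>n. of_real (f w) * (z / w) ^ n) \<partial>circle_haar) = (\<integral>w. (of_real (f w) * herglotz z w + of_real (f w)) / 2 \<partial>circle_haar)"
    proof (intro Bochner_Integration.integral_cong refl)
      fix w assume "w \<in> space circle_haar"
      then have w: "cmod w = 1" by simp
      then have w0: "w \<noteq> 0" by auto
      have wz: "w \<noteq> z" using w z by auto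
      have "norm (z / w) < 1" using w z by (simp add: norm_divide)
      then have "(\<lambda>n. of_real (f w) * (z / w) ^ n) sums (of_real (f w) * (1 / (1 - z / w)))"
        by (intro sums_mult geometric_sums)
      moreover have "of_real (f w) * (1 / (1 - z / w)) = (of_real (f w) * herglotz z w + of_real (f w)) / 2"
        using w0 wz unfolding herglotz_def by (simp add: field_simps)
      ultimately show "(\<Sum>n. of_real (f w) * (z / w) ^ n) = (of_real (f w) * herglotz z w + of_real (f w)) / 2"
        by (simp add: sums_iff)
    qed
    also have "\<dots> = (herglotz_int f z + c 0) / 2"
      using integrable_times_herglotz[OF f z] f unfolding herglotz_int_def c0
      by (subst integral_divide_zero, subst Bochner_Integration.integral_add) auto
    also have "(\<lambda>n. \<integral>w. of_real (f w) * (z / w) ^ n \<partial>circle_haar) = (\<lambda>n. c n * (z - 0) ^ n)"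
    proof
      fix n
      have "(\<integral>w. of_real (f w) * (z / w) ^ n \<partial>circle_haar) = (\<integral>w. (of_real (f w) / w ^ n) * z ^ n \<partial>circle_haar)"
        by (intro Bochner_Integration.integral_cong) (auto simp: power_divide)
      also have "\<dots> = c n * (z - 0) ^ n"
        unfolding c_def by (subst integral_mult_left_zero) simp
      finally show "(\<integral>w. of_real (f w) * (z / w) ^ n \<partial>circle_haar) = c n * (z - 0) ^ n" .
    qed
    finally show ?thesis .
  qed
  have "(\<lambda>z. (herglotz_int f z + c 0) / 2) holomorphic_on ball 0 1"
    by (rule power_series_holomorphic[OF sums])
  then have "(\<lambda>z. 2 * ((herglotz_int f z + c 0) / 2) - c 0) holomorphic_on ball 0 1"
    by (intro holomorphic_on_diff holomorphic_on_mult holomorphic_on_const)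
  then show ?thesis
    by (rule holomorphic_transform) (simp add: field_simps)
qed

text \<open>On the circle, \<open>G\<close> times the Poisson kernel is a sum of three functions
  with known mean: \<open>h1\<close> and \<open>h2\<close> are holomorphic and vanish at 0, and the
  middle term is \<open>G z\<close> times the conjugate of a holomorphic function with value 1 at 0.
  The singularity of \<open>h1\<close> at \<open>z\<close> is removable.\<close>

lemma poisson_formula:
  assumes G: "G holomorphic_on ball 0 R" and R: "R > 1" and z: "cmod z < 1"
  shows "(\<integral>w. G w * of_real (poisson z w) \<partial>circle_haar) = G z"
proof -
  define k where "k w = (if w = z then deriv G z else (G w - G z) / (w - z))" for w
  define h1 where "h1 w = k w * w" for w
  define h2 where "h2 w = G w * (cnj z * w / (1 - cnj z * w))" for w
  define h3 where "h3 w = 1 / (1 - cnj z * w)" for w :: complex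
  \<comment> \<open>The factor \<open>1 / (1 - cnj z * w)\<close> has its pole at
    \<open>1 / cnj z\<close>, outside the closed disc. For \<open>z = 0\<close> there is no pole
    while \<open>1 / cmod z\<close> is 0 in HOL, hence the case distinction in
    \<open>S\<close>.\<close>
  define R' where "R' = min R (1 / cmod z)"
  have R'1: "R' > 1 \<or> z = 0"
    using R z by (cases "z = 0") (auto simp: R'_def field_simps)
  define S where "S = (if z = 0 then R else R')"
  have S: "S > 1" "S \<le> R" and nz: "\<And>w::complex. w \<in> ball 0 S \<Longrightarrow> 1 - cnj z * w \<noteq> 0"
  proof -
    show "S > 1" "S \<le> R" using R R'1 by (auto simp: S_def R'_def)
    fix w :: complex assume w: "w \<in> ball 0 S"
    have "cmod (cnj z * w) < 1"
      using w by (cases "z = 0") (auto simp: S_def R'_def norm_mult field_simps)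
    then show "1 - cnj z * w \<noteq> 0" by auto
  qed
  have GS: "G holomorphic_on ball 0 S"
    using G S by (auto intro: holomorphic_on_subset)
  have "k holomorphic_on ball 0 S"
    unfolding k_def[abs_def] using pole_lemma_open[OF GS, of z] by simp
  then have h1: "h1 holomorphic_on ball 0 S"
    unfolding h1_def[abs_def] by (intro holomorphic_intros)
  have h2: "h2 holomorphic_on ball 0 S"
    unfolding h2_def[abs_def] using GS nz by (intro holomorphic_intros) auto
  have h3: "h3 holomorphic_on ball 0 S"
    unfolding h3_def[abs_def] using nz by (intro holomorphic_intros) auto
  have I: "(\<integral>w. h w \<partial>circle_haar) = h 0" "integrable circle_haar h" if "h holomorphic_on ball 0 S" for h
  proof -
    show "(\<integral>w. h w \<partial>circle_haar) = h 0" using that S by (intro mean_value_haar) auto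
    have "continuous_on (sphere 0 1) h"
      using that S by (intro continuous_on_subset[OF holomorphic_on_imp_continuous_on[OF that]]) auto
    then show "integrable circle_haar h" by (rule integrable_circle_haar_continuous)
  qed
  have "(\<integral>w. G w * of_real (poisson z w) \<partial>circle_haar) = (\<integral>w. h1 w + G z * cnj (h3 w) + h2 w \<partial>circle_haar)"
  proof (intro Bochner_Integration.integral_cong refl)
    fix w assume "w \<in> space circle_haar"
    then have w: "cmod w = 1" by simp
    then have w0: "w \<noteq> 0" and wz: "w \<noteq> z" using z by auto
    have cw: "cnj w = 1 / w"
      using w w0 by (simp add: field_simps complex_norm_square[symmetric])
    have "1 - cnj z * w \<noteq> 0" using nz[of w] w S by auto
    then have d: "1 / w - cnj z \<noteq> 0" using w0 by (simp add: field_simps)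
    have "of_real (poisson z w) = (herglotz z w + cnj (herglotz z w)) / 2"
      by (simp add: complex_add_cnj)
    also have "\<dots> = w / (w - z) + cnj z * w / (1 - cnj z * w)"
    proof -
      have "herglotz z w = 2 * w / (w - z) - 1"
        using wz by (simp add: herglotz_def field_simps)
      moreover have "cnj (herglotz z w) = 2 * (cnj z * w / (1 - cnj z * w)) + 1"
        using d w0 \<open>1 - cnj z * w \<noteq> 0\<close> by (simp add: herglotz_def cw field_simps)
      ultimately show ?thesis by (simp add: field_simps)
    qed
    finally have P: "of_real (poisson z w) = w / (w - z) + cnj z * w / (1 - cnj z * w)" .
    have c3: "cnj (h3 w) = w / (w - z)"
      using w0 wz by (simp add: h3_def cw field_simps)
    have h1w: "h1 w = (G w - G z) * (w / (w - z))"
      using wz by (simp add: h1_def k_def)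
    have ring: "a * (q + c) = (a - b) * q + b * q + a * c" for a b c q :: complex
      by algebra
    show "G w * of_real (poisson z w) = h1 w + G z * cnj (h3 w) + h2 w"
      unfolding P c3 h2_def h1w by (rule ring)
  qed
  also have "\<dots> = (\<integral>w. h1 w \<partial>circle_haar) + G z * cnj (\<integral>w. h3 w \<partial>circle_haar) + (\<integral>w. h2 w \<partial>circle_haar)"
    using I(2)[OF h1] I(2)[OF h2] I(2)[OF h3] by simp
  also have "\<dots> = G z"
    unfolding I(1)[OF h1] I(1)[OF h2] I(1)[OF h3] by (simp add: h1_def h2_def h3_def)
  finally show ?thesis .
qed

section \<open>Poisson averages and dilated holomorphic functions\<close>

lemma integral_poisson:
  assumes "cmod z < 1"
  shows "(\<integral>w. poisson z w \<partial>circle_haar) = 1"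
proof -
  have "(\<integral>w. 1 * of_real (poisson z w) \<partial>circle_haar) = (1::complex)"
    using assms by (intro poisson_formula[where R=2]) auto
  then show ?thesis
    unfolding mult_1 integral_complex_of_real by (metis of_real_eq_1_iff)
qed

lemma integrable_poisson:
  assumes "cmod z < 1"
  shows "integrable circle_haar (poisson z)" "integrable circle_haar (conj_poisson z)"
  using integrable_times_poisson[of "\<lambda>_. 1", OF _ assms] by auto

text \<open>For \<open>r > 0\<close>, \<open>2 / (1 + r)\<close> lies strictly between 1 and
  \<open>1 / r\<close>; for \<open>r = 0\<close>, where \<open>1 / r\<close> is 0 in HOL, it is
  still larger than 1.\<close>

lemma holomorphic_dilate:
  assumes F: "F holomorphic_on ball 0 1" and r: "0 \<le> r" "r < 1"
  shows "(\<lambda>z. F (of_real r * z)) holomorphic_on ball 0 (2 / (1 + r))"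
proof -
  have "cmod (of_real r * z) < 1" if "cmod z < 2 / (1 + r)" for z
  proof -
    have "cmod (of_real r * z) \<le> r * (2 / (1 + r))"
      using that r mult_left_mono[of "cmod z" "2 / (1 + r)" r] by (simp add: norm_mult)
    also have "\<dots> < 1" using r by (simp add: field_simps)
    finally show ?thesis .
  qed
  then have "(F \<circ> (\<lambda>z. of_real r * z)) holomorphic_on ball 0 (2 / (1 + r))"
    by (intro holomorphic_on_compose_gen[OF _ F] holomorphic_intros) auto
  then show ?thesis by (simp add: o_def)
qed

lemma continuous_on_dilate:
  assumes F: "F holomorphic_on ball 0 1" and r: "0 \<le> r" "r < 1"
  shows "continuous_on (sphere 0 1) (\<lambda>z. F (of_real r * z))"
  using r by (intro continuous_on_subset[OF holomorphic_on_imp_continuous_on[OF holomorphic_dilate[OF assms]]]) auto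

lemma Re_Im_L2_eq:
  assumes F: "F holomorphic_on ball 0 1" and r: "0 \<le> r" "r < 1" and s: "0 \<le> s" "s < 1"
  shows "(\<integral>z. (Im (F (of_real r * z)) - Im (F (of_real s * z)))\<^sup>2 \<partial>circle_haar)
       = (\<integral>z. (Re (F (of_real r * z)) - Re (F (of_real s * z)))\<^sup>2 \<partial>circle_haar)"
proof -
  define g where "g z = F (of_real r * z) - F (of_real s * z)" for z
  define R where "R = min (2 / (1 + r)) (2 / (1 + s))"
  have R: "R > 1" using r s by (simp add: R_def)
  have g: "g holomorphic_on ball 0 R"
    unfolding g_def[abs_def] using holomorphic_dilate[OF F r] holomorphic_dilate[OF F s]
    by (intro holomorphic_on_diff) (auto elim!: holomorphic_on_subset simp: R_def)
  then have g2: "(\<lambda>z. g z ^ 2) holomorphic_on ball 0 R"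
    by (intro holomorphic_intros)
  have gc: "continuous_on (sphere 0 1) g"
    using R by (intro continuous_on_subset[OF holomorphic_on_imp_continuous_on[OF g]]) auto
  have "(\<integral>z. g z ^ 2 \<partial>circle_haar) = g 0 ^ 2"
    by (rule mean_value_haar[OF g2 R])
  \<comment> \<open>Both dilates take the value \<open>F 0\<close> at 0, so their difference
    vanishes there whatever the radii are.\<close>
  then have "Re (\<integral>z. g z ^ 2 \<partial>circle_haar) = 0"
    by (simp add: g_def)
  moreover have "Re (\<integral>z. g z ^ 2 \<partial>circle_haar) = (\<integral>z. (Re (g z))\<^sup>2 - (Im (g z))\<^sup>2 \<partial>circle_haar)"
    by (subst integral_Re[symmetric])
       (auto intro!: integrable_circle_haar_continuous continuous_intros gc simp: power2_eq_square)
  moreover have "\<dots> = (\<integral>z. (Re (g z))\<^sup>2 \<partial>circle_haar) - (\<integral>z. (Im (g z))\<^sup>2 \<partial>circle_haar)"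
    by (intro Bochner_Integration.integral_diff integrable_circle_haar_continuous continuous_intros gc)
  ultimately show ?thesis
    by (simp add: g_def)
qed

text \<open>The Poisson kernel is real, so imaginary parts can be taken in the Poisson formula for a
  dilate. Letting \<open>r\<close> tend to 1 later shows that the boundary limit of
  \<open>Im F\<close> has \<open>Im F\<close> as its Poisson integral.\<close>

lemma poisson_Im_semigroup:
  assumes F: "F holomorphic_on ball 0 1" and r: "0 \<le> r" "r < 1" and s: "0 \<le> s" "s < 1" and \<zeta>: "cmod \<zeta> = 1"
  shows "(\<integral>w. Im (F (of_real r * w)) * poisson (of_real s * \<zeta>) w \<partial>circle_haar) = Im (F (of_real (r * s) * \<zeta>))"
proof -
  have sz: "cmod (of_real s * \<zeta>) < 1" using s \<zeta> by (simp add: norm_mult)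
  have "(\<integral>w. F (of_real r * w) * of_real (poisson (of_real s * \<zeta>) w) \<partial>circle_haar) = F (of_real r * (of_real s * \<zeta>))"
    using r by (intro poisson_formula[OF holomorphic_dilate[OF F r]] sz) auto
  moreover have "integrable circle_haar (\<lambda>w. F (of_real r * w) * of_real (poisson (of_real s * \<zeta>) w))"
  proof (rule integrable_mult_bounded_haar[where B="2 / (1 - cmod (of_real s * \<zeta>))"])
    show "integrable circle_haar (\<lambda>z. F (of_real r * z))"
      by (intro integrable_circle_haar_continuous continuous_on_dilate[OF F r])
    show "cmod (of_real (poisson (of_real s * \<zeta>) w)) \<le> 2 / (1 - cmod (of_real s * \<zeta>))" if "cmod w = 1" for w
      using norm_herglotz_le[OF sz that] abs_Re_le_cmod[of "herglotz (of_real s * \<zeta>) w"] by simp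
  qed auto
  ultimately show ?thesis
    by (subst (asm) complex_eq_iff) (auto simp: mult.assoc simp flip: integral_Im)
qed

lemma herglotz_int_measurable [measurable]:
  assumes [measurable]: "f \<in> borel_measurable circle_borel" "g \<in> borel_measurable M"
  shows "(\<lambda>x. herglotz_int f (g x)) \<in> borel_measurable M"
  unfolding herglotz_int_def by measurable

text \<open>Jensen's inequality: the Poisson kernel is a probability density, and the variance of
  \<open>f\<close> under it is nonnegative.\<close>

lemma square_poisson_le:
  assumes f [measurable]: "integrable circle_haar f" and f2: "integrable circle_haar (\<lambda>w. (f w)\<^sup>2)" and z: "cmod z < 1"
  shows "(Re (herglotz_int f z))\<^sup>2 \<le> (\<integral>w. (f w)\<^sup>2 * poisson z w \<partial>circle_haar)"
proof -
  define c where "c = Re (herglotz_int f z)"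
  note ints = integrable_times_poisson(1)[OF f z] integrable_times_poisson(1)[OF f2 z] integrable_poisson(1)[OF z]
  have "0 \<le> (\<integral>w. (f w - c)\<^sup>2 * poisson z w \<partial>circle_haar)"
    using z by (intro integral_nonneg_AE AE_I2) (auto intro!: mult_nonneg_nonneg poisson_nonneg)
  also have "\<dots> = (\<integral>w. (f w)\<^sup>2 * poisson z w - 2 * c * (f w * poisson z w) + c\<^sup>2 * poisson z w \<partial>circle_haar)"
    by (intro Bochner_Integration.integral_cong) (auto simp: power2_eq_square algebra_simps)
  also have "\<dots> = (\<integral>w. (f w)\<^sup>2 * poisson z w \<partial>circle_haar) - 2 * c * (\<integral>w. f w * poisson z w \<partial>circle_haar) + c\<^sup>2 * (\<integral>w. poisson z w \<partial>circle_haar)"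
    using ints by simp
  also have "\<dots> = (\<integral>w. (f w)\<^sup>2 * poisson z w \<partial>circle_haar) - c\<^sup>2"
    using Re_herglotz_int[OF f z] integral_poisson[OF z] by (simp add: c_def power2_eq_square)
  finally show ?thesis by (simp add: c_def)
qed

text \<open>After Jensen and Fubini the kernel is integrated over its other boundary point; by
  symmetry its total mass there is 1 as well.\<close>

lemma nn_integral_poisson_square_le:
  assumes f: "integrable circle_haar f" and f2: "integrable circle_haar (\<lambda>w. (f w)\<^sup>2)" and r: "0 \<le> r" "r < 1"
  shows "(\<integral>\<^sup>+z. ennreal ((Re (herglotz_int f (of_real r * z)))\<^sup>2) \<partial>circle_haar) \<le> (\<integral>\<^sup>+z. ennreal ((f z)\<^sup>2) \<partial>circle_haar)"
proof -
  interpret pair_prob_space circle_haar circle_haar by unfold_locales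
  have [measurable]: "f \<in> borel_measurable circle_borel"
    using borel_measurable_integrable[OF f] by simp
  have rz: "cmod (of_real r * z) < 1" if "cmod z = 1" for z
    using that r by (simp add: norm_mult)
  have "(\<integral>\<^sup>+z. ennreal ((Re (herglotz_int f (of_real r * z)))\<^sup>2) \<partial>circle_haar)
      \<le> (\<integral>\<^sup>+z. (\<integral>\<^sup>+w. ennreal ((f w)\<^sup>2 * poisson (of_real r * z) w) \<partial>circle_haar) \<partial>circle_haar)"
  proof (rule nn_integral_mono)
    fix z assume "z \<in> space circle_haar"
    then have z: "cmod (of_real r * z) < 1" by (intro rz) simp
    have "(\<integral>\<^sup>+w. ennreal ((f w)\<^sup>2 * poisson (of_real r * z) w) \<partial>circle_haar) = ennreal (\<integral>w. (f w)\<^sup>2 * poisson (of_real r * z) w \<partial>circle_haar)"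
      using poisson_nonneg[OF _ z]
      by (intro nn_integral_eq_integral integrable_times_poisson f2 z AE_I2) auto
    then show "ennreal ((Re (herglotz_int f (of_real r * z)))\<^sup>2) \<le> (\<integral>\<^sup>+w. ennreal ((f w)\<^sup>2 * poisson (of_real r * z) w) \<partial>circle_haar)"
      using square_poisson_le[OF f f2 z] by (simp add: ennreal_leI)
  qed
  also have "\<dots> = (\<integral>\<^sup>+w. (\<integral>\<^sup>+z. ennreal ((f w)\<^sup>2 * poisson (of_real r * z) w) \<partial>circle_haar) \<partial>circle_haar)"
    by (intro Fubini'[symmetric]) measurable
  also have "\<dots> = (\<integral>\<^sup>+w. ennreal ((f w)\<^sup>2) \<partial>circle_haar)"
  proof (rule nn_integral_cong)
    fix w assume "w \<in> space circle_haar"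
    then have w: "cmod w = 1" by simp
    have "(\<integral>\<^sup>+z. ennreal ((f w)\<^sup>2 * poisson (of_real r * z) w) \<partial>circle_haar) = (\<integral>\<^sup>+z. ennreal ((f w)\<^sup>2) * ennreal (poisson (of_real r * w) z) \<partial>circle_haar)"
      by (intro nn_integral_cong) (auto simp: ennreal_mult' herglotz_swap[OF _ w])
    also have "\<dots> = ennreal ((f w)\<^sup>2) * (\<integral>\<^sup>+z. ennreal (poisson (of_real r * w) z) \<partial>circle_haar)"
      by (rule nn_integral_cmult) measurable
    also have "(\<integral>\<^sup>+z. ennreal (poisson (of_real r * w) z) \<partial>circle_haar) = ennreal (\<integral>z. poisson (of_real r * w) z \<partial>circle_haar)"
      using poisson_nonneg[OF _ rz[OF w]] by (intro nn_integral_eq_integral integrable_poisson rz w AE_I2) auto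
    finally show "(\<integral>\<^sup>+z. ennreal ((f w)\<^sup>2 * poisson (of_real r * z) w) \<partial>circle_haar) = ennreal ((f w)\<^sup>2)"
      by (simp add: integral_poisson rz w)
  qed
  finally show ?thesis .
qed

section \<open>Lebesgue points\<close>

lemma lebesgue_differentiation_right:
  fixes g :: "real \<Rightarrow> real"
  assumes "\<And>a b. set_integrable lborel {a..b} g"
  shows "AE x in lborel. \<forall>e>0. \<exists>d>0. \<forall>h. 0 < h \<and> h < d \<longrightarrow> \<bar>(LINT t:{x..x+h}|lborel. g t) / h - g x\<bar> < e"
proof -
  have "g integrable_on cbox a b" for a b
    using set_borel_integral_eq_integral(1)[OF assms[of a b]] by simp
  from integrable_ccontinuous_explicit[OF this] obtain N where N: "negligible N"
    and d: "\<And>x e. x \<notin> N \<Longrightarrow> 0 < e \<Longrightarrow> \<exists>d>0. \<forall>h. 0 < h \<and> h < d \<longrightarrow>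
        norm (integral (cbox x (x + h *\<^sub>R One)) g /\<^sub>R h ^ DIM(real) - g x) < e"
    by blast
  from N have "AE x in lebesgue. x \<notin> N"
    by (intro AE_not_in) (simp add: negligible_iff_null_sets)
  then have "AE x in lborel. x \<notin> N"
    unfolding AE_completion_iff .
  then show ?thesis
  proof eventually_elim
    fix x assume "x \<notin> N"
    from d[OF this] show "\<forall>e>0. \<exists>d>0. \<forall>h. 0 < h \<and> h < d \<longrightarrow> \<bar>(LINT t:{x..x+h}|lborel. g t) / h - g x\<bar> < e"
      using assms by (simp add: set_borel_integral_eq_integral(2) divide_inverse mult.commute)
  qed
qed

text \<open>Reflection at 0 turns left intervals into right ones and preserves null sets.\<close>

lemma lebesgue_differentiation_left:
  fixes g :: "real \<Rightarrow> real"
  assumes g: "\<And>a b. set_integrable lborel {a..b} g"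
  shows "AE x in lborel. \<forall>e>0. \<exists>d>0. \<forall>h. 0 < h \<and> h < d \<longrightarrow> \<bar>(LINT t:{x-h..x}|lborel. g t) / h - g x\<bar> < e"
proof -
  have refl: "(LINT t:{a..b}|lborel. g (- t)) = (LINT t:{-b..-a}|lborel. g t)" for a b
    unfolding set_lebesgue_integral_def
    by (subst (2) lborel_integral_real_affine[where c="-1" and t=0])
       (auto intro!: Bochner_Integration.integral_cong split: split_indicator)
  have "set_integrable lborel {a..b} (\<lambda>t. g (- t))" for a b
  proof -
    have "integrable lborel (\<lambda>x. indicator {-b..-a} (0 + (-1) * x) *\<^sub>R g (0 + (-1) * x))"
      using g[of "-b" "-a"] unfolding set_integrable_def by (intro lborel_integrable_real_affine) auto
    moreover have "(\<lambda>x. indicator {-b..-a} (0 + (-1) * x) *\<^sub>R g (0 + (-1) * x)) = (\<lambda>x. indicator {a..b} x *\<^sub>R g (- x))"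
      by (auto split: split_indicator)
    ultimately show ?thesis unfolding set_integrable_def by simp
  qed
  from lebesgue_differentiation_right[of "\<lambda>t. g (- t)", OF this]
  obtain N where N: "N \<in> null_sets lborel" and
    d: "\<And>x. x \<in> space lborel - N \<Longrightarrow> \<forall>e>0. \<exists>d>0. \<forall>h. 0 < h \<and> h < d \<longrightarrow> \<bar>(LINT t:{x..x+h}|lborel. g (- t)) / h - g (- x)\<bar> < e"
    by (rule AE_E3) blast
  have [measurable]: "N \<in> sets borel" using N by auto
  have "AE x in lborel. x \<notin> N" by (rule AE_not_in[OF N])
  then have "AE x in lborel. 0 + (-1) * x \<notin> N"
    by (intro AE_borel_affine) auto
  then show ?thesis
  proof eventually_elim
    case (elim x)
    then show ?case using d[of "-x"] by (simp add: refl)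
  qed
qed

text \<open>Differentiation of averages is applied to \<open>\<bar>f t - q\<bar>\<close> for all
  rational \<open>q\<close> at once, which excludes only countably many null sets; then
  \<open>q\<close> is chosen close to \<open>f x\<close>.\<close>

lemma lebesgue_point:
  fixes f :: "real \<Rightarrow> real"
  assumes f: "integrable lborel f"
  shows "AE x in lborel. \<forall>e>0. \<exists>d>0. \<forall>h. 0 < h \<and> h < d \<longrightarrow>
           (\<integral>\<^sup>+t. ennreal \<bar>f t - f x\<bar> * indicator {x-h..x+h} t \<partial>lborel) \<le> ennreal (e * h)"
proof -
  define g where "g q t = \<bar>f t - q\<bar>" for q t
  have [measurable]: "f \<in> borel_measurable borel"
    using borel_measurable_integrable[OF f] by simp
  have g: "set_integrable lborel {a..b} (g q)" for a b q
  proof -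
    have "integrable lborel (indicat_real {a..b})"
      by (intro integrable_real_indicator) (auto simp: emeasure_lborel_Icc_eq)
    then have "set_integrable lborel {a..b} (\<lambda>t. f t - q)"
      by (intro set_integral_diff(1))
         (use integrable_mult_indicator[OF _ f] in \<open>auto simp: set_integrable_def\<close>)
    then show ?thesis unfolding g_def by (rule set_integrable_abs)
  qed
  have "AE x in lborel. \<forall>q\<in>\<rat>. \<forall>e>0. \<exists>d>0. \<forall>h. 0 < h \<and> h < d \<longrightarrow> \<bar>(LINT t:{x..x+h}|lborel. g q t) / h - g q x\<bar> < e"
    by (subst AE_ball_countable) (auto intro: countable_rat lebesgue_differentiation_right[OF g])
  moreover have "AE x in lborel. \<forall>q\<in>\<rat>. \<forall>e>0. \<exists>d>0. \<forall>h. 0 < h \<and> h < d \<longrightarrow> \<bar>(LINT t:{x-h..x}|lborel. g q t) / h - g q x\<bar> < e"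
    by (subst AE_ball_countable) (auto intro: countable_rat lebesgue_differentiation_left[OF g])
  ultimately show ?thesis
  proof eventually_elim
    fix x
    assume R: "\<forall>q\<in>\<rat>. \<forall>e>0. \<exists>d>0. \<forall>h. 0 < h \<and> h < d \<longrightarrow> \<bar>(LINT t:{x..x+h}|lborel. g q t) / h - g q x\<bar> < e"
      and L: "\<forall>q\<in>\<rat>. \<forall>e>0. \<exists>d>0. \<forall>h. 0 < h \<and> h < d \<longrightarrow> \<bar>(LINT t:{x-h..x}|lborel. g q t) / h - g q x\<bar> < e"
    show "\<forall>e>0. \<exists>d>0. \<forall>h. 0 < h \<and> h < d \<longrightarrow>
           (\<integral>\<^sup>+t. ennreal \<bar>f t - f x\<bar> * indicator {x-h..x+h} t \<partial>lborel) \<le> ennreal (e * h)"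
    proof (intro allI impI)
      fix e :: real assume e: "e > 0"
      \<comment> \<open>With this \<open>q\<close> each half interval contributes at most
        \<open>h * (e / 4)\<close>, and replacing \<open>q\<close> by \<open>f x\<close> on an
        interval of length \<open>2 * h\<close> costs another \<open>h * (e / 4)\<close>.\<close>
      obtain q where q: "q \<in> \<rat>" "\<bar>f x - q\<bar> < e / 8"
      proof -
        obtain q where "q \<in> \<rat>" "f x - e/8 < q" "q < f x"
          using Rats_dense_in_real[of "f x - e/8" "f x"] e by auto
        then show thesis by (intro that[of q]) auto
      qed
      from R q e obtain d1 where d1: "d1 > 0" "\<And>h. 0 < h \<Longrightarrow> h < d1 \<Longrightarrow> \<bar>(LINT t:{x..x+h}|lborel. g q t) / h - g q x\<bar> < e/8"
        by (metis zero_less_divide_iff zero_less_numeral)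
      from L q e obtain d2 where d2: "d2 > 0" "\<And>h. 0 < h \<Longrightarrow> h < d2 \<Longrightarrow> \<bar>(LINT t:{x-h..x}|lborel. g q t) / h - g q x\<bar> < e/8"
        by (metis zero_less_divide_iff zero_less_numeral)
      have nn: "(\<integral>\<^sup>+t. ennreal (g q t) * indicator {a..b} t \<partial>lborel) \<le> ennreal (h * (e / 4))"
        if "\<bar>(LINT t:{a..b}|lborel. g q t) / h - g q x\<bar> < e/8" "0 < h" for a b h
      proof -
        have "(LINT t:{a..b}|lborel. g q t) / h < e / 4"
          using that(1) q(2) unfolding g_def by linarith
        then have le: "(LINT t:{a..b}|lborel. g q t) \<le> h * (e / 4)"
          using that by (simp add: field_simps)
        have "(\<integral>\<^sup>+t. ennreal (g q t) * indicator {a..b} t \<partial>lborel) = (\<integral>\<^sup>+t. ennreal (indicator {a..b} t *\<^sub>R g q t) \<partial>lborel)"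
          by (intro nn_integral_cong) (auto split: split_indicator)
        also have "\<dots> = ennreal (LINT t:{a..b}|lborel. g q t)"
          using g[of a b q] unfolding set_integrable_def set_lebesgue_integral_def
          by (intro nn_integral_eq_integral) (auto simp: g_def)
        finally show ?thesis using le by (simp add: ennreal_leI)
      qed
      show "\<exists>d>0. \<forall>h. 0 < h \<and> h < d \<longrightarrow>
           (\<integral>\<^sup>+t. ennreal \<bar>f t - f x\<bar> * indicator {x-h..x+h} t \<partial>lborel) \<le> ennreal (e * h)"
      proof (intro exI[of _ "min d1 d2"] conjI allI impI)
        fix h assume h: "0 < h \<and> h < min d1 d2"
        have "(\<integral>\<^sup>+t. ennreal \<bar>f t - f x\<bar> * indicator {x-h..x+h} t \<partial>lborel)
            \<le> (\<integral>\<^sup>+t. ennreal (g q t) * indicator {x-h..x} t + ennreal (g q t) * indicator {x..x+h} t + ennreal (e / 8) * indicator {x-h..x+h} t \<partial>lborel)"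
        proof (rule nn_integral_mono)
          fix t
          have "\<bar>f t - f x\<bar> \<le> g q t + e / 8"
            using q unfolding g_def by linarith
          then have "ennreal \<bar>f t - f x\<bar> \<le> ennreal (g q t + e / 8)"
            by (rule ennreal_leI)
          also have "\<dots> = ennreal (g q t) + ennreal (e / 8)"
            using e by (intro ennreal_plus) (auto simp: g_def)
          finally have "ennreal \<bar>f t - f x\<bar> \<le> ennreal (g q t) + ennreal (e / 8)" .
          then show "ennreal \<bar>f t - f x\<bar> * indicator {x-h..x+h} t \<le> ennreal (g q t) * indicator {x-h..x} t + ennreal (g q t) * indicator {x..x+h} t + ennreal (e / 8) * indicator {x-h..x+h} t"
            by (auto split: split_indicator simp: add.assoc intro: order_trans)
        qed
        also have "\<dots> = (\<integral>\<^sup>+t. ennreal (g q t) * indicator {x-h..x} t \<partial>lborel) + (\<integral>\<^sup>+t. ennreal (g q t) * indicator {x..x+h} t \<partial>lborel) + (\<integral>\<^sup>+t. ennreal (e / 8) * indicator {x-h..x+h} t \<partial>lborel)"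
          by (subst nn_integral_add, simp_all add: g_def, subst nn_integral_add, simp_all)
        also have "\<dots> \<le> ennreal (h * (e / 4)) + ennreal (h * (e / 4)) + ennreal (e / 8 * (2 * h))"
        proof (intro add_mono)
          show "(\<integral>\<^sup>+t. ennreal (g q t) * indicator {x-h..x} t \<partial>lborel) \<le> ennreal (h * (e / 4))"
            using h d2 by (intro nn) auto
          show "(\<integral>\<^sup>+t. ennreal (g q t) * indicator {x..x+h} t \<partial>lborel) \<le> ennreal (h * (e / 4))"
            using h d1 by (intro nn) auto
          show "(\<integral>\<^sup>+t. ennreal (e / 8) * indicator {x-h..x+h} t \<partial>lborel) \<le> ennreal (e / 8 * (2 * h))"
          proof -
            have "(\<integral>\<^sup>+t. ennreal (e / 8) * indicator {x-h..x+h} t \<partial>lborel) = ennreal (e / 8) * ennreal ((x + h) - (x - h))"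
              using h by (subst nn_integral_cmult_indicator) auto
            also have "\<dots> = ennreal (e / 8 * ((x + h) - (x - h)))"
              using e by (intro ennreal_mult'[symmetric]) simp
            finally show ?thesis by simp
          qed
        qed
        also have "\<dots> = ennreal (h * (e / 4) + h * (e / 4) + e / 8 * (2 * h))"
        proof -
          have plus3: "ennreal a + ennreal b + ennreal c = ennreal (a + b + c)" if "0 \<le> a" "0 \<le> b" "0 \<le> c" for a b c
            using that by simp
          show ?thesis by (rule plus3) (use h e in auto)
        qed
        also have "\<dots> \<le> ennreal (e * h)"
          using h e by (intro ennreal_leI) (simp add: field_simps)
        finally show "(\<integral>\<^sup>+t. ennreal \<bar>f t - f x\<bar> * indicator {x-h..x+h} t \<partial>lborel) \<le> ennreal (e * h)" .
      qed (use d1 d2 in auto)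
    qed
  qed
qed

lemma nn_integral_inverse_cube:
  fixes a c :: real assumes "a > 0" "c \<ge> 0"
  shows "(\<integral>\<^sup>+h. ennreal (2 * c / h ^ 3) * indicator {a..} h \<partial>lborel) = ennreal (c / a\<^sup>2)"
proof -
  have "(\<integral>\<^sup>+h. ennreal (2 * c / h ^ 3) * indicator {a..} h \<partial>lborel) = ennreal (0 - (- c / a\<^sup>2))"
  proof (rule nn_integral_FTC_atLeast)
    show "((\<lambda>h. - c / h\<^sup>2) has_real_derivative 2 * c / x ^ 3) (at x)" if "a \<le> x" for x
      using that assms by (auto intro!: derivative_eq_intros simp: field_simps power2_eq_square power3_eq_cube power4_eq_xxxx)
    show "((\<lambda>h. - c / h\<^sup>2) \<longlongrightarrow> 0) at_top"
      by real_asymp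
  qed (use assms in auto)
  then show ?thesis by simp
qed

lemma nn_integral_inverse_square:
  fixes a c :: real assumes "a > 0" "c \<ge> 0"
  shows "(\<integral>\<^sup>+h. ennreal (c / h\<^sup>2) * indicator {a..} h \<partial>lborel) = ennreal (c / a)"
proof -
  have "(\<integral>\<^sup>+h. ennreal (c / h\<^sup>2) * indicator {a..} h \<partial>lborel) = ennreal (0 - (- c / a))"
  proof (rule nn_integral_FTC_atLeast)
    show "((\<lambda>h. - c / h) has_real_derivative c / x\<^sup>2) (at x)" if "a \<le> x" for x
      using that assms by (auto intro!: derivative_eq_intros simp: field_simps power2_eq_square)
    show "((\<lambda>h. - c / h) \<longlongrightarrow> 0) at_top"
      by real_asymp
  qed (use assms in auto)
  then show ?thesis by simp
qed

text \<open>The kernel is a superposition of indicators of symmetric intervals,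
  \<open>\<delta> / max \<bar>t\<bar> \<delta> ^ 2 = \<integral>\<^bsub>\<delta>\<^esub>\<^bsup>\<infinity>\<^esup> 2 \<delta> h\<^sup>-\<^sup>3 [\<bar>t\<bar> \<le> h] dh\<close>,
  so a bound on interval averages turns into a bound on the integral against it.\<close>

lemma nn_integral_cauchy_kernel_le:
  fixes \<phi> :: "real \<Rightarrow> ennreal" and \<delta> d e C :: real
  assumes [measurable]: "\<phi> \<in> borel_measurable borel"
    and pos: "\<delta> > 0" "d > 0" "e \<ge> 0" "C \<ge> 0"
    and loc: "\<And>h. 0 < h \<Longrightarrow> h < d \<Longrightarrow> (\<integral>\<^sup>+t. \<phi> t * indicator {x-h..x+h} t \<partial>lborel) \<le> ennreal (e * h)"
    and tot: "(\<integral>\<^sup>+t. \<phi> t \<partial>lborel) \<le> ennreal C"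
  shows "(\<integral>\<^sup>+t. \<phi> t * ennreal (\<delta> / (max \<bar>t - x\<bar> \<delta>)\<^sup>2) \<partial>lborel) \<le> ennreal (2 * e) + ennreal (C * \<delta> / d\<^sup>2)"
proof -
  have "(\<integral>\<^sup>+t. \<phi> t * ennreal (\<delta> / (max \<bar>t - x\<bar> \<delta>)\<^sup>2) \<partial>lborel)
      = (\<integral>\<^sup>+t. (\<integral>\<^sup>+h. \<phi> t * (ennreal (2 * \<delta> / h ^ 3) * indicator {max \<bar>t - x\<bar> \<delta>..} h) \<partial>lborel) \<partial>lborel)"
    using pos by (intro nn_integral_cong, subst nn_integral_cmult, simp, subst nn_integral_inverse_cube) auto
  also have "\<dots> = (\<integral>\<^sup>+t. (\<integral>\<^sup>+h. \<phi> t * (ennreal (2 * \<delta> / h ^ 3) * (if \<bar>t - x\<bar> \<le> h \<and> \<delta> \<le> h then 1 else 0)) \<partial>lborel) \<partial>lborel)"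
    by (intro nn_integral_cong) (auto split: split_indicator)
  also have "\<dots> = (\<integral>\<^sup>+h. (\<integral>\<^sup>+t. \<phi> t * (ennreal (2 * \<delta> / h ^ 3) * (if \<bar>t - x\<bar> \<le> h \<and> \<delta> \<le> h then 1 else 0)) \<partial>lborel) \<partial>lborel)"
    by (intro lborel_pair.Fubini') measurable
  also have "\<dots> = (\<integral>\<^sup>+h. ennreal (2 * \<delta> / h ^ 3) * indicator {\<delta>..} h * (\<integral>\<^sup>+t. \<phi> t * indicator {x-h..x+h} t \<partial>lborel) \<partial>lborel)"
    by (intro nn_integral_cong, subst nn_integral_cmult[symmetric], simp, intro nn_integral_cong)
       (auto split: split_indicator simp: mult.commute abs_le_iff)
  \<comment> \<open>Scales below \<open>d\<close> use the local bound, which cancels one power of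
    \<open>h\<close>. Larger scales use only the total mass, and there the integral of the inverse
    cube from \<open>d\<close> on supplies the factor \<delta> that makes this term small.\<close>
  also have "\<dots> \<le> (\<integral>\<^sup>+h. ennreal ((2 * \<delta> * e) / h\<^sup>2) * indicator {\<delta>..} h + ennreal (2 * (\<delta> * C) / h ^ 3) * indicator {d..} h \<partial>lborel)"
  proof (rule nn_integral_mono)
    fix h :: real
    show "ennreal (2 * \<delta> / h ^ 3) * indicator {\<delta>..} h * (\<integral>\<^sup>+t. \<phi> t * indicator {x-h..x+h} t \<partial>lborel)
      \<le> ennreal ((2 * \<delta> * e) / h\<^sup>2) * indicator {\<delta>..} h + ennreal (2 * (\<delta> * C) / h ^ 3) * indicator {d..} h"
    proof (cases "h \<ge> \<delta>")
      case True
      then have h: "h > 0" using pos by simp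
      show ?thesis
      proof (cases "h < d")
        case lt: True
        have "ennreal (2 * \<delta> / h ^ 3) * (\<integral>\<^sup>+t. \<phi> t * indicator {x-h..x+h} t \<partial>lborel) \<le> ennreal (2 * \<delta> / h ^ 3) * ennreal (e * h)"
          by (intro mult_left_mono loc h lt) simp
        also have "\<dots> = ennreal ((2 * \<delta> * e) / h\<^sup>2)"
          using h pos by (subst ennreal_mult[symmetric]) (auto simp: field_simps power2_eq_square power3_eq_cube)
        finally show ?thesis using True lt by simp
      next
        case ge: False
        have "ennreal (2 * \<delta> / h ^ 3) * (\<integral>\<^sup>+t. \<phi> t * indicator {x-h..x+h} t \<partial>lborel) \<le> ennreal (2 * \<delta> / h ^ 3) * ennreal C"
          by (intro mult_left_mono order_trans[OF _ tot] nn_integral_mono) (auto split: split_indicator)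
        also have "\<dots> = ennreal (2 * (\<delta> * C) / h ^ 3)"
          using h pos by (subst ennreal_mult[symmetric]) (auto simp: mult_ac)
        finally show ?thesis using True ge by (simp add: add_increasing)
      qed
    qed simp
  qed
  also have "\<dots> = ennreal (2 * \<delta> * e / \<delta>) + ennreal (\<delta> * C / d\<^sup>2)"
    using pos by (subst nn_integral_add, measurable, subst nn_integral_inverse_square, simp, simp,
        subst nn_integral_inverse_cube) auto
  also have "\<dots> = ennreal (2 * e) + ennreal (C * \<delta> / d\<^sup>2)"
    using pos by (simp add: mult.commute)
  finally show ?thesis .
qed


section \<open>Poisson integrals at Lebesgue points\<close>

lemma AE_circle_haar_cisI:
  assumes "AE t in lborel. t \<in> {-pi<..<pi} \<longrightarrow> P (cis t)"
  shows "AE z in circle_haar. P z"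
proof -
  from assms obtain N where N: "\<And>t. t \<in> space lborel - N \<Longrightarrow> t \<in> {-pi<..<pi} \<longrightarrow> P (cis t)" "N \<in> null_sets lborel"
    by (rule AE_E3) blast
  have [measurable]: "N \<in> sets borel" using N by auto
  \<comment> \<open>\<open>P\<close> is not known to be measurable. The exceptional null set on the
    line is covered by a Borel one and pulled back along \<open>Arg\<close>, which yields a
    measurable predicate stronger than \<open>P\<close>.\<close>
  define Q where "Q z \<longleftrightarrow> Arg z \<notin> N \<and> Arg z \<noteq> pi" for z
  have "AE z in circle_haar. Q z"
  proof (rule AE_circle_haar_predI)
    have "AE t in lborel. t \<notin> N" using N by (intro AE_not_in)
    then show "AE t in lborel. t \<in> {-pi<..<pi} \<longrightarrow> Q (cis t)"
      by eventually_elim (auto simp: Q_def Arg_cis)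
    show "Measurable.pred circle_borel Q" unfolding Q_def by measurable
  qed
  moreover have "P z" if "Q z" "z \<in> space circle_haar" for z
  proof -
    have "P (cis (Arg z))"
      using N(1)[of "Arg z"] that Arg_bounded[of z] by (auto simp: Q_def)
    then show ?thesis using cis_Arg_circle[of z] that by simp
  qed
  ultimately show ?thesis by (auto elim!: AE_mp)
qed

lemma norm_cis_diff: "cmod (cis a - cis b) = 2 * \<bar>sin ((a - b) / 2)\<bar>"
proof -
  have "(cmod (cis a - cis b))\<^sup>2 = (cos a - cos b)\<^sup>2 + (sin a - sin b)\<^sup>2"
    by (simp add: cmod_power2)
  also have "\<dots> = ((sin a)\<^sup>2 + (cos a)\<^sup>2) + ((sin b)\<^sup>2 + (cos b)\<^sup>2) - 2 * (cos a * cos b + sin a * sin b)"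
    by (simp add: power2_eq_square algebra_simps)
  also have "\<dots> = 2 - 2 * cos (a - b)"
    by (simp add: cos_diff)
  also have "cos (a - b) = 1 - 2 * (sin ((a - b) / 2))\<^sup>2"
  proof -
    have "cos (2 * ((a - b) / 2)) = 1 - 2 * (sin ((a - b) / 2))\<^sup>2"
      by (rule cos_double_sin)
    moreover have "2 * ((a - b) / 2) = a - b" by simp
    ultimately show ?thesis by (simp only:)
  qed
  also have "2 - 2 * (1 - 2 * (sin ((a - b) / 2))\<^sup>2) = (2 * \<bar>sin ((a - b) / 2)\<bar>)\<^sup>2"
    by (simp add: power_mult_distrib)
  finally show ?thesis
    by (rule power2_eq_imp_eq) auto
qed

text \<open>Half the distance from \<open>t\<close> to \<theta> is at most (pi + |\<theta>|) / 2 <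
  pi, and on that range sin x / x is bounded away from 0. The bound degenerates when \<theta>
  approaches the cut, so the constant depends on \<theta>.\<close>

lemma norm_cis_diff_lower:
  assumes \<theta>: "-pi < \<theta>" "\<theta> < pi"
  obtains c where "0 < c" "c \<le> 1" "\<And>t. t \<in> {-pi..pi} \<Longrightarrow> 2 * c * \<bar>t - \<theta>\<bar> \<le> cmod (cis t - cis \<theta>)"
proof -
  define L where "L = (pi + \<bar>\<theta>\<bar>) / 2"
  have L: "0 \<le> L" "L < pi" using \<theta> by (auto simp: L_def)
  have "continuous_on {0..L} sinc"
    by (intro continuous_at_imp_continuous_on ballI isCont_sinc)
  then obtain x0 where x0: "x0 \<in> {0..L}" "\<And>x. x \<in> {0..L} \<Longrightarrow> sinc x0 \<le> sinc x"
    using continuous_attains_inf[of "{0..L}" sinc] L by auto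
  have pos: "sinc x0 > 0"
    using x0(1) L by (auto intro!: divide_pos_pos sin_gt_zero)
  \<comment> \<open>The half compensates the factor 2 in the claim; the cap at 1 is for comparing
    \<open>c * (1 - r)\<close> with \<open>1 - r\<close> in the kernel bound.\<close>
  define c where "c = min (sinc x0 / 2) 1"
  show thesis
  proof (rule that[of c])
    show "0 < c" "c \<le> 1" using pos by (auto simp: c_def)
    fix t assume t: "t \<in> {-pi..pi}"
    define x where "x = \<bar>t - \<theta>\<bar> / 2"
    have x: "0 \<le> x" "x \<le> L" using t by (auto simp: x_def L_def)
    have sx: "0 \<le> sin x" using x L by (intro sin_ge_zero) auto
    have "sinc x0 * x \<le> sin x"
      using x0(2)[of x] x by (cases "x = 0") (auto simp: field_simps split: if_splits)
    moreover have "2 * c * x \<le> sinc x0 * x"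
      using x by (intro mult_right_mono) (auto simp: c_def)
    ultimately have "2 * c * x \<le> sin x" by linarith
    moreover have "\<bar>sin ((t - \<theta>) / 2)\<bar> = sin x"
    proof -
      have "(t - \<theta>) / 2 = x \<or> (t - \<theta>) / 2 = - x" by (auto simp: x_def)
      then show ?thesis using sx by (auto simp del: divide_eq_eq_numeral1)
    qed
    ultimately show "2 * c * \<bar>t - \<theta>\<bar> \<le> cmod (cis t - cis \<theta>)"
      unfolding norm_cis_diff by (simp add: x_def)
  qed
qed

text \<open>The distance from \<open>cis t\<close> to the point of radius \<open>r\<close> dominates
  both \<open>c * (1 - r)\<close> and, by the triangle inequality through
  \<open>cis \<theta>\<close>, \<open>c * \<bar>t - \<theta>\<bar>\<close>. The factor 2 in the
  assumed chord bound pays for that detour.\<close>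

lemma poisson_le_cauchy_kernel:
  assumes c: "0 < c" "c \<le> 1" "2 * c * \<bar>t - \<theta>\<bar> \<le> cmod (cis t - cis \<theta>)" and r: "0 \<le> r" "r < 1"
  shows "poisson (of_real r * cis \<theta>) (cis t) \<le> 2 / c\<^sup>2 * ((1 - r) / (max \<bar>t - \<theta>\<bar> (1 - r))\<^sup>2)"
proof -
  define m where "m = cmod (cis t - of_real r * cis \<theta>)"
  have m1: "1 - r \<le> m"
    using norm_diff_ge_circle[of "cis t" "of_real r * cis \<theta>"] r by (simp add: m_def norm_mult)
  have "of_real r * cis \<theta> - cis \<theta> = of_real (r - 1) * cis \<theta>"
    by (simp add: algebra_simps)
  then have rc: "cmod (of_real r * cis \<theta> - cis \<theta>) = 1 - r"
    using r by (simp only: norm_mult norm_of_real norm_cis, simp)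
  have "cmod (cis t - cis \<theta>) \<le> m + (1 - r)"
    by (rule norm_diff_triangle_le[of _ "of_real r * cis \<theta>"]) (use rc in \<open>simp_all add: m_def\<close>)
  then have "c * \<bar>t - \<theta>\<bar> \<le> m" using c m1 by linarith
  moreover have "c * (1 - r) \<le> m"
  proof -
    have "c * (1 - r) \<le> 1 * (1 - r)" using c r by (intro mult_right_mono) auto
    then show ?thesis using m1 by simp
  qed
  ultimately have m: "c * max \<bar>t - \<theta>\<bar> (1 - r) \<le> m"
    by (simp add: max_def)
  have pos: "0 < c * max \<bar>t - \<theta>\<bar> (1 - r)"
    using c r by (intro mult_pos_pos) auto
  have "poisson (of_real r * cis \<theta>) (cis t) = (1 - r\<^sup>2) / m\<^sup>2"
    using r by (subst poisson_eq) (auto simp: m_def norm_mult)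
  also have "\<dots> \<le> (2 * (1 - r)) / (c * max \<bar>t - \<theta>\<bar> (1 - r))\<^sup>2"
  proof (rule frac_le)
    have "1 - r\<^sup>2 = (1 - r) * (1 + r)" by (simp add: power2_eq_square algebra_simps)
    also have "\<dots> \<le> (1 - r) * 2" using r by (intro mult_left_mono) auto
    finally show "1 - r\<^sup>2 \<le> 2 * (1 - r)" by simp
    show "(c * max \<bar>t - \<theta>\<bar> (1 - r))\<^sup>2 \<le> m\<^sup>2" using m pos by (intro power_mono) auto
    show "0 < (c * max \<bar>t - \<theta>\<bar> (1 - r))\<^sup>2" by (intro zero_less_power pos)
  qed (use r in auto)
  also have "\<dots> = 2 / c\<^sup>2 * ((1 - r) / (max \<bar>t - \<theta>\<bar> (1 - r))\<^sup>2)"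
    by (simp add: power_mult_distrib)
  finally show ?thesis .
qed

text \<open>A Lebesgue point condition with the Poisson kernel in place of interval averages. In
  this form it yields both the radial limit of the Poisson integral and the comparison of the
  truncated principal value with the conjugate Poisson integral.\<close>

definition poisson_point :: "(complex \<Rightarrow> real) \<Rightarrow> complex \<Rightarrow> bool" where
  "poisson_point f \<zeta> \<longleftrightarrow>
     ((\<lambda>r. \<integral>w. \<bar>f w - f \<zeta>\<bar> * poisson (of_real r * \<zeta>) w \<partial>circle_haar) \<longlongrightarrow> 0) (at_left 1)"

lemma integrable_abs_diff_const:
  fixes f :: "complex \<Rightarrow> real"
  assumes "integrable circle_haar f"
  shows "integrable circle_haar (\<lambda>w. \<bar>f w - a\<bar>)"
  using assms by auto

text \<open>At a Lebesgue point the kernel estimate bounds the weighted oscillation by a multiple of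
  \<open>2 * e + C * (1 - r) / d\<^sup>2\<close>. Here \<open>e\<close> is fixed first, then
  \<open>d\<close>, and only the second term is affected when \<open>r\<close> tends to 1.\<close>

lemma AE_poisson_point:
  assumes f: "integrable circle_haar f"
  shows "AE \<zeta> in circle_haar. poisson_point f \<zeta>"
proof (rule AE_circle_haar_cisI)
  have [measurable]: "f \<in> borel_measurable circle_borel"
    using borel_measurable_integrable[OF f] by simp
  define I where "I = {-pi..<-pi + 2 * pi}"
  \<comment> \<open>Cut down to one period, the function is integrable on the whole line.\<close>
  define g where "g t = indicator I t * f (cis t)" for t
  have g: "integrable lborel g"
    using f integrable_circle_haar_iff[of f "-pi"] by (simp add: g_def[abs_def] set_integrable_def I_def)
  from lebesgue_point[OF g]
  show "AE \<theta> in lborel. \<theta> \<in> {-pi<..<pi} \<longrightarrow> poisson_point f (cis \<theta>)"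
  proof (eventually_elim, intro impI)
    fix \<theta> assume lp: "\<forall>e>0. \<exists>d>0. \<forall>h. 0 < h \<and> h < d \<longrightarrow>
           (\<integral>\<^sup>+t. ennreal \<bar>g t - g \<theta>\<bar> * indicator {\<theta>-h..\<theta>+h} t \<partial>lborel) \<le> ennreal (e * h)"
      and \<theta>: "\<theta> \<in> {-pi<..<pi}"
    then have \<theta>I: "\<theta> \<in> I" by (auto simp: I_def)
    obtain c where c: "0 < c" "c \<le> 1" "\<And>t. t \<in> {-pi..pi} \<Longrightarrow> 2 * c * \<bar>t - \<theta>\<bar> \<le> cmod (cis t - cis \<theta>)"
      using norm_cis_diff_lower[of \<theta>] \<theta> by auto
    define \<phi> where "\<phi> t = ennreal \<bar>f (cis t) - f (cis \<theta>)\<bar> * indicator I t" for t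
    have [measurable]: "\<phi> \<in> borel_measurable borel" by (simp add: \<phi>_def[abs_def] I_def)
    define C where "C = (LINT t:I|lborel. \<bar>f (cis t) - f (cis \<theta>)\<bar>)"
    have si: "set_integrable lborel I (\<lambda>t. \<bar>f (cis t) - f (cis \<theta>)\<bar>)"
      unfolding I_def
      using integrable_abs_diff_const[OF f, of "f (cis \<theta>)"]
      by (subst (asm) integrable_circle_haar_iff[of _ "-pi"]) auto
    have C0: "C \<ge> 0" unfolding C_def set_lebesgue_integral_def
      by (intro Bochner_Integration.integral_nonneg) auto
    have tot: "(\<integral>\<^sup>+t. \<phi> t \<partial>lborel) \<le> ennreal C"
    proof -
      have "(\<integral>\<^sup>+t. \<phi> t \<partial>lborel) = (\<integral>\<^sup>+t. ennreal (indicator I t *\<^sub>R \<bar>f (cis t) - f (cis \<theta>)\<bar>) \<partial>lborel)"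
        by (intro nn_integral_cong) (auto simp: \<phi>_def split: split_indicator)
      also have "\<dots> = ennreal C"
        using si unfolding C_def set_lebesgue_integral_def set_integrable_def
        by (intro nn_integral_eq_integral) auto
      finally show ?thesis by simp
    qed
    define V where "V r = (\<integral>w. \<bar>f w - f (cis \<theta>)\<bar> * poisson (of_real r * cis \<theta>) w \<partial>circle_haar)" for r :: real
    define K where "K = 2 / c\<^sup>2"
    have K: "K > 0" using c by (simp add: K_def)
    have V: "0 \<le> V r" "V r \<le> K * (2 * e + C * (1 - r) / d\<^sup>2)"
      if r: "0 \<le> r" "r < 1" and e: "e > 0" and d: "d > 0"
        "\<And>h. 0 < h \<and> h < d \<longrightarrow> (\<integral>\<^sup>+t. ennreal \<bar>g t - g \<theta>\<bar> * indicator {\<theta>-h..\<theta>+h} t \<partial>lborel) \<le> ennreal (e * h)" for r e d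
    proof -
      have rz: "cmod (of_real r * cis \<theta>) < 1" using r by (simp add: norm_mult)
      have nonneg: "0 \<le> \<bar>f w - f (cis \<theta>)\<bar> * poisson (of_real r * cis \<theta>) w" if "cmod w = 1" for w
        using poisson_nonneg[OF that rz] by simp
      show "0 \<le> V r" unfolding V_def by (intro integral_nonneg_AE AE_I2 nonneg) simp
      have "ennreal (V r) = (\<integral>\<^sup>+w. ennreal (\<bar>f w - f (cis \<theta>)\<bar> * poisson (of_real r * cis \<theta>) w) \<partial>circle_haar)"
        unfolding V_def
        by (intro nn_integral_eq_integral[symmetric] integrable_times_poisson integrable_abs_diff_const f rz AE_I2 nonneg) simp
      also have "\<dots> = (\<integral>\<^sup>+t. ennreal (\<bar>f (cis t) - f (cis \<theta>)\<bar> * poisson (of_real r * cis \<theta>) (cis t)) * indicator I t \<partial>lborel) / ennreal (2 * pi)"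
        unfolding I_def by (rule nn_integral_circle_haar) measurable
      also have "\<dots> \<le> (\<integral>\<^sup>+t. ennreal (\<bar>f (cis t) - f (cis \<theta>)\<bar> * poisson (of_real r * cis \<theta>) (cis t)) * indicator I t \<partial>lborel)"
      proof -
        have "x / ennreal (2 * pi) \<le> x" for x
        proof -
          have "inverse (ennreal (2 * pi)) \<le> 1"
            using pi_gt3 by (subst inverse_ennreal) (auto simp: field_simps)
          then show ?thesis unfolding divide_ennreal_def using mult_left_mono[of _ 1 x] by simp
        qed
        then show ?thesis .
      qed
      also have "\<dots> \<le> (\<integral>\<^sup>+t. ennreal K * (\<phi> t * ennreal ((1 - r) / (max \<bar>t - \<theta>\<bar> (1 - r))\<^sup>2)) \<partial>lborel)"
      proof (rule nn_integral_mono)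
        fix t
        show "ennreal (\<bar>f (cis t) - f (cis \<theta>)\<bar> * poisson (of_real r * cis \<theta>) (cis t)) * indicator I t
          \<le> ennreal K * (\<phi> t * ennreal ((1 - r) / (max \<bar>t - \<theta>\<bar> (1 - r))\<^sup>2))"
        proof (cases "t \<in> I")
          case True
          then have "poisson (of_real r * cis \<theta>) (cis t) \<le> K * ((1 - r) / (max \<bar>t - \<theta>\<bar> (1 - r))\<^sup>2)"
            unfolding K_def using c r by (intro poisson_le_cauchy_kernel c) (auto simp: I_def)
          then have "\<bar>f (cis t) - f (cis \<theta>)\<bar> * poisson (of_real r * cis \<theta>) (cis t) \<le> K * (\<bar>f (cis t) - f (cis \<theta>)\<bar> * ((1 - r) / (max \<bar>t - \<theta>\<bar> (1 - r))\<^sup>2))"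
            by (subst mult.left_commute) (rule mult_left_mono, auto)
          then have "ennreal (\<bar>f (cis t) - f (cis \<theta>)\<bar> * poisson (of_real r * cis \<theta>) (cis t)) \<le> ennreal (K * (\<bar>f (cis t) - f (cis \<theta>)\<bar> * ((1 - r) / (max \<bar>t - \<theta>\<bar> (1 - r))\<^sup>2)))"
            by (rule ennreal_leI)
          also have "\<dots> = ennreal K * (ennreal \<bar>f (cis t) - f (cis \<theta>)\<bar> * ennreal ((1 - r) / (max \<bar>t - \<theta>\<bar> (1 - r))\<^sup>2))"
            using K by (simp only: ennreal_mult'[of K] less_imp_le ennreal_mult'[OF abs_ge_zero])
          finally show ?thesis using True by (simp add: \<phi>_def)
        qed simp
      qed
      also have "\<dots> = ennreal K * (\<integral>\<^sup>+t. \<phi> t * ennreal ((1 - r) / (max \<bar>t - \<theta>\<bar> (1 - r))\<^sup>2) \<partial>lborel)"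
        by (rule nn_integral_cmult) measurable
      also have "\<dots> \<le> ennreal K * (ennreal (2 * e) + ennreal (C * (1 - r) / d\<^sup>2))"
      proof (intro mult_left_mono nn_integral_cauchy_kernel_le tot)
        fix h :: real assume h: "0 < h" "h < d"
        have "(\<integral>\<^sup>+t. \<phi> t * indicator {\<theta> - h..\<theta> + h} t \<partial>lborel) \<le> (\<integral>\<^sup>+t. ennreal \<bar>g t - g \<theta>\<bar> * indicator {\<theta>-h..\<theta>+h} t \<partial>lborel)"
          using \<theta>I by (intro nn_integral_mono) (auto simp: \<phi>_def g_def split: split_indicator)
        also have "\<dots> \<le> ennreal (e * h)" using d(2)[of h] h by blast
        finally show "(\<integral>\<^sup>+t. \<phi> t * indicator {\<theta> - h..\<theta> + h} t \<partial>lborel) \<le> ennreal (e * h)" .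
      qed (use r e d C0 in auto)
      also have "\<dots> = ennreal (K * (2 * e + C * (1 - r) / d\<^sup>2))"
      proof -
        have "ennreal (2 * e) + ennreal (C * (1 - r) / d\<^sup>2) = ennreal (2 * e + C * (1 - r) / d\<^sup>2)"
          using e r C0 by (intro ennreal_plus[symmetric]) auto
        then show ?thesis using K by (simp only: ennreal_mult'[of K] less_imp_le)
      qed
      finally show "V r \<le> K * (2 * e + C * (1 - r) / d\<^sup>2)"
        using K e r C0 by (subst (asm) ennreal_le_iff) auto
    qed
    have "(V \<longlongrightarrow> 0) (at_left 1)"
    proof (rule tendstoI)
      fix e' :: real assume e': "e' > 0"
      \<comment> \<open>Makes the part independent of the radius equal to
        \<open>e' / 2\<close>.\<close>
      define e where "e = e' / (4 * K)"
      have e: "e > 0" using e' K by (simp add: e_def)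
      from lp e obtain d where d: "d > 0" "\<And>h. 0 < h \<and> h < d \<longrightarrow> (\<integral>\<^sup>+t. ennreal \<bar>g t - g \<theta>\<bar> * indicator {\<theta>-h..\<theta>+h} t \<partial>lborel) \<le> ennreal (e * h)"
        by blast
      have "((\<lambda>r. K * (C * (1 - r) / d\<^sup>2)) \<longlongrightarrow> K * (C * (1 - 1) / d\<^sup>2)) (at_left 1)"
        by (intro tendsto_intros) (use d in auto)
      then have "\<forall>\<^sub>F r in at_left 1. K * (C * (1 - r) / d\<^sup>2) < e' / 2"
        by (rule order_tendstoD(2)) (use e' in auto)
      moreover have "\<forall>\<^sub>F r in at_left (1::real). r \<in> {0<..<1}"
        by (rule eventually_at_leftI[of 0]) auto
      ultimately show "\<forall>\<^sub>F r in at_left 1. dist (V r) 0 < e'"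
      proof eventually_elim
        case (elim r)
        then have "V r \<le> K * (2 * e + C * (1 - r) / d\<^sup>2)" "0 \<le> V r"
          using V[of r e d] e d by auto
        moreover have "K * (2 * e) = e' / 2" using K by (simp add: e_def)
        moreover have "K * (2 * e + C * (1 - r) / d\<^sup>2) = K * (2 * e) + K * (C * (1 - r) / d\<^sup>2)"
          by (rule distrib_left)
        ultimately have "0 \<le> V r" "V r < e'" using elim(1) by linarith+
        then show ?case by simp
      qed
    qed
    then show "poisson_point f (cis \<theta>)"
      unfolding poisson_point_def V_def .
  qed
qed

text \<open>As the kernel has total mass 1, the constant \<open>f \<zeta>\<close> can be moved under
  the integral.\<close>

lemma poisson_point_limit:
  assumes f: "integrable circle_haar f" and \<zeta>: "cmod \<zeta> = 1" and p: "poisson_point f \<zeta>"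
  shows "((\<lambda>r. Re (herglotz_int f (of_real r * \<zeta>))) \<longlongrightarrow> f \<zeta>) (at_left 1)"
proof (rule Lim_transform2[OF tendsto_const])
  show "((\<lambda>r. f \<zeta> - Re (herglotz_int f (of_real r * \<zeta>))) \<longlongrightarrow> 0) (at_left 1)"
  proof (rule Lim_null_comparison[OF _ p[unfolded poisson_point_def]])
    have "\<forall>\<^sub>F r in at_left (1::real). r \<in> {0<..<1}"
      by (rule eventually_at_leftI[of 0]) auto
    then show "\<forall>\<^sub>F r in at_left 1. norm (f \<zeta> - Re (herglotz_int f (of_real r * \<zeta>)))
        \<le> (\<integral>w. \<bar>f w - f \<zeta>\<bar> * poisson (of_real r * \<zeta>) w \<partial>circle_haar)"
    proof eventually_elim
      case (elim r)
      then have rz: "cmod (of_real r * \<zeta>) < 1" using \<zeta> by (simp add: norm_mult)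
      note ints = integrable_times_poisson(1)[OF f rz] integrable_poisson(1)[OF rz]
      have "Re (herglotz_int f (of_real r * \<zeta>)) - f \<zeta> = (\<integral>w. f w * poisson (of_real r * \<zeta>) w \<partial>circle_haar) - f \<zeta> * (\<integral>w. poisson (of_real r * \<zeta>) w \<partial>circle_haar)"
        by (simp add: Re_herglotz_int[OF f rz] integral_poisson[OF rz])
      also have "\<dots> = (\<integral>w. (f w - f \<zeta>) * poisson (of_real r * \<zeta>) w \<partial>circle_haar)"
        using ints by (simp add: left_diff_distrib)
      finally have "norm (f \<zeta> - Re (herglotz_int f (of_real r * \<zeta>))) = norm (\<integral>w. (f w - f \<zeta>) * poisson (of_real r * \<zeta>) w \<partial>circle_haar)"
        by (simp add: norm_minus_commute)
      also have "\<dots> \<le> (\<integral>w. norm ((f w - f \<zeta>) * poisson (of_real r * \<zeta>) w) \<partial>circle_haar)"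
        by (rule integral_norm_bound)
      also have "\<dots> = (\<integral>w. \<bar>f w - f \<zeta>\<bar> * poisson (of_real r * \<zeta>) w \<partial>circle_haar)"
        using poisson_nonneg[OF _ rz] by (intro Bochner_Integration.integral_cong) (auto simp: abs_mult)
      finally show ?case .
    qed
  qed
qed

section \<open>The principal value integral\<close>

text \<open>The substitution that maps \<open>t\<close> to \<theta> - t puts \<zeta> at parameter 0,
  the middle of the interval. This is the form in which \<open>circle_hilbert\<close> is
  written.\<close>

lemma circle_haar_rotate:
  fixes k :: "complex \<Rightarrow> 'b::{banach, second_countable_topology}"
  assumes k: "integrable circle_haar k" and \<zeta>: "cmod \<zeta> = 1"
  shows "set_integrable lborel {-pi<..<pi} (\<lambda>t. k (\<zeta> * cis (- t)))"
    and "(\<integral>z. k z \<partial>circle_haar) = (LINT t:{-pi<..<pi}|lborel. k (\<zeta> * cis (- t))) /\<^sub>R (2 * pi)"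
proof -
  have km [measurable]: "k \<in> borel_measurable circle_borel"
    using borel_measurable_integrable[OF k] by simp
  define \<theta> where "\<theta> = Arg \<zeta>"
  have \<theta>: "\<zeta> = cis \<theta>" using cis_Arg_circle[of \<zeta>] \<zeta> by (simp add: \<theta>_def)
  have eq: "\<zeta> * cis (- t) = cis (\<theta> - t)" for t
    by (simp add: \<theta> cis_mult)
  define I where "I = {\<theta> - pi..<\<theta> - pi + 2 * pi}"
  have I: "indicator I (\<theta> + - 1 * t) = (indicator {-pi<..pi} t :: real)" for t
    by (auto simp: I_def split: split_indicator)
  have si: "set_integrable lborel I (\<lambda>t. k (cis t))"
    using k integrable_circle_haar_iff[OF km, of "\<theta> - pi"] by (simp add: I_def)
  then have "integrable lborel (\<lambda>t. indicator I (\<theta> + - 1 * t) *\<^sub>R k (cis (\<theta> + - 1 * t)))"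
    unfolding set_integrable_def by (intro lborel_integrable_real_affine) auto
  then have "set_integrable lborel {-pi<..pi} (\<lambda>t. k (\<zeta> * cis (- t)))"
    unfolding set_integrable_def I eq by simp
  then show "set_integrable lborel {-pi<..<pi} (\<lambda>t. k (\<zeta> * cis (- t)))"
    by (rule set_integrable_subset) auto
  have "(LINT t:I|lborel. k (cis t)) = (LINT t:{-pi<..pi}|lborel. k (\<zeta> * cis (- t)))"
    unfolding set_lebesgue_integral_def
    by (subst lborel_integral_real_affine[where c="-1" and t=\<theta>], simp, unfold I eq, simp)
  also have "\<dots> = (LINT t:{-pi<..<pi}|lborel. k (\<zeta> * cis (- t)))"
    unfolding set_lebesgue_integral_def
  proof (rule integral_cong_AE)
    show "AE x in lborel. indicat_real {- pi<..pi} x *\<^sub>R k (\<zeta> * cis (- x)) = indicat_real {- pi<..<pi} x *\<^sub>R k (\<zeta> * cis (- x))"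
      using AE_lborel_singleton[of pi] by eventually_elim (auto split: split_indicator)
  qed (simp_all add: eq)
  finally show "(\<integral>z. k z \<partial>circle_haar) = (LINT t:{-pi<..<pi}|lborel. k (\<zeta> * cis (- t))) /\<^sub>R (2 * pi)"
    using integral_circle_haar[OF km, of "\<theta> - pi"] by (simp add: I_def)
qed

lemma herglotz_rotate:
  assumes "\<zeta> \<noteq> 0" shows "herglotz (z * \<zeta>) (\<zeta> * w) = herglotz z w"
proof -
  have "herglotz (z * \<zeta>) (\<zeta> * w) = (\<zeta> * (w + z)) / (\<zeta> * (w - z))"
    by (simp add: herglotz_def algebra_simps)
  then show ?thesis using assms by (simp add: herglotz_def)
qed

text \<open>\<open>D\<close> is the squared distance 1 + r^2 - 2 r cos t, written as a sum that
  shows its positivity and separates the radial distance from the angular one.\<close>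

lemma poisson_kernels_cis:
  fixes r t :: real
  defines "D \<equiv> (1 - r)\<^sup>2 + 4 * r * (sin (t / 2))\<^sup>2"
  shows "poisson (of_real r) (cis (- t)) = (1 - r\<^sup>2) / D"
    and "conj_poisson (of_real r) (cis (- t)) = 2 * r * sin t / D"
proof -
  have ct: "cos t = 1 - 2 * (sin (t / 2))\<^sup>2"
    using cos_double_sin[of "t / 2"] by simp
  have "(cos t - r)\<^sup>2 + (sin t)\<^sup>2 = ((sin t)\<^sup>2 + (cos t)\<^sup>2) + r\<^sup>2 - 2 * r * cos t"
    by (simp add: power2_eq_square algebra_simps)
  also have "\<dots> = 1 + r\<^sup>2 - 2 * r * cos t" by simp
  also have "\<dots> = D"
    by (simp add: D_def ct power2_eq_square algebra_simps)
  finally have D: "(Re (cis (- t) - of_real r))\<^sup>2 + (Im (cis (- t) - of_real r))\<^sup>2 = D" by simp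
  show "conj_poisson (of_real r) (cis (- t)) = 2 * r * sin t / D"
    unfolding herglotz_def Im_divide D by (simp add: algebra_simps)
  have "(cmod (cis (- t) - of_real r))\<^sup>2 = D" unfolding cmod_power2 by (rule D)
  then show "poisson (of_real r) (cis (- t)) = (1 - r\<^sup>2) / D"
    by (simp add: poisson_eq)
qed

text \<open>The conjugate Poisson kernel of radius \<open>r\<close> approximates the cotangent kernel
  truncated at distance \<open>1 - r\<close>, with an error controlled by the Poisson kernel itself.\<close>

lemma hilbert_kernel_bound:
  assumes r: "0 \<le> r" "r < 1" and t: "\<bar>t\<bar> < pi"
  shows "\<bar>(if 1 - r \<le> \<bar>t\<bar> then 1 / tan (t / 2) else 0) - conj_poisson (of_real r) (cis (- t))\<bar>
           \<le> 2 * poisson (of_real r) (cis (- t))"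
proof -
  define s c where "s = sin (t / 2)" and "c = cos (t / 2)"
  define D where "D = (1 - r)\<^sup>2 + 4 * r * s\<^sup>2"
  have st: "sin t = 2 * s * c"
    using sin_double[of "t/2"] by (simp add: s_def c_def)
  have D: "D > 0" using r by (auto simp: D_def intro!: add_pos_nonneg)
  note P = poisson_kernels_cis(1)[of r t, folded s_def, folded D_def]
  note Q = poisson_kernels_cis(2)[of r t, folded s_def, folded D_def]
  have P1: "(1 - r) / D \<le> poisson (of_real r) (cis (- t))"
  proof -
    have "1 - r \<le> 1 - r\<^sup>2" using r by (simp add: power2_eq_square mult_left_le)
    then show ?thesis unfolding P using D by (intro divide_right_mono) auto
  qed
  show ?thesis
  proof (cases "1 - r \<le> \<bar>t\<bar>")
    case False
    have "\<bar>2 * r * sin t / D\<bar> = 2 * r * \<bar>sin t\<bar> / D" using r D by (simp add: abs_mult)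
    also have "\<dots> \<le> 2 * 1 * (1 - r) / D"
      using False r D abs_sin_x_le_abs_x[of t] by (intro divide_right_mono mult_mono) auto
    also have "\<dots> = 2 * ((1 - r) / D)" by simp
    also have "\<dots> \<le> 2 * poisson (of_real r) (cis (- t))" by (intro mult_left_mono P1) simp
    finally show ?thesis using False by (simp add: Q)
  next
    case True
    then have t0: "t \<noteq> 0" using r by auto
    then have s0: "s \<noteq> 0"
    proof -
      have "- pi < t / 2" "t / 2 < pi" using t pi_gt_zero by linarith+
      then show ?thesis using sin_eq_0_pi[of "t / 2"] t0 by (auto simp: s_def)
    qed
    have tan: "1 / tan (t / 2) = c / s" by (simp add: tan_def s_def c_def)
    \<comment> \<open>The error is exactly the cotangent times \<open>(1 - r)\<^sup>2 / D\<close>.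
      Beyond the truncation the cotangent is at most \<open>2 / (1 - r)\<close>, which leaves
      \<open>2 * (1 - r) / D\<close>, a quantity below twice the Poisson kernel.\<close>
    have "c / s - 2 * r * sin t / D = c / s * ((1 - r)\<^sup>2 / D)"
    proof -
      have "c / s - 2 * r * sin t / D = (c * D - 4 * r * s\<^sup>2 * c) / (s * D)"
        using s0 D by (simp add: st field_simps power2_eq_square)
      also have "c * D - 4 * r * s\<^sup>2 * c = c * (1 - r)\<^sup>2"
        by (simp add: D_def algebra_simps)
      finally show ?thesis by simp
    qed
    moreover have "\<bar>c / s\<bar> \<le> 2 / (1 - r)"
    proof -
      have "(1 - r) / 2 \<le> \<bar>t / 2\<bar>" using True by simp
      also have "\<dots> \<le> \<bar>tan (t / 2)\<bar>" using t by (intro abs_tan_ge) auto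
      finally have "(1 - r) / 2 \<le> \<bar>tan (t / 2)\<bar>" .
      then have "1 / \<bar>tan (t / 2)\<bar> \<le> 1 / ((1 - r) / 2)"
        using r by (intro frac_le) auto
      then show ?thesis using tan by (simp flip: tan add: abs_divide)
    qed
    ultimately have "\<bar>c / s - 2 * r * sin t / D\<bar> \<le> 2 / (1 - r) * ((1 - r)\<^sup>2 / D)"
      using D r by (simp only: abs_mult) (intro mult_mono, auto)
    also have "\<dots> = 2 * ((1 - r) / D)" using r by (simp add: power2_eq_square)
    also have "\<dots> \<le> 2 * poisson (of_real r) (cis (- t))" by (intro mult_left_mono P1) simp
    finally show ?thesis using True by (simp add: Q tan)
  qed
qed

lemma set_integrable_mult_bounded:
  fixes f k :: "real \<Rightarrow> real"
  assumes f: "set_integrable lborel A f" and [measurable]: "A \<in> sets borel" "k \<in> borel_measurable borel"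
    and B: "\<And>t. t \<in> A \<Longrightarrow> \<bar>k t\<bar> \<le> B"
  shows "set_integrable lborel A (\<lambda>t. f t * k t)"
  unfolding set_integrable_def
proof (rule Bochner_Integration.integrable_bound)
  show "integrable lborel (\<lambda>t. B * (indicator A t *\<^sub>R f t))"
    using f unfolding set_integrable_def by simp
  have "(\<lambda>t. (indicator A t *\<^sub>R f t) * k t) \<in> borel_measurable lborel"
    using borel_measurable_integrable[OF f[unfolded set_integrable_def]] by measurable
  then show "(\<lambda>t. indicator A t *\<^sub>R (f t * k t)) \<in> borel_measurable lborel"
    by (simp add: mult.assoc)
  show "AE t in lborel. norm (indicator A t *\<^sub>R (f t * k t)) \<le> norm (B * (indicator A t *\<^sub>R f t))"
  proof (rule AE_I2)
    fix t
    have "\<bar>f t\<bar> * \<bar>k t\<bar> \<le> \<bar>f t\<bar> * \<bar>B\<bar>" if "t \<in> A"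
      using B[OF that] by (intro mult_left_mono) auto
    then show "norm (indicator A t *\<^sub>R (f t * k t)) \<le> norm (B * (indicator A t *\<^sub>R f t))"
      by (auto simp: abs_mult mult.commute split: split_indicator)
  qed
qed

lemma set_integral_odd:
  fixes k :: "real \<Rightarrow> real"
  assumes odd: "\<And>t. k (- t) = - k t"
  shows "(LINT t:{-a<..<a}|lborel. k t) = 0"
proof -
  have "(LINT t:{-a<..<a}|lborel. k t) = (LINT t|lborel. indicator {-a<..<a} (0 + - 1 * t) *\<^sub>R k (0 + - 1 * t))"
    unfolding set_lebesgue_integral_def
    by (subst lborel_integral_real_affine[where c="-1" and t=0]) auto
  also have "\<dots> = (LINT t|lborel. - (indicator {-a<..<a} t *\<^sub>R k t))"
    by (intro Bochner_Integration.integral_cong) (auto simp: odd split: split_indicator)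
  also have "\<dots> = - (LINT t:{-a<..<a}|lborel. k t)"
    unfolding set_lebesgue_integral_def by simp
  finally show ?thesis by simp
qed

text \<open>Both kernels are odd in \<open>t\<close>, so their difference \<open>D\<close> has
  integral 0 and the constant \<open>p \<zeta>\<close> may be subtracted from \<open>p\<close>. What
  remains is bounded by the oscillation of \<open>p\<close> around \<zeta> against twice the Poisson
  kernel.\<close>

lemma circle_hilbert_approx:
  assumes p: "integrable circle_haar p" and \<zeta>: "cmod \<zeta> = 1" and r: "0 < r" "r < 1"
  shows "\<bar>(LINT t:{t. 1 - r \<le> \<bar>t\<bar> \<and> \<bar>t\<bar> < pi}|lborel. p (\<zeta> * cis (- t)) / tan (t / 2)) / (2 * pi) - Im (herglotz_int p (of_real r * \<zeta>))\<bar>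
    \<le> 2 * (\<integral>w. \<bar>p w - p \<zeta>\<bar> * poisson (of_real r * \<zeta>) w \<partial>circle_haar)"
proof -
  have pm: "p \<in> borel_measurable circle_borel"
    using borel_measurable_integrable[OF p] by simp
  have z0: "\<zeta> \<noteq> 0" using \<zeta> by auto
  have rz: "cmod (of_real r * \<zeta>) < 1" using r \<zeta> by (simp add: norm_mult)
  define A where "A = {-pi<..<pi}"
  have [measurable]: "A \<in> sets borel" by (simp add: A_def)
  define P where "P t = p (\<zeta> * cis (- t))" for t
  define T where "T t = (if 1 - r \<le> \<bar>t\<bar> then 1 / tan (t / 2) else 0)" for t
  define q where "q t = conj_poisson (of_real r) (cis (- t))" for t
  define k where "k t = poisson (of_real r) (cis (- t))" for t
  define D where "D t = T t - q t" for t
  have cisb: "(\<lambda>t. cis (- t)) \<in> borel_measurable borel"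
    by (intro borel_measurable_continuous_onI continuous_intros)
  have qm [measurable]: "q \<in> borel_measurable borel" "k \<in> borel_measurable borel"
    using cisb unfolding q_def[abs_def] k_def[abs_def] by measurable
  have "(\<lambda>t::real. sin (t / 2) / cos (t / 2)) \<in> borel_measurable borel" by measurable
  then have [measurable]: "(\<lambda>t::real. tan (t / 2)) \<in> borel_measurable borel" by (simp add: tan_def)
  have Tm [measurable]: "T \<in> borel_measurable borel" unfolding T_def[abs_def] by measurable
  have hb: "cmod (herglotz (of_real r) (cis (- t))) \<le> 2 / (1 - r)" for t
    using norm_herglotz_le[of "of_real r" "cis (- t)"] r by simp
  have qB: "\<bar>q t\<bar> \<le> 2 / (1 - r)" and kB: "\<bar>k t\<bar> \<le> 2 / (1 - r)" for t
    using hb[of t] abs_Im_le_cmod[of "herglotz (of_real r) (cis (- t))"] abs_Re_le_cmod[of "herglotz (of_real r) (cis (- t))"]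
    unfolding q_def k_def by linarith+
  have DB: "\<bar>D t\<bar> \<le> 2 * k t" if "t \<in> A" for t
    using hilbert_kernel_bound[of r t] r that unfolding D_def T_def q_def k_def A_def by auto
  have k0: "0 \<le> k t" for t
    unfolding k_def using r by (intro poisson_nonneg) auto
  have DB': "\<bar>D t\<bar> \<le> 2 * (2 / (1 - r))" if "t \<in> A" for t
    using DB[OF that] kB[of t] by linarith
  have TB: "\<bar>T t\<bar> \<le> 3 * (2 / (1 - r))" if "t \<in> A" for t
    using DB'[OF that] qB[of t] unfolding D_def by linarith
  have Dm [measurable]: "D \<in> borel_measurable borel" unfolding D_def[abs_def] by measurable
  have Pi: "set_integrable lborel A P"
    unfolding A_def P_def[abs_def] by (rule circle_haar_rotate(1)[OF p \<zeta>])
  have ci: "set_integrable lborel A (\<lambda>t. c)" for c :: real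
  proof -
    have "integrable lborel (indicat_real A)"
      unfolding A_def by (intro integrable_real_indicator) auto
    then show ?thesis by (simp add: set_integrable_def)
  qed
  have PTi: "set_integrable lborel A (\<lambda>t. P t * T t)"
    by (rule set_integrable_mult_bounded[OF Pi]) (use TB in auto)
  have Pqi: "set_integrable lborel A (\<lambda>t. P t * q t)"
    by (rule set_integrable_mult_bounded[OF Pi]) (use qB in auto)
  have cDi: "set_integrable lborel A (\<lambda>t. p \<zeta> * D t)"
    by (rule set_integrable_mult_bounded[OF ci]) (use DB' in auto)
  have PDi: "set_integrable lborel A (\<lambda>t. P t * D t)"
    by (rule set_integrable_mult_bounded[OF Pi]) (use DB' in auto)
  have Ai: "set_integrable lborel A (\<lambda>t. \<bar>P t - p \<zeta>\<bar>)"
    by (intro set_integrable_abs set_integral_diff(1) Pi ci)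
  have Aki: "set_integrable lborel A (\<lambda>t. \<bar>P t - p \<zeta>\<bar> * k t)"
    by (rule set_integrable_mult_bounded[OF Ai]) (use kB in auto)
  have ADi: "set_integrable lborel A (\<lambda>t. (P t - p \<zeta>) * D t)"
    by (rule set_integrable_mult_bounded[OF set_integral_diff(1)[OF Pi ci]]) (use DB' in auto)
  have H: "(LINT t:{t. 1 - r \<le> \<bar>t\<bar> \<and> \<bar>t\<bar> < pi}|lborel. p (\<zeta> * cis (- t)) / tan (t / 2)) = (LINT t:A|lborel. P t * T t)"
    unfolding set_lebesgue_integral_def
    by (intro Bochner_Integration.integral_cong) (auto simp: A_def P_def T_def split: split_indicator)
  have hk: "herglotz (of_real r * \<zeta>) (\<zeta> * cis (- t)) = herglotz (of_real r) (cis (- t))" for t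
    by (rule herglotz_rotate[OF z0])
  have I: "Im (herglotz_int p (of_real r * \<zeta>)) = (LINT t:A|lborel. P t * q t) / (2 * pi)"
    unfolding Im_herglotz_int[OF p rz]
    by (subst circle_haar_rotate(2)[OF integrable_times_poisson(2)[OF p rz] \<zeta>])
       (simp only: hk P_def q_def A_def real_scaleR_def, rule divide_inverse_commute[symmetric])
  have J: "(\<integral>w. \<bar>p w - p \<zeta>\<bar> * poisson (of_real r * \<zeta>) w \<partial>circle_haar) = (LINT t:A|lborel. \<bar>P t - p \<zeta>\<bar> * k t) / (2 * pi)"
    by (subst circle_haar_rotate(2)[OF integrable_times_poisson(1)[OF integrable_abs_diff_const[OF p] rz] \<zeta>])
       (simp only: hk P_def k_def A_def real_scaleR_def, rule divide_inverse_commute[symmetric])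
  have "D (- t) = - D t" for t
  proof -
    have "herglotz (of_real r) (cis (- (- t))) = cnj (herglotz (of_real r) (cis (- t)))"
      by (simp add: herglotz_def cis_cnj)
    then show ?thesis by (simp add: D_def T_def q_def)
  qed
  then have odd: "(LINT t:A|lborel. D t) = 0"
    unfolding A_def by (rule set_integral_odd)
  have "(LINT t:A|lborel. P t * T t) - (LINT t:A|lborel. P t * q t) = (LINT t:A|lborel. P t * T t - P t * q t)"
    by (rule set_integral_diff(2)[symmetric, OF PTi Pqi])
  also have "\<dots> = (LINT t:A|lborel. P t * D t)"
    by (simp add: D_def algebra_simps)
  also have "\<dots> = (LINT t:A|lborel. P t * D t) - (LINT t:A|lborel. p \<zeta> * D t)"
    using odd by simp
  also have "\<dots> = (LINT t:A|lborel. P t * D t - p \<zeta> * D t)"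
    by (rule set_integral_diff(2)[symmetric, OF PDi cDi])
  also have "\<dots> = (LINT t:A|lborel. (P t - p \<zeta>) * D t)"
    by (simp add: algebra_simps)
  finally have diff: "(LINT t:A|lborel. P t * T t) - (LINT t:A|lborel. P t * q t) = (LINT t:A|lborel. (P t - p \<zeta>) * D t)" .
  have "\<bar>LINT t:A|lborel. (P t - p \<zeta>) * D t\<bar> \<le> (LINT t:A|lborel. 2 * (\<bar>P t - p \<zeta>\<bar> * k t))"
    unfolding set_lebesgue_integral_def
  proof (rule integral_abs_bound_integral)
    show "integrable lborel (\<lambda>x. indicat_real A x *\<^sub>R ((P x - p \<zeta>) * D x))"
      using ADi by (simp add: set_integrable_def)
    show "integrable lborel (\<lambda>x. indicat_real A x *\<^sub>R (2 * (\<bar>P x - p \<zeta>\<bar> * k x)))"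
      using set_integrable_mult_right[of 2, OF Aki] by (simp add: set_integrable_def)
    fix t
    have "\<bar>P t - p \<zeta>\<bar> * \<bar>D t\<bar> \<le> \<bar>P t - p \<zeta>\<bar> * (2 * k t)" if "t \<in> A"
      using DB[OF that] by (intro mult_left_mono) auto
    then show "\<bar>indicat_real A t *\<^sub>R ((P t - p \<zeta>) * D t)\<bar> \<le> indicat_real A t *\<^sub>R (2 * (\<bar>P t - p \<zeta>\<bar> * k t))"
      by (auto simp: abs_mult mult_ac split: split_indicator)
  qed
  also have "\<dots> = 2 * (LINT t:A|lborel. \<bar>P t - p \<zeta>\<bar> * k t)" by simp
  finally have "\<bar>(LINT t:A|lborel. P t * T t) - (LINT t:A|lborel. P t * q t)\<bar> / (2 * pi) \<le> 2 * (LINT t:A|lborel. \<bar>P t - p \<zeta>\<bar> * k t) / (2 * pi)"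
    unfolding diff by (intro divide_right_mono) auto
  then show ?thesis
    unfolding H I J diff_divide_distrib[symmetric] abs_divide by simp
qed

text \<open>The truncation is tied to the radius by \<epsilon> = 1 - r. Since
  \<open>circle_hilbert\<close> is a \<open>Lim\<close>, its value is known only once convergence
  along all small \<epsilon> is proved; this is why the hypothesis concerns all radii and not a
  sequence.\<close>

lemma circle_hilbert_eq:
  assumes p: "integrable circle_haar p" and \<zeta>: "cmod \<zeta> = 1" and pp: "poisson_point p \<zeta>"
    and g: "((\<lambda>r. Im (herglotz_int p (of_real r * \<zeta>))) \<longlongrightarrow> g) (at_left 1)"
  shows "circle_hilbert p \<zeta> = g"
proof -
  define H where "H \<epsilon> = (LINT t:{t. \<epsilon> \<le> \<bar>t\<bar> \<and> \<bar>t\<bar> < pi}|lborel. p (\<zeta> * cis (- t)) / tan (t / 2)) / (2 * pi)" for \<epsilon>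
  have "((\<lambda>r. H (1 - r) - Im (herglotz_int p (of_real r * \<zeta>))) \<longlongrightarrow> 0) (at_left 1)"
  proof (rule Lim_null_comparison)
    have "\<forall>\<^sub>F r in at_left (1::real). r \<in> {0<..<1}"
      by (rule eventually_at_leftI[of 0]) auto
    then show "\<forall>\<^sub>F r in at_left 1. norm (H (1 - r) - Im (herglotz_int p (of_real r * \<zeta>)))
        \<le> 2 * (\<integral>w. \<bar>p w - p \<zeta>\<bar> * poisson (of_real r * \<zeta>) w \<partial>circle_haar)"
      by eventually_elim (use circle_hilbert_approx[OF p \<zeta>] in \<open>simp add: H_def\<close>)
    show "((\<lambda>r. 2 * (\<integral>w. \<bar>p w - p \<zeta>\<bar> * poisson (of_real r * \<zeta>) w \<partial>circle_haar)) \<longlongrightarrow> 0) (at_left 1)"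
      using tendsto_mult_left[OF pp[unfolded poisson_point_def], of 2] by simp
  qed
  from tendsto_add[OF this g] have "((\<lambda>r. H (1 - r)) \<longlongrightarrow> g) (at_left 1)" by simp
  moreover have "filterlim (\<lambda>\<epsilon>::real. 1 - \<epsilon>) (at_left 1) (at_right 0)"
    by real_asymp
  ultimately have "((\<lambda>\<epsilon>. H (1 - (1 - \<epsilon>))) \<longlongrightarrow> g) (at_right 0)"
    by (rule filterlim_compose)
  then have "(H \<longlongrightarrow> g) (at_right 0)" by simp
  then show ?thesis
    unfolding circle_hilbert_def H_def[abs_def] by (intro tendsto_Lim) auto
qed

section \<open>Convergence in mean square\<close>

lemma (in prob_space) square_expectation_abs_le:
  fixes X :: "'a \<Rightarrow> real"
  assumes X: "integrable M (\<lambda>x. (X x)\<^sup>2)" and [measurable]: "X \<in> borel_measurable M"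
  shows "integrable M X" "(expectation (\<lambda>x. \<bar>X x\<bar>))\<^sup>2 \<le> expectation (\<lambda>x. (X x)\<^sup>2)"
proof -
  show i: "integrable M X"
    by (rule square_integrable_imp_integrable[OF _ X]) simp
  have "0 \<le> variance (\<lambda>x. \<bar>X x\<bar>)" by (rule variance_positive)
  then show "(expectation (\<lambda>x. \<bar>X x\<bar>))\<^sup>2 \<le> expectation (\<lambda>x. (X x)\<^sup>2)"
    using variance_eq[of "\<lambda>x. \<bar>X x\<bar>"] i X by simp
qed

lemma continuous_on_herglotz_int_dilate:
  assumes "integrable circle_haar f" "0 \<le> r" "r < 1"
  shows "continuous_on (sphere 0 1) (\<lambda>z. herglotz_int f (of_real r * z))"
  by (rule continuous_on_dilate[OF herglotz_int_holomorphic[OF assms(1)] assms(2,3)])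

text \<open>Parallelogram law and Fatou: almost everywhere convergence gives liminf ||U + f||^2
  \<ge> 4 ||f||^2, while contractivity gives ||U|| \<le> ||f||. So ||U - f||^2 = 2 ||U||^2 + 2
  ||f||^2 - ||U + f||^2 must tend to 0, without approximation by continuous functions.\<close>

lemma Re_herglotz_int_L2_tendsto:
  assumes f: "integrable circle_haar f" and f2: "integrable circle_haar (\<lambda>w. (f w)\<^sup>2)"
    and r: "\<And>n. 0 < r n" "\<And>n. r n < 1" "r \<longlonglongrightarrow> 1"
  shows "(\<lambda>n. \<integral>z. (Re (herglotz_int f (of_real (r n) * z)) - f z)\<^sup>2 \<partial>circle_haar) \<longlonglongrightarrow> 0"
proof -
  have fm [measurable]: "f \<in> borel_measurable circle_borel"
    using borel_measurable_integrable[OF f] by simp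
  define U where "U n z = Re (herglotz_int f (of_real (r n) * z))" for n z
  define A where "A = (\<integral>z. (f z)\<^sup>2 \<partial>circle_haar)"
  define b where "b n = (\<integral>z. (U n z - f z)\<^sup>2 \<partial>circle_haar)" for n
  have A0: "A \<ge> 0" by (simp add: A_def)
  have Uc: "continuous_on (sphere 0 1) (U n)" for n
    unfolding U_def using continuous_on_herglotz_int_dilate[OF f, of "r n"] r(1,2)[of n] by (intro continuous_intros) auto
  have Ui: "integrable circle_haar (\<lambda>z. (U n z)\<^sup>2)" for n
    by (intro integrable_circle_haar_continuous continuous_intros Uc)
  have Um [measurable]: "U n \<in> borel_measurable circle_borel" for n
    unfolding U_def by measurable
  have UB: "\<exists>B. \<forall>z. cmod z = 1 \<longrightarrow> norm (U n z) \<le> B" for n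
  proof -
    have "compact (U n ` sphere 0 1)" by (intro compact_continuous_image Uc) auto
    then show ?thesis using compact_imp_bounded bounded_iff by (metis imageI mem_sphere_0)
  qed
  have Ufi: "integrable circle_haar (\<lambda>z. f z * U n z)" for n
  proof -
    obtain B where "\<forall>z. cmod z = 1 \<longrightarrow> norm (U n z) \<le> B" using UB by blast
    then show ?thesis by (intro integrable_mult_bounded_haar[OF f]) auto
  qed
  have UA: "(\<integral>z. (U n z)\<^sup>2 \<partial>circle_haar) \<le> A" for n
  proof -
    have "ennreal (\<integral>z. (U n z)\<^sup>2 \<partial>circle_haar) = (\<integral>\<^sup>+z. ennreal ((U n z)\<^sup>2) \<partial>circle_haar)"
      by (intro nn_integral_eq_integral[symmetric] Ui) auto
    also have "\<dots> \<le> (\<integral>\<^sup>+z. ennreal ((f z)\<^sup>2) \<partial>circle_haar)"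
      unfolding U_def using r(1,2)[of n] by (intro nn_integral_poisson_square_le f f2) auto
    also have "\<dots> = ennreal A"
      unfolding A_def by (intro nn_integral_eq_integral f2) auto
    finally show ?thesis using A0 by simp
  qed
  have plus_eq: "(\<integral>z. (U n z + f z)\<^sup>2 \<partial>circle_haar) = 2 * (\<integral>z. (U n z)\<^sup>2 \<partial>circle_haar) + 2 * A - b n"
    and plus_i: "integrable circle_haar (\<lambda>z. (U n z + f z)\<^sup>2)" for n
  proof -
    have e: "(\<lambda>z. (U n z + f z)\<^sup>2) = (\<lambda>z. (U n z)\<^sup>2 + (f z)\<^sup>2 + 2 * (f z * U n z))"
      "(\<lambda>z. (U n z - f z)\<^sup>2) = (\<lambda>z. (U n z)\<^sup>2 + (f z)\<^sup>2 - 2 * (f z * U n z))"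
      by (auto simp: power2_eq_square algebra_simps)
    show "integrable circle_haar (\<lambda>z. (U n z + f z)\<^sup>2)" unfolding e using Ui Ufi f2 by simp
    show "(\<integral>z. (U n z + f z)\<^sup>2 \<partial>circle_haar) = 2 * (\<integral>z. (U n z)\<^sup>2 \<partial>circle_haar) + 2 * A - b n"
      unfolding b_def e A_def using Ui Ufi f2 by simp
  qed
  have b0: "0 \<le> b n" for n by (simp add: b_def)
  have lim_r: "filterlim r (at_left 1) sequentially"
    using r by (intro tendsto_imp_filterlim_at_left) auto
  have "AE z in circle_haar. (\<lambda>n. U n z) \<longlonglongrightarrow> f z"
    using AE_poisson_point[OF f] AE_space
    by eventually_elim (unfold U_def, rule filterlim_compose[OF poisson_point_limit[OF f] lim_r], auto)
  then have "AE z in circle_haar. liminf (\<lambda>n. ennreal ((U n z + f z)\<^sup>2)) = ennreal ((f z + f z)\<^sup>2)"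
  proof eventually_elim
    case (elim z)
    then have "(\<lambda>n. ennreal ((U n z + f z)\<^sup>2)) \<longlonglongrightarrow> ennreal ((f z + f z)\<^sup>2)"
      by (intro tendsto_ennrealI tendsto_intros)
    then show ?case by (intro lim_imp_Liminf) auto
  qed
  then have "(\<integral>\<^sup>+z. ennreal ((f z + f z)\<^sup>2) \<partial>circle_haar) = (\<integral>\<^sup>+z. liminf (\<lambda>n. ennreal ((U n z + f z)\<^sup>2)) \<partial>circle_haar)"
    by (intro nn_integral_cong_AE) auto
  also have "\<dots> \<le> liminf (\<lambda>n. \<integral>\<^sup>+z. ennreal ((U n z + f z)\<^sup>2) \<partial>circle_haar)"
    by (intro nn_integral_liminf) measurable
  also have "(\<lambda>n. \<integral>\<^sup>+z. ennreal ((U n z + f z)\<^sup>2) \<partial>circle_haar) = (\<lambda>n. ennreal (2 * (\<integral>z. (U n z)\<^sup>2 \<partial>circle_haar) + 2 * A - b n))"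
    unfolding plus_eq[symmetric] by (intro ext nn_integral_eq_integral plus_i) auto
  also have "(\<integral>\<^sup>+z. ennreal ((f z + f z)\<^sup>2) \<partial>circle_haar) = ennreal (4 * A)"
  proof -
    have "(\<lambda>z. (f z + f z)\<^sup>2) = (\<lambda>z. 4 * (f z)\<^sup>2)" by (auto simp: power2_eq_square)
    then have "integrable circle_haar (\<lambda>z. (f z + f z)\<^sup>2)" "(\<integral>z. (f z + f z)\<^sup>2 \<partial>circle_haar) = 4 * A"
      using f2 by (simp_all add: A_def)
    then show ?thesis by (subst nn_integral_eq_integral) auto
  qed
  finally have L: "ennreal (4 * A) \<le> liminf (\<lambda>n. ennreal (2 * (\<integral>z. (U n z)\<^sup>2 \<partial>circle_haar) + 2 * A - b n))" .
  have "b \<longlonglongrightarrow> 0"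
  proof (rule LIMSEQ_I)
    fix e :: real assume e: "e > 0"
    have a0: "0 \<le> 2 * (\<integral>z. (U n z)\<^sup>2 \<partial>circle_haar) + 2 * A - b n" for n
      unfolding plus_eq[symmetric] by simp
    \<comment> \<open>The lower bound comes from an inequality in \<open>ennreal\<close>, where
      negative reals become 0, so a negative threshold is treated apart.\<close>
    have "\<forall>\<^sub>F n in sequentially. 4 * A - e < 2 * (\<integral>z. (U n z)\<^sup>2 \<partial>circle_haar) + 2 * A - b n"
    proof (cases "4 * A - e < 0")
      case True
      then show ?thesis using a0 by (intro always_eventually allI) (meson less_le_trans)
    next
      case False
      then have "ennreal (4 * A - e) < ennreal (4 * A)" using e by (intro ennreal_lessI) auto
      also note L
      finally have "\<forall>\<^sub>F n in sequentially. ennreal (4 * A - e) < ennreal (2 * (\<integral>z. (U n z)\<^sup>2 \<partial>circle_haar) + 2 * A - b n)"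
        by (rule less_LiminfD)
      then show ?thesis
        by eventually_elim (use False in \<open>subst (asm) ennreal_less_iff, auto\<close>)
    qed
    then have "\<forall>\<^sub>F n in sequentially. norm (b n - 0) < e"
      by eventually_elim (use UA b0 in \<open>smt (verit) real_norm_def\<close>)
    then show "\<exists>no. \<forall>n\<ge>no. norm (b n - 0) < e" by (simp add: eventually_sequentially)
  qed
  then show ?thesis unfolding b_def U_def .
qed

text \<open>By monotone convergence the sum of the absolute increments has finite integral, so it is
  finite almost everywhere and the telescoping series converges.\<close>

lemma AE_convergent_summable_L1:
  fixes w :: "nat \<Rightarrow> 'a \<Rightarrow> real"
  assumes [measurable]: "\<And>n. w n \<in> borel_measurable M"
    and i: "\<And>n. integrable M (\<lambda>x. w (Suc n) x - w n x)"
    and s: "summable (\<lambda>n. \<integral>x. \<bar>w (Suc n) x - w n x\<bar> \<partial>M)"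
  shows "AE x in M. convergent (\<lambda>n. w n x)"
proof -
  have "(\<integral>\<^sup>+x. (\<Sum>n. ennreal \<bar>w (Suc n) x - w n x\<bar>) \<partial>M) = (\<Sum>n. \<integral>\<^sup>+x. ennreal \<bar>w (Suc n) x - w n x\<bar> \<partial>M)"
    by (rule nn_integral_suminf) measurable
  also have "\<dots> = (\<Sum>n. ennreal (\<integral>x. \<bar>w (Suc n) x - w n x\<bar> \<partial>M))"
    using i by (intro suminf_cong nn_integral_eq_integral) auto
  also have "\<dots> \<noteq> \<infinity>"
    using s by (subst suminf_ennreal2) auto
  finally have "AE x in M. (\<Sum>n. ennreal \<bar>w (Suc n) x - w n x\<bar>) \<noteq> \<infinity>"
    by (intro nn_integral_PInf_AE) measurable
  then show ?thesis
  proof eventually_elim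
    case (elim x)
    then have "summable (\<lambda>n. \<bar>w (Suc n) x - w n x\<bar>)"
      by (intro summable_suminf_not_top) auto
    then have "summable (\<lambda>n. w (Suc n) x - w n x)"
      by (rule summable_rabs_cancel)
    then have "(\<lambda>n. \<Sum>k<n. w (Suc k) x - w k x) \<longlonglongrightarrow> (\<Sum>k. w (Suc k) x - w k x)"
      by (rule summable_LIMSEQ)
    then have "(\<lambda>n. w n x - w 0 x) \<longlonglongrightarrow> (\<Sum>k. w (Suc k) x - w k x)"
      unfolding sum_lessThan_telescope[of "\<lambda>k. w k x"] .
    from tendsto_add[OF this tendsto_const[of "w 0 x"]] show ?case
      by (auto simp: convergent_def)
  qed
qed

text \<open>Radii are chosen so fast that convergence holds both in mean square and almost
  everywhere. The limit \<open>g\<close> is then shown to have the conjugate function as its Poisson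
  integral, which upgrades convergence along the chosen radii to convergence along all radii, as the
  principal value requires.\<close>

lemma conj_poisson_L2_limit:
  assumes f: "integrable circle_haar f" and f2: "integrable circle_haar (\<lambda>w. (f w)\<^sup>2)"
  obtains g r where "g \<in> borel_measurable circle_borel" "integrable circle_haar (\<lambda>z. (g z)\<^sup>2)"
    "\<And>n::nat. 0 < r n" "\<And>n. r n < 1" "r \<longlonglongrightarrow> 1"
    "\<And>n. integrable circle_haar (\<lambda>z. (Im (herglotz_int f (of_real (r n) * z)) - g z)\<^sup>2)"
    "(\<lambda>n. \<integral>z. (Im (herglotz_int f (of_real (r n) * z)) - g z)\<^sup>2 \<partial>circle_haar) \<longlonglongrightarrow> 0"
    "AE z in circle_haar. circle_hilbert f z = g z"
proof -
  have fm [measurable]: "f \<in> borel_measurable circle_borel"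
    using borel_measurable_integrable[OF f] by simp
  define F where "F = herglotz_int f"
  have F: "F holomorphic_on ball 0 1" unfolding F_def by (rule herglotz_int_holomorphic[OF f])
  define r0 :: "nat \<Rightarrow> real" where "r0 n = 1 - 1 / (real n + 2)" for n
  have r0: "0 < r0 n" "r0 n < 1" for n by (auto simp: r0_def field_simps)
  have r0l: "r0 \<longlonglongrightarrow> 1" unfolding r0_def by real_asymp
  define b where "b n = (\<integral>z. (Re (F (of_real (r0 n) * z)) - f z)\<^sup>2 \<partial>circle_haar)" for n
  have b: "b \<longlonglongrightarrow> 0"
    unfolding b_def F_def by (rule Re_herglotz_int_L2_tendsto[OF f f2 r0 r0l])
  have b0: "0 \<le> b n" for n by (simp add: b_def)
  \<comment> \<open>Geometrically small errors make consecutive differences summable in the mean.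
    Requiring \<open>N \<ge> k\<close> makes the selected indices tend to infinity.\<close>
  have "\<exists>N\<ge>k. b N \<le> (1/4) ^ k" for k :: nat
  proof -
    have "\<forall>\<^sub>F n in sequentially. b n < (1/4) ^ k"
      using b by (rule order_tendstoD) simp
    then obtain N where "\<And>n. n \<ge> N \<Longrightarrow> b n < (1/4) ^ k" by (auto simp: eventually_sequentially)
    then show ?thesis by (intro exI[of _ "max N k"]) (auto intro: less_imp_le)
  qed
  then obtain s where s: "\<And>k. s k \<ge> k" "\<And>k. b (s k) \<le> (1/4) ^ k" by metis
  define r where "r k = r0 (s k)" for k
  have r: "0 < r n" "r n < 1" for n using r0 by (auto simp: r_def)
  have "filterlim s at_top sequentially"
    using s(1) by (intro filterlim_at_top_mono[OF filterlim_ident]) (auto intro: always_eventually)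
  then have rl: "r \<longlonglongrightarrow> 1" unfolding r_def by (rule filterlim_compose[OF r0l])
  define w where "w k z = Im (F (of_real (r k) * z))" for k z
  define u where "u k z = Re (F (of_real (r k) * z))" for k z
  have wm [measurable]: "w k \<in> borel_measurable circle_borel" "u k \<in> borel_measurable circle_borel" for k
    unfolding w_def u_def F_def by measurable
  have Fc: "continuous_on (sphere 0 1) (\<lambda>z. F (of_real (r k) * z))" for k
    unfolding F_def using r[of k] by (intro continuous_on_herglotz_int_dilate f) auto
  have wc: "continuous_on (sphere 0 1) (w k)" "continuous_on (sphere 0 1) (u k)" for k
    unfolding w_def u_def by (intro continuous_intros Fc)+
  have ufi: "integrable circle_haar (\<lambda>z. (u k z - f z)\<^sup>2)" for k
  proof (rule Bochner_Integration.integrable_bound)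
    show "integrable circle_haar (\<lambda>z. 2 * (u k z)\<^sup>2 + 2 * (f z)\<^sup>2)"
      by (intro Bochner_Integration.integrable_add integrable_mult_right f2 integrable_circle_haar_continuous continuous_intros wc)
    have "(a - c)\<^sup>2 \<le> 2 * a\<^sup>2 + 2 * c\<^sup>2" for a c :: real
      using zero_le_power2[of "a + c"] by (simp add: power2_eq_square algebra_simps)
    then show "AE z in circle_haar. norm ((u k z - f z)\<^sup>2) \<le> norm (2 * (u k z)\<^sup>2 + 2 * (f z)\<^sup>2)"
      by (intro AE_I2) simp
  qed simp
  have wi: "integrable circle_haar (\<lambda>z. (w j z - w k z)\<^sup>2)" for j k
    by (intro integrable_circle_haar_continuous continuous_intros wc)
  have ww: "(\<integral>z. (w j z - w k z)\<^sup>2 \<partial>circle_haar) \<le> 2 * b (s j) + 2 * b (s k)" for j k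
  proof -
    have "(\<integral>z. (w j z - w k z)\<^sup>2 \<partial>circle_haar) = (\<integral>z. (u j z - u k z)\<^sup>2 \<partial>circle_haar)"
      unfolding w_def u_def using r by (intro Re_Im_L2_eq F less_imp_le)
    also have "\<dots> \<le> (\<integral>z. 2 * (u j z - f z)\<^sup>2 + 2 * (u k z - f z)\<^sup>2 \<partial>circle_haar)"
    proof (rule integral_mono)
      show "integrable circle_haar (\<lambda>z. (u j z - u k z)\<^sup>2)"
        by (intro integrable_circle_haar_continuous continuous_intros wc)
      show "integrable circle_haar (\<lambda>z. 2 * (u j z - f z)\<^sup>2 + 2 * (u k z - f z)\<^sup>2)"
        by (intro Bochner_Integration.integrable_add integrable_mult_right ufi)
      show "(u j z - u k z)\<^sup>2 \<le> 2 * (u j z - f z)\<^sup>2 + 2 * (u k z - f z)\<^sup>2" for z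
        using zero_le_power2[of "(u j z - f z) + (u k z - f z)"] by (simp add: power2_eq_square algebra_simps)
    qed
    also have "\<dots> = 2 * b (s j) + 2 * b (s k)"
      using ufi by (simp add: b_def u_def r_def)
    finally show ?thesis .
  qed
  have ww4: "(\<integral>z. (w j z - w k z)\<^sup>2 \<partial>circle_haar) \<le> 4 * (1/4) ^ k" if "j \<ge> k" for j k
  proof -
    have "((1::real)/4) ^ j \<le> (1/4) ^ k" using that by (intro power_decreasing) auto
    then have "b (s j) \<le> (1/4) ^ k" using s(2)[of j] by (rule order_trans[rotated])
    then have "2 * b (s j) + 2 * b (s k) \<le> 2 * (1/4) ^ k + 2 * (1/4) ^ k"
      using s(2)[of k] by (intro add_mono mult_left_mono) auto
    also have "\<dots> = 4 * (1/4) ^ k" by simp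
    finally show ?thesis using ww[of j k] by (rule order_trans[rotated])
  qed
  have wL1: "(\<integral>z. \<bar>w (Suc k) z - w k z\<bar> \<partial>circle_haar) \<le> 2 * (1/2) ^ k" for k
  proof (rule power2_le_imp_le)
    have "(\<integral>z. \<bar>w (Suc k) z - w k z\<bar> \<partial>circle_haar)\<^sup>2 \<le> (\<integral>z. (w (Suc k) z - w k z)\<^sup>2 \<partial>circle_haar)"
      by (rule haar.square_expectation_abs_le(2)[OF wi]) simp
    also have "\<dots> \<le> 4 * (1/4) ^ k" by (intro ww4) simp
    also have "\<dots> = (2 * (1/2) ^ k)\<^sup>2"
    proof -
      have "(1/4::real) ^ k = ((1/2) * (1/2)) ^ k" by simp
      then show ?thesis by (simp only: power_mult_distrib power2_eq_square)
    qed
    finally show "(\<integral>z. \<bar>w (Suc k) z - w k z\<bar> \<partial>circle_haar)\<^sup>2 \<le> (2 * (1/2) ^ k)\<^sup>2" .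
  qed simp
  have geo: "summable (\<lambda>k. (1/2::real) ^ k)" by (rule summable_geometric) simp
  have conv: "AE z in circle_haar. convergent (\<lambda>k. w k z)"
  proof (rule AE_convergent_summable_L1)
    show "integrable circle_haar (\<lambda>z. w (Suc k) z - w k z)" for k
      by (intro integrable_circle_haar_continuous continuous_intros wc)
    show "summable (\<lambda>k. \<integral>z. \<bar>w (Suc k) z - w k z\<bar> \<partial>circle_haar)"
    proof (rule summable_comparison_test'[where N=0])
      show "summable (\<lambda>k. 2 * (1/2::real) ^ k)" by (rule summable_mult[OF geo])
      show "norm (\<integral>z. \<bar>w (Suc k) z - w k z\<bar> \<partial>circle_haar) \<le> 2 * (1/2) ^ k" for k
        using wL1[of k] by simp
    qed
  qed simp
  \<comment> \<open>\<open>lim\<close> gives a function that is defined and measurable everywhere;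
    it is the actual limit off a null set.\<close>
  define g where "g z = lim (\<lambda>k. w k z)" for z
  have gm [measurable]: "g \<in> borel_measurable circle_borel"
    unfolding g_def by measurable
  have wg: "AE z in circle_haar. (\<lambda>k. w k z) \<longlonglongrightarrow> g z"
    using conv by eventually_elim (simp add: g_def convergent_LIMSEQ_iff)
  \<comment> \<open>Fatou in \<open>j\<close> turns the Cauchy bound for \<open>w j - w k\<close>
    into a bound for the distance from \<open>w k\<close> to the limit.\<close>
  have wgn: "(\<integral>\<^sup>+z. ennreal ((w k z - g z)\<^sup>2) \<partial>circle_haar) \<le> ennreal (4 * (1/4) ^ k)" for k
  proof -
    have "AE z in circle_haar. liminf (\<lambda>j. ennreal ((w j z - w k z)\<^sup>2)) = ennreal ((w k z - g z)\<^sup>2)"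
      using wg
    proof eventually_elim
      case (elim z)
      then have "(\<lambda>j. ennreal ((w j z - w k z)\<^sup>2)) \<longlonglongrightarrow> ennreal ((g z - w k z)\<^sup>2)"
        by (intro tendsto_ennrealI tendsto_intros)
      then show ?case by (subst power2_commute) (intro lim_imp_Liminf, auto)
    qed
    then have "(\<integral>\<^sup>+z. ennreal ((w k z - g z)\<^sup>2) \<partial>circle_haar) = (\<integral>\<^sup>+z. liminf (\<lambda>j. ennreal ((w j z - w k z)\<^sup>2)) \<partial>circle_haar)"
      by (intro nn_integral_cong_AE) auto
    also have "\<dots> \<le> liminf (\<lambda>j. \<integral>\<^sup>+z. ennreal ((w j z - w k z)\<^sup>2) \<partial>circle_haar)"
      by (intro nn_integral_liminf) measurable
    also have "(\<lambda>j. \<integral>\<^sup>+z. ennreal ((w j z - w k z)\<^sup>2) \<partial>circle_haar) = (\<lambda>j. ennreal (\<integral>z. (w j z - w k z)\<^sup>2 \<partial>circle_haar))"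
      by (intro ext nn_integral_eq_integral wi) auto
    also have "liminf \<dots> \<le> limsup \<dots>" by (rule Liminf_le_Limsup) simp
    also have "\<dots> \<le> ennreal (4 * (1/4) ^ k)"
      by (intro Limsup_bounded eventually_sequentiallyI[of k] ennreal_leI ww4)
    finally show ?thesis .
  qed
  have wgi: "integrable circle_haar (\<lambda>z. (w k z - g z)\<^sup>2)" for k
    using wgn[of k] by (intro integrableI_bounded) (auto simp: le_less_trans)
  have wgb: "(\<integral>z. (w k z - g z)\<^sup>2 \<partial>circle_haar) \<le> 4 * (1/4) ^ k" for k
    using wgn[of k] wgi[of k] by (subst (asm) nn_integral_eq_integral) auto
  have l4: "(\<lambda>k. 4 * (1/4) ^ k :: real) \<longlonglongrightarrow> 0" by real_asymp
  have wgl: "(\<lambda>k. \<integral>z. (w k z - g z)\<^sup>2 \<partial>circle_haar) \<longlonglongrightarrow> 0"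
    by (rule tendsto_sandwich[OF _ _ tendsto_const l4]) (auto intro!: always_eventually wgb)
  have g2: "integrable circle_haar (\<lambda>z. (g z)\<^sup>2)"
  proof (rule Bochner_Integration.integrable_bound)
    show "integrable circle_haar (\<lambda>z. 2 * (w 0 z - g z)\<^sup>2 + 2 * (w 0 z)\<^sup>2)"
      by (intro Bochner_Integration.integrable_add integrable_mult_right wgi integrable_circle_haar_continuous continuous_intros wc)
    have "c\<^sup>2 \<le> 2 * (a - c)\<^sup>2 + 2 * a\<^sup>2" for a c :: real
      using zero_le_power2[of "2 * a - c"] by (simp add: power2_eq_square algebra_simps)
    then show "AE z in circle_haar. norm ((g z)\<^sup>2) \<le> norm (2 * (w 0 z - g z)\<^sup>2 + 2 * (w 0 z)\<^sup>2)"
      by (intro AE_I2) simp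
  qed simp
  have gi: "integrable circle_haar g"
    using haar.square_expectation_abs_le(1)[OF g2] by simp
  \<comment> \<open>For fixed \<open>t\<close>, let \<open>k\<close> tend to infinity in the Poisson
    formula for the dilate of radius \<open>r k\<close>. One side converges in the mean against a
    bounded kernel, the other by continuity of \<open>F\<close> inside the disc.\<close>
  have Pg: "Re (herglotz_int g (of_real t * \<zeta>)) = Im (F (of_real t * \<zeta>))"
    if t: "0 \<le> t" "t < 1" and \<zeta>: "cmod \<zeta> = 1" for t \<zeta>
  proof -
    have tz: "cmod (of_real t * \<zeta>) < 1" using t \<zeta> by (simp add: norm_mult)
    define B where "B = 2 / (1 - cmod (of_real t * \<zeta>))"
    have pB: "\<bar>poisson (of_real t * \<zeta>) z\<bar> \<le> B" if "cmod z = 1" for z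
      unfolding B_def using norm_herglotz_le[OF tz that] abs_Re_le_cmod[of "herglotz (of_real t * \<zeta>) z"] by linarith
    have wgi1: "integrable circle_haar (\<lambda>z. w k z - g z)" for k
      using haar.square_expectation_abs_le(1)[OF wgi] by simp
    have eq: "(\<integral>z. w k z * poisson (of_real t * \<zeta>) z \<partial>circle_haar) = Im (F (of_real (r k * t) * \<zeta>))" for k
      unfolding w_def using r[of k] by (intro poisson_Im_semigroup F t \<zeta>) auto
    have "(\<lambda>k. F (of_real (r k * t) * \<zeta>)) \<longlonglongrightarrow> F (of_real (1 * t) * \<zeta>)"
    proof (rule continuous_on_tendsto_compose[OF holomorphic_on_imp_continuous_on[OF F]])
      show "(\<lambda>k. of_real (r k * t) * \<zeta>) \<longlonglongrightarrow> of_real (1 * t) * \<zeta>"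
        by (intro tendsto_intros rl)
      have "cmod (of_real (r k * t) * \<zeta>) < 1" for k
        using r[of k] t \<zeta> mult_strict_mono[of "r k" 1 t 1] by (cases "t = 0") (auto simp: norm_mult abs_mult)
      then show "\<forall>\<^sub>F k in sequentially. of_real (r k * t) * \<zeta> \<in> ball 0 1"
        by (intro always_eventually) simp
    qed (use tz in simp)
    then have 1: "(\<lambda>k. \<integral>z. w k z * poisson (of_real t * \<zeta>) z \<partial>circle_haar) \<longlonglongrightarrow> Im (F (of_real t * \<zeta>))"
      unfolding eq by (auto intro: tendsto_Im)
    have "(\<lambda>k. \<integral>z. w k z * poisson (of_real t * \<zeta>) z \<partial>circle_haar) \<longlonglongrightarrow> (\<integral>z. g z * poisson (of_real t * \<zeta>) z \<partial>circle_haar)"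
    proof (rule LIM_zero_cancel, rule Lim_null_comparison)
      show "(\<lambda>k. B * sqrt (4 * (1/4) ^ k)) \<longlonglongrightarrow> 0"
        using tendsto_mult_left[OF tendsto_real_sqrt[OF l4], of B] by simp
      show "\<forall>\<^sub>F k in sequentially. norm ((\<integral>z. w k z * poisson (of_real t * \<zeta>) z \<partial>circle_haar) - (\<integral>z. g z * poisson (of_real t * \<zeta>) z \<partial>circle_haar)) \<le> B * sqrt (4 * (1/4) ^ k)"
      proof (intro always_eventually allI)
        fix k
        have "(\<integral>z. w k z * poisson (of_real t * \<zeta>) z \<partial>circle_haar) - (\<integral>z. g z * poisson (of_real t * \<zeta>) z \<partial>circle_haar)
            = (\<integral>z. (w k z - g z) * poisson (of_real t * \<zeta>) z \<partial>circle_haar)"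
          using integrable_times_poisson(1)[OF integrable_circle_haar_continuous[OF wc(1)] tz] integrable_times_poisson(1)[OF gi tz]
          by (simp add: left_diff_distrib)
        also have "norm \<dots> \<le> (\<integral>z. \<bar>w k z - g z\<bar> * B \<partial>circle_haar)"
          unfolding real_norm_def
        proof (rule order_trans[OF integral_abs_bound], rule integral_mono_AE)
          show "AE z in circle_haar. \<bar>(w k z - g z) * poisson (of_real t * \<zeta>) z\<bar> \<le> \<bar>w k z - g z\<bar> * B"
            using pB by (intro AE_I2) (auto simp: abs_mult intro!: mult_left_mono)
          show "integrable circle_haar (\<lambda>z. \<bar>(w k z - g z) * poisson (of_real t * \<zeta>) z\<bar>)"
            by (intro integrable_abs integrable_times_poisson wgi1 tz)
          show "integrable circle_haar (\<lambda>z. \<bar>w k z - g z\<bar> * B)"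
            using wgi1 by (intro integrable_mult_left integrable_abs)
        qed
        also have "\<dots> = B * (\<integral>z. \<bar>w k z - g z\<bar> \<partial>circle_haar)" by simp
        also have "\<dots> \<le> B * sqrt (4 * (1/4) ^ k)"
        proof (rule mult_left_mono)
          have "(\<integral>z. \<bar>w k z - g z\<bar> \<partial>circle_haar)\<^sup>2 \<le> 4 * (1/4) ^ k"
            using haar.square_expectation_abs_le(2)[OF wgi[of k]] wgb[of k] by simp
          then show "(\<integral>z. \<bar>w k z - g z\<bar> \<partial>circle_haar) \<le> sqrt (4 * (1/4) ^ k)" by (rule real_le_rsqrt)
          show "0 \<le> B" unfolding B_def using tz by simp
        qed
        finally show "norm ((\<integral>z. w k z * poisson (of_real t * \<zeta>) z \<partial>circle_haar) - (\<integral>z. g z * poisson (of_real t * \<zeta>) z \<partial>circle_haar)) \<le> B * sqrt (4 * (1/4) ^ k)" .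
      qed
    qed
    from LIMSEQ_unique[OF 1 this] show ?thesis by (simp add: Re_herglotz_int[OF gi tz])
  qed
  \<comment> \<open>At a common Poisson point of \<open>f\<close> and \<open>g\<close>, the Poisson
    integral of \<open>g\<close> tends to \<open>g z\<close> along all radii. It equals
    \<open>Im F\<close>, whose radial limit is the value of the principal value.\<close>
  have hil: "AE z in circle_haar. circle_hilbert f z = g z"
    using AE_poisson_point[OF f] AE_poisson_point[OF gi] AE_space
  proof eventually_elim
    case (elim z)
    then have z: "cmod z = 1" by simp
    have "\<forall>\<^sub>F t in at_left (1::real). t \<in> {0<..<1}"
      by (rule eventually_at_leftI[of 0]) auto
    then have "\<forall>\<^sub>F t in at_left 1. Re (herglotz_int g (of_real t * z)) = Im (F (of_real t * z))"
      by eventually_elim (use Pg z in auto)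
    from tendsto_cong[THEN iffD1, OF this poisson_point_limit[OF gi z elim(2)]]
    show ?case
      unfolding F_def by (rule circle_hilbert_eq[OF f z elim(1)])
  qed
  show thesis
    by (rule that[of g r, OF gm g2 r rl]) (use wgi wgl hil in \<open>simp_all add: w_def F_def\<close>)
qed

section \<open>Free entropy\<close>

text \<open>Chords of the circle have length at most 2, so the shift by \<open>ln 2\<close> makes
  the kernel nonnegative there. With values in \<open>ennreal\<close>, Tonelli and Fatou apply
  directly and the diagonal carries its true value \<infinity>.\<close>

definition energy_kernel :: "complex \<Rightarrow> complex \<Rightarrow> ennreal" where
  "energy_kernel z w = (if z = w then \<infinity> else ennreal (ln 2 - ln (cmod (z - w))))"

definition log_energy :: "complex measure \<Rightarrow> ennreal" where
  "log_energy M = (\<integral>\<^sup>+z. (\<integral>\<^sup>+w. energy_kernel z w \<partial>M) \<partial>M)"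

lemma energy_kernel_commute: "energy_kernel z w = energy_kernel w z"
  by (simp add: energy_kernel_def norm_minus_commute)

lemma measurable_energy_kernel [measurable]:
  fixes f g :: "'a \<Rightarrow> complex"
  assumes f: "f \<in> borel_measurable M" and g: "g \<in> borel_measurable M"
  shows "(\<lambda>x. energy_kernel (f x) (g x)) \<in> borel_measurable M"
proof -
  have [measurable]: "(\<lambda>x. cmod (f x - g x)) \<in> borel_measurable M"
    by (rule measurable_compose[OF borel_measurable_diff[OF f g] borel_measurable_continuous_onI[of norm]])
       (intro continuous_intros)
  show ?thesis
    unfolding energy_kernel_def
  proof (rule measurable_If)
    show "{x \<in> space M. f x = g x} \<in> sets M" 
      using borel_measurable_eq[of "\<lambda>x. cmod (f x - g x)" M "\<lambda>_. 0"] by simp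
  qed measurable
qed

lemma measurable_log_kernel [measurable]:
  fixes f g :: "'a \<Rightarrow> complex"
  assumes f: "f \<in> borel_measurable M" and g: "g \<in> borel_measurable M"
  shows "(\<lambda>x. log_kernel (f x) (g x)) \<in> borel_measurable M"
proof -
  have [measurable]: "(\<lambda>x. cmod (f x - g x)) \<in> borel_measurable M"
    by (rule measurable_compose[OF borel_measurable_diff[OF f g] borel_measurable_continuous_onI[of norm]])
       (intro continuous_intros)
  show ?thesis
    unfolding log_kernel_def
  proof (rule measurable_If)
    show "{x \<in> space M. f x = g x} \<in> sets M" 
      using borel_measurable_eq[of "\<lambda>x. cmod (f x - g x)" M "\<lambda>_. 0"] by simp
  qed measurable
qed

lemma ln_norm_diff_circle_le:
  assumes "cmod z = 1" "cmod w \<le> 1" "z \<noteq> w"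
  shows "ln (cmod (z - w)) \<le> ln 2"
  using assms norm_triangle_ineq4[of z w] by (subst ln_le_cancel_iff) auto

text \<open>Pointwise, the negative part of the logarithm plus \<open>ln 2\<close> equals the
  shifted kernel plus the positive part. The positive part is at most \<open>ln 2\<close>, so its
  integral is finite and cancels.\<close>

lemma free_entropy_eq:
  assumes M: "M \<in> circle_prob_measures"
  shows "free_entropy M = ereal (ln 2) - enn2ereal (log_energy M)"
proof -
  interpret M: prob_space M using M by (simp add: circle_prob_measures_def)
  interpret pair_prob_space M M by unfold_locales
  have sM [measurable_cong]: "sets M = sets circle_borel" using M by (simp add: circle_prob_measures_def)
  have spM: "space M = sphere 0 1" using sets_eq_imp_space_eq[OF sM] by simp
  define A where "A = (\<integral>\<^sup>+x. e2ennreal (log_kernel (fst x) (snd x)) \<partial>(M \<Otimes>\<^sub>M M))"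
  define B where "B = (\<integral>\<^sup>+x. e2ennreal (- log_kernel (fst x) (snd x)) \<partial>(M \<Otimes>\<^sub>M M))"
  have mult: "emeasure (M \<Otimes>\<^sub>M M) (space (M \<Otimes>\<^sub>M M)) = 1" by (rule P.emeasure_space_1)
  have lk: "e2ennreal (- log_kernel z w) + ennreal (ln 2) = energy_kernel z w + e2ennreal (log_kernel z w)"
    "e2ennreal (log_kernel z w) \<le> ennreal (ln 2)"
    if "z \<in> space M" "w \<in> space M" for z w
  proof -
    consider "z = w" | "z \<noteq> w" by auto
    then have "e2ennreal (- log_kernel z w) + ennreal (ln 2) = energy_kernel z w + e2ennreal (log_kernel z w) \<and> e2ennreal (log_kernel z w) \<le> ennreal (ln 2)"
    proof cases
      case 1
      then show ?thesis by (simp add: log_kernel_def energy_kernel_def e2ennreal_infty e2ennreal_neg)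
    next
      case 2
      define x where "x = ln (cmod (z - w))"
      have x: "x \<le> ln 2" unfolding x_def using 2 that spM by (intro ln_norm_diff_circle_le) auto
      have "ennreal (- x) + ennreal (ln 2) = ennreal (ln 2 - x) + ennreal x"
      proof (cases "0 \<le> x")
        case True
        then show ?thesis using x by (simp add: ennreal_neg flip: ennreal_plus)
      next
        case False
        then show ?thesis using x by (simp add: ennreal_neg flip: ennreal_plus)
      qed
      then show ?thesis using 2 x by (simp add: log_kernel_def energy_kernel_def e2ennreal_ereal x_def[symmetric] ennreal_leI)
    qed
    then show "e2ennreal (- log_kernel z w) + ennreal (ln 2) = energy_kernel z w + e2ennreal (log_kernel z w)"
      "e2ennreal (log_kernel z w) \<le> ennreal (ln 2)" by auto
  qed
  have N: "log_energy M = (\<integral>\<^sup>+x. energy_kernel (fst x) (snd x) \<partial>(M \<Otimes>\<^sub>M M))"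
  proof -
    have "(\<lambda>x. energy_kernel (fst x) (snd x)) \<in> borel_measurable (M \<Otimes>\<^sub>M M)" by measurable
    from M.nn_integral_fst[OF this] show ?thesis by (simp add: log_energy_def)
  qed
  have "B + ennreal (ln 2) = (\<integral>\<^sup>+x. e2ennreal (- log_kernel (fst x) (snd x)) + ennreal (ln 2) \<partial>(M \<Otimes>\<^sub>M M))"
    unfolding B_def by (subst nn_integral_add) (auto simp: mult)
  also have "\<dots> = (\<integral>\<^sup>+x. energy_kernel (fst x) (snd x) + e2ennreal (log_kernel (fst x) (snd x)) \<partial>(M \<Otimes>\<^sub>M M))"
    by (intro nn_integral_cong lk) (auto simp: space_pair_measure)
  also have "\<dots> = log_energy M + A"
    unfolding A_def N by (rule nn_integral_add) auto
  finally have BA: "B + ennreal (ln 2) = log_energy M + A" .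
  have "A \<le> (\<integral>\<^sup>+x. ennreal (ln 2) \<partial>(M \<Otimes>\<^sub>M M))"
    unfolding A_def by (intro nn_integral_mono lk) (auto simp: space_pair_measure)
  also have "\<dots> = ennreal (ln 2)" by (simp add: mult)
  finally have "A < \<top>" by (simp add: le_less_trans)
  then obtain a where a: "A = ennreal a" "0 \<le> a" by (cases A) auto
  have FE: "free_entropy M = enn2ereal A - enn2ereal B"
    unfolding free_entropy_def A_def B_def by (simp add: case_prod_beta')
  show ?thesis
  proof (cases "log_energy M")
    case top
    then have "B = \<top>" using BA by (cases B) (auto simp flip: ennreal_plus)
    then show ?thesis using top a by (simp add: FE enn2ereal_ennreal)
  next
    case (real n)
    then have "B \<noteq> \<top>" using BA a by (auto simp flip: ennreal_plus)
    then obtain b where b: "B = ennreal b" "0 \<le> b" by (cases B) auto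
    have "ennreal (b + ln 2) = ennreal (n + a)"
      using BA a b real by simp
    then have "b + ln 2 = n + a"
      using a b real by (subst (asm) ennreal_inj) auto
    then show ?thesis using a b real by (simp add: FE enn2ereal_ennreal)
  qed
qed

lemma distr_cis_circle_prob:
  assumes "prob_space S" and X: "X \<in> borel_measurable S"
  shows "distr S circle_borel (\<lambda>s. cis (X s)) \<in> circle_prob_measures"
  unfolding circle_prob_measures_def
  using assms by (auto intro!: prob_space.prob_space_distr)

lemma log_energy_distr:
  assumes "prob_space S" and [measurable]: "X \<in> borel_measurable S"
  shows "log_energy (distr S circle_borel (\<lambda>s. cis (X s))) = (\<integral>\<^sup>+s. (\<integral>\<^sup>+t. energy_kernel (cis (X s)) (cis (X t)) \<partial>S) \<partial>S)"
proof -
  interpret S: prob_space S by fact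
  have 1: "(\<integral>\<^sup>+w. energy_kernel z w \<partial>distr S circle_borel (\<lambda>s. cis (X s))) = (\<integral>\<^sup>+t. energy_kernel z (cis (X t)) \<partial>S)" for z
    by (subst nn_integral_distr) auto
  have cm [measurable]: "cis \<in> borel_measurable borel"
    by (intro borel_measurable_continuous_onI continuous_intros)
  have 2: "(\<lambda>z. \<integral>\<^sup>+t. energy_kernel z (cis (X t)) \<partial>S) \<in> borel_measurable circle_borel"
    by (rule S.borel_measurable_nn_integral) measurable
  show ?thesis
    unfolding log_energy_def 1 by (subst nn_integral_distr) (use 2 in auto)
qed

text \<open>The kernel is continuous off the diagonal. On it, approaching pairs eventually exceed
  every finite level, whether or not they coincide themselves.\<close>

lemma energy_kernel_lsc:
  assumes z: "zs \<longlonglongrightarrow> z" and w: "ws \<longlonglongrightarrow> w"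
  shows "energy_kernel z w \<le> liminf (\<lambda>n. energy_kernel (zs n) (ws n))"
proof (cases "z = w")
  case False
  have d: "(\<lambda>n. cmod (zs n - ws n)) \<longlonglongrightarrow> cmod (z - w)" by (intro tendsto_intros z w)
  then have "(\<lambda>n. ennreal (ln 2 - ln (cmod (zs n - ws n)))) \<longlonglongrightarrow> ennreal (ln 2 - ln (cmod (z - w)))"
    using False by (intro tendsto_ennrealI tendsto_diff tendsto_const tendsto_ln) auto
  moreover have "\<forall>\<^sub>F n in sequentially. 0 < cmod (zs n - ws n)"
    using d False by (intro order_tendstoD(1)[OF d]) auto
  then have "\<forall>\<^sub>F n in sequentially. ennreal (ln 2 - ln (cmod (zs n - ws n))) = energy_kernel (zs n) (ws n)"
    by eventually_elim (auto simp: energy_kernel_def)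
  ultimately have "(\<lambda>n. energy_kernel (zs n) (ws n)) \<longlonglongrightarrow> ennreal (ln 2 - ln (cmod (z - w)))"
    by (rule Lim_transform_eventually)
  then have "liminf (\<lambda>n. energy_kernel (zs n) (ws n)) = ennreal (ln 2 - ln (cmod (z - w)))"
    by (intro lim_imp_Liminf) auto
  then show ?thesis using False by (simp add: energy_kernel_def)
next
  case True
  have d: "(\<lambda>n. cmod (zs n - ws n)) \<longlonglongrightarrow> 0" using tendsto_norm[OF tendsto_diff[OF z w]] True by simp
  show ?thesis unfolding le_Liminf_iff
  proof (intro allI impI)
    fix y assume "y < energy_kernel z w"
    then obtain c where c: "y = ennreal c" "0 \<le> c" using True by (cases y) (auto simp: energy_kernel_def)
    have "\<forall>\<^sub>F n in sequentially. cmod (zs n - ws n) < exp (ln 2 - c)"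
      by (rule order_tendstoD(2)[OF d]) simp
    then show "\<forall>\<^sub>F n in sequentially. y < energy_kernel (zs n) (ws n)"
    proof eventually_elim
      case (elim n)
      show ?case
      proof (cases "zs n = ws n")
        case False
        then have "ln (cmod (zs n - ws n)) < ln (exp (ln 2 - c))" using elim by (subst ln_less_cancel_iff) auto
        then have "c < ln 2 - ln (cmod (zs n - ws n))" by simp
        then have "ennreal c < ennreal (ln 2 - ln (cmod (zs n - ws n)))"
          using c(2) by (intro ennreal_lessI) linarith+
        then show ?thesis using False by (simp only: energy_kernel_def if_False c(1))
      qed (simp add: energy_kernel_def c)
    qed
  qed
qed

text \<open>Fatou in each variable. Measures are represented by random variables on one space,
  because pointwise convergence is what a weakly convergent sequence offers after a Skorohod
  representation.\<close>

lemma log_energy_lsc: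
  assumes S: "prob_space S" and [measurable]: "\<And>n. Y n \<in> borel_measurable S" "X \<in> borel_measurable S"
    and lim: "\<And>s. s \<in> space S \<Longrightarrow> (\<lambda>n. Y n s) \<longlonglongrightarrow> X s"
  shows "log_energy (distr S circle_borel (\<lambda>s. cis (X s))) \<le> liminf (\<lambda>n. log_energy (distr S circle_borel (\<lambda>s. cis (Y n s))))"
proof -
  interpret S: prob_space S by fact
  have cm [measurable]: "cis \<in> borel_measurable borel"
    by (intro borel_measurable_continuous_onI continuous_intros)
  have cl: "(\<lambda>n. cis (Y n s)) \<longlonglongrightarrow> cis (X s)" if "s \<in> space S" for s
    using lim[OF that] by (intro tendsto_cis)
  have "(\<integral>\<^sup>+s. (\<integral>\<^sup>+t. energy_kernel (cis (X s)) (cis (X t)) \<partial>S) \<partial>S)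
      \<le> (\<integral>\<^sup>+s. (\<integral>\<^sup>+t. liminf (\<lambda>n. energy_kernel (cis (Y n s)) (cis (Y n t))) \<partial>S) \<partial>S)"
    by (intro nn_integral_mono energy_kernel_lsc cl)
  also have "\<dots> \<le> (\<integral>\<^sup>+s. liminf (\<lambda>n. \<integral>\<^sup>+t. energy_kernel (cis (Y n s)) (cis (Y n t)) \<partial>S) \<partial>S)"
    by (intro nn_integral_mono nn_integral_liminf) measurable
  also have "\<dots> \<le> liminf (\<lambda>n. \<integral>\<^sup>+s. (\<integral>\<^sup>+t. energy_kernel (cis (Y n s)) (cis (Y n t)) \<partial>S) \<partial>S)"
    by (intro nn_integral_liminf) measurable
  finally show ?thesis by (simp add: log_energy_distr S)
qed

section \<open>Existence of the equilibrium measure\<close>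

lemma tight_bounded_support:
  assumes "\<And>n. real_distribution (\<mu> n)" and "a < b" "\<And>n. measure (\<mu> n) {a<..b} = 1"
  shows "tight \<mu>"
  unfolding tight_def
proof (intro conjI allI impI)
  fix e :: real assume "0 < e"
  then show "\<exists>a b. a < b \<and> (\<forall>n. 1 - e < measure (\<mu> n) {a<..b})"
    using assms by (intro exI[of _ a] exI[of _ b]) auto
qed (rule assms)

text \<open>Cutting the circle open turns its measures into real distributions, to which Helly
  selection, the Skorohod representation and quantile functions apply. Pushing forward by
  \<open>cis\<close> undoes the cut.\<close>

definition arg_distr :: "complex measure \<Rightarrow> real measure" where
  "arg_distr M = distr M borel Arg"

context
  fixes M assumes M: "M \<in> circle_prob_measures"
begin

lemma circle_prob_space: "prob_space M" and circle_prob_sets: "sets M = sets circle_borel"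
  and circle_prob_space_eq: "space M = sphere 0 1"
  using M sets_eq_imp_space_eq[of M circle_borel] by (auto simp: circle_prob_measures_def)

lemma measurable_circle_prob_iff: "measurable M N = measurable circle_borel N"
  by (rule measurable_cong_sets[OF circle_prob_sets refl])

lemma arg_distr_real_distribution: "real_distribution (arg_distr M)"
proof -
  interpret prob_space M by (rule circle_prob_space)
  show ?thesis
    unfolding arg_distr_def
    by (intro real_distribution_distr) (simp add: measurable_circle_prob_iff)
qed

lemma arg_distr_support: "measure (arg_distr M) {-pi<..pi} = 1"
proof -
  interpret prob_space M by (rule circle_prob_space)
  have "Arg -` {-pi<..pi} \<inter> space M = space M" using Arg_bounded by auto
  then show ?thesis
    unfolding arg_distr_def
    by (subst measure_distr) (auto simp: measurable_circle_prob_iff prob_space)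
qed

lemma distr_cis_arg_distr: "distr (arg_distr M) circle_borel cis = M"
proof -
  have "distr (arg_distr M) circle_borel cis = distr M circle_borel (cis \<circ> Arg)"
    unfolding arg_distr_def by (rule distr_distr) (auto simp: measurable_circle_prob_iff)
  also have "\<dots> = distr M M (\<lambda>z. z)"
    using cis_Arg_circle by (intro distr_cong) (auto simp: circle_prob_sets circle_prob_space_eq)
  finally show ?thesis by (simp add: distr_id)
qed

end

lemma liminf_add_ge_ennreal:
  fixes f g :: "nat \<Rightarrow> ennreal"
  shows "liminf f + liminf g \<le> liminf (\<lambda>n. f n + g n)"
proof -
  have inc: "incseq (\<lambda>n. INF m\<in>{n..}. h m)" for h :: "nat \<Rightarrow> ennreal"
    by (intro incseq_SucI INF_superset_mono) auto
  have "liminf f + liminf g = (SUP n. (INF m\<in>{n..}. f m) + (INF m\<in>{n..}. g m))"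
    unfolding liminf_SUP_INF by (rule ennreal_SUP_add[symmetric]) (rule inc)+
  also have "\<dots> \<le> (SUP n. INF m\<in>{n..}. f m + g m)"
    by (intro SUP_mono' INF_greatest add_mono INF_lower)
  finally show ?thesis unfolding liminf_SUP_INF .
qed

text \<open>Continuity is known only for the periodic function on the line. Composition with
  \<open>Arg\<close>, which jumps but is measurable, carries it to the circle as
  measurability.\<close>

lemma measurable_circle_of_cis:
  fixes f :: "complex \<Rightarrow> real"
  assumes "continuous_on UNIV (\<lambda>t. f (cis t))"
  shows "f \<in> borel_measurable circle_borel"
  using measurable_compose[OF Arg_measurable borel_measurable_continuous_onI[OF assms]]
  by (subst measurable_cong[of _ _ "\<lambda>z. f (cis (Arg z))"]) (auto simp: cis_Arg_circle)

lemma bounded_circle_of_cis: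
  fixes f :: "complex \<Rightarrow> real"
  assumes "continuous_on UNIV (\<lambda>t. f (cis t))"
  obtains C where "\<And>z. cmod z = 1 \<Longrightarrow> \<bar>f z\<bar> \<le> C"
proof -
  have "compact ((\<lambda>t. f (cis t)) ` {-pi..pi})"
    by (intro compact_continuous_image continuous_on_subset[OF assms]) auto
  then obtain C where C: "\<And>t. t \<in> {-pi..pi} \<Longrightarrow> norm (f (cis t)) \<le> C"
    using compact_imp_bounded bounded_iff by (metis imageI)
  show thesis
  proof (rule that)
    fix z :: complex assume "cmod z = 1"
    then show "\<bar>f z\<bar> \<le> C" using C[of "Arg z"] Arg_bounded[of z] cis_Arg_circle[of z] by auto
  qed
qed

text \<open>The direct method: a minimising sequence is tight on the line, a weak limit of a
  subsequence is again a circle measure after \<open>cis\<close>, and the weighted energy is lower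
  semicontinuous. Mass that moves to the end point -pi is harmless, since \<open>cis\<close>
  identifies it with pi.\<close>

lemma equilibrium_measure_mem:
  assumes Q: "continuous_on UNIV (\<lambda>t. Q (cis t))"
  shows "equilibrium_measure Q \<in> circle_prob_measures"
proof -
  let ?S = circle_prob_measures
  note Qm = measurable_circle_of_cis[OF Q]
  obtain C0 where C: "\<And>z. cmod z = 1 \<Longrightarrow> \<bar>Q z\<bar> \<le> C0"
    using bounded_circle_of_cis[OF Q] by blast
  have C': "0 \<le> Q z + C0" if "cmod z = 1" for z
    using C[OF that] by linarith
  \<comment> \<open>The weighted energy shifted by \<open>ln 2 + C0\<close>, so that both summands
    are nonnegative and infima and liminfs can be formed in \<open>ennreal\<close>.\<close>
  define J where "J M = log_energy M + (\<integral>\<^sup>+z. ennreal (Q z + C0) \<partial>M)" for M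
  have WJ: "weighted_energy Q M = enn2ereal (J M) - ereal (ln 2 + C0)" if M: "M \<in> ?S" for M
  proof -
    interpret prob_space M by (rule circle_prob_space[OF M])
    have Qi: "integrable M Q"
      using Qm C by (intro integrable_const_bound[of _ C0]) (auto simp: measurable_circle_prob_iff[OF M] circle_prob_space_eq[OF M])
    have "(\<integral>\<^sup>+z. ennreal (Q z + C0) \<partial>M) = ennreal (\<integral>z. Q z + C0 \<partial>M)"
      using Qi by (intro nn_integral_eq_integral) (auto simp: circle_prob_space_eq[OF M] C' intro!: AE_I2)
    also have "(\<integral>z. Q z + C0 \<partial>M) = (\<integral>z. Q z \<partial>M) + C0"
      using Qi by (simp add: prob_space)
    finally have q: "(\<integral>\<^sup>+z. ennreal (Q z + C0) \<partial>M) = ennreal ((\<integral>z. Q z \<partial>M) + C0)" .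
    have q0: "0 \<le> (\<integral>z. Q z \<partial>M) + C0"
    proof -
      have "0 \<le> (\<integral>z. Q z + C0 \<partial>M)"
        by (intro integral_nonneg_AE AE_I2) (auto simp: circle_prob_space_eq[OF M] C' intro!: AE_I2)
      then show ?thesis using Qi by (simp add: prob_space)
    qed
    show ?thesis
      unfolding weighted_energy_def free_entropy_eq[OF M] J_def q
      using q0 by (cases "log_energy M") (auto simp: enn2ereal_ennreal simp flip: ennreal_plus)
  qed
  obtain M0 where "M0 \<in> ?S"
    using distr_cis_circle_prob[OF prob_space_circle_haar, of "\<lambda>_. 0"] by auto
  then have "J ` ?S \<noteq> {}" by auto
  from Inf_as_limit[OF this] obtain u where "\<And>n. u n \<in> J ` ?S" and ul: "u \<longlonglongrightarrow> Inf (J ` ?S)" by auto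
  then have "\<forall>n. \<exists>M\<in>?S. u n = J M" by auto
  then obtain M where M: "\<And>n::nat. M n \<in> ?S" and uM: "\<And>n. u n = J (M n)" by metis
  define \<mu> where "\<mu> n = arg_distr (M n)" for n
  have rd: "real_distribution (\<mu> n)" for n unfolding \<mu>_def by (rule arg_distr_real_distribution[OF M])
  have "tight \<mu>"
    by (rule tight_bounded_support[of _ "-pi" pi]) (use rd arg_distr_support[OF M] in \<open>auto simp: \<mu>_def\<close>)
  from tight_imp_convergent_subsubsequence[OF this strict_mono_id]
  obtain r N where r: "strict_mono (r :: nat \<Rightarrow> nat)" and N: "real_distribution N" "weak_conv_m (\<mu> \<circ> r) N"
    by auto
  \<comment> \<open>The representation replaces weak convergence by pointwise convergence on one
    probability space, where Fatou can be used.\<close>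
  have "\<exists>(S :: real measure) Y X. prob_space S \<and> (\<forall>n. Y n \<in> borel_measurable S) \<and>
      (\<forall>n. distr S borel (Y n) = (\<mu> \<circ> r) n) \<and> X \<in> S \<rightarrow>\<^sub>M lborel \<and> distr S borel X = N \<and>
      (\<forall>s\<in>space S. (\<lambda>n. Y n s) \<longlonglongrightarrow> X s)"
    by (rule Skorohod) (use rd N in \<open>simp_all add: o_def\<close>)
  then obtain S :: "real measure" and Y X where S: "prob_space S"
    and Ym': "\<forall>n. Y n \<in> borel_measurable S" and Yd': "\<forall>n. distr S borel (Y n) = (\<mu> \<circ> r) n"
    and Xm': "X \<in> S \<rightarrow>\<^sub>M lborel" and lim': "\<forall>s\<in>space S. (\<lambda>n. Y n s) \<longlonglongrightarrow> X s"
    by blast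
  have Ym: "Y n \<in> borel_measurable S" and Yd: "distr S borel (Y n) = \<mu> (r n)" for n
    using Ym' Yd' by simp_all
  have Xm: "X \<in> borel_measurable S" using Xm' by simp
  have lim: "(\<lambda>n. Y n s) \<longlonglongrightarrow> X s" if "s \<in> space S" for s using lim' that by blast
  note [measurable] = Ym Xm
  interpret S: prob_space S by fact
  define L where "L = distr S circle_borel (\<lambda>s. cis (X s))"
  have LS: "L \<in> ?S" unfolding L_def by (rule distr_cis_circle_prob[OF S Xm])
  have MY: "M (r n) = distr S circle_borel (\<lambda>s. cis (Y n s))" for n
  proof -
    have "M (r n) = distr (distr S borel (Y n)) circle_borel cis"
      unfolding Yd \<mu>_def by (rule distr_cis_arg_distr[OF M, symmetric])
    also have "\<dots> = distr S circle_borel (cis \<circ> Y n)" by (rule distr_distr) auto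
    finally show ?thesis by (simp add: o_def)
  qed
  have e: "log_energy L \<le> liminf (\<lambda>n. log_energy (M (r n)))"
    unfolding L_def MY by (rule log_energy_lsc[OF S Ym Xm lim])
  have q: "(\<integral>\<^sup>+z. ennreal (Q z + C0) \<partial>L) \<le> liminf (\<lambda>n. \<integral>\<^sup>+z. ennreal (Q z + C0) \<partial>M (r n))"
  proof -
    have Qc: "(\<lambda>t. Q (cis t)) \<in> borel_measurable borel" by (rule borel_measurable_continuous_onI[OF Q])
    have d: "(\<integral>\<^sup>+z. ennreal (Q z + C0) \<partial>distr S circle_borel (\<lambda>s. cis (W s))) = (\<integral>\<^sup>+s. ennreal (Q (cis (W s)) + C0) \<partial>S)"
      if [measurable]: "W \<in> borel_measurable S" for W
      using Qm by (subst nn_integral_distr) auto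
    have "(\<integral>\<^sup>+s. ennreal (Q (cis (X s)) + C0) \<partial>S) = (\<integral>\<^sup>+s. liminf (\<lambda>n. ennreal (Q (cis (Y n s)) + C0)) \<partial>S)"
    proof (rule nn_integral_cong)
      fix s assume "s \<in> space S"
      then have "(\<lambda>n. Q (cis (Y n s))) \<longlonglongrightarrow> Q (cis (X s))"
        using continuous_on_tendsto_compose[OF Q lim] by auto
      then have "(\<lambda>n. ennreal (Q (cis (Y n s)) + C0)) \<longlonglongrightarrow> ennreal (Q (cis (X s)) + C0)"
        by (intro tendsto_ennrealI tendsto_intros)
      then show "ennreal (Q (cis (X s)) + C0) = liminf (\<lambda>n. ennreal (Q (cis (Y n s)) + C0))"
        by (intro lim_imp_Liminf[symmetric]) auto
    qed
    also have "\<dots> \<le> liminf (\<lambda>n. \<integral>\<^sup>+s. ennreal (Q (cis (Y n s)) + C0) \<partial>S)"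
      using measurable_compose[OF Ym Qc] by (intro nn_integral_liminf) auto
    finally show ?thesis unfolding L_def MY d[OF Xm] d[OF Ym] .
  qed
  have "J L \<le> liminf (\<lambda>n. log_energy (M (r n))) + liminf (\<lambda>n. \<integral>\<^sup>+z. ennreal (Q z + C0) \<partial>M (r n))"
    unfolding J_def by (intro add_mono e q)
  also have "\<dots> \<le> liminf (\<lambda>n. J (M (r n)))"
    unfolding J_def by (rule liminf_add_ge_ennreal)
  also have "\<dots> = Inf (J ` ?S)"
    using LIMSEQ_subseq_LIMSEQ[OF ul r] by (intro lim_imp_Liminf) (auto simp: uM o_def)
  finally have JL: "J L \<le> J M'" if "M' \<in> ?S" for M'
    using that by (meson INF_lower order_trans)
  have "is_arg_min (weighted_energy Q) (\<lambda>x. x \<in> ?S) L"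
    unfolding is_arg_min_linorder
  proof (intro conjI allI impI LS)
    fix M' assume M': "M' \<in> ?S"
    have "enn2ereal (J L) \<le> enn2ereal (J M')" using JL[OF M'] by (simp add: less_eq_ennreal.rep_eq)
    then show "weighted_energy Q L \<le> weighted_energy Q M'"
      unfolding WJ[OF M'] WJ[OF LS] by (rule ereal_minus_mono) simp
  qed
  \<comment> \<open>\<open>equilibrium_measure\<close> is a Hilbert choice; it is known to lie in
    the set only now that a minimiser has been exhibited.\<close>
  then have "is_arg_min (weighted_energy Q) (\<lambda>x. x \<in> ?S) (equilibrium_measure Q)"
    unfolding equilibrium_measure_def arg_min_on_def arg_min_def by (rule someI)
  then show ?thesis by (simp add: is_arg_min_linorder)
qed

text \<open>The logarithmic potential of the Haar measure vanishes on the circle. Pulling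
  \<open>w\<close> inside to radius \<open>r n\<close> gives it exactly by the mean value property;
  lower semicontinuity and Fatou then carry the bound to radius 1.\<close>

lemma nn_integral_energy_kernel_haar:
  assumes z: "cmod z = 1"
  shows "(\<integral>\<^sup>+w. energy_kernel z w \<partial>circle_haar) \<le> ennreal (ln 2)"
proof -
  define r :: "nat \<Rightarrow> real" where "r n = 1 - 1 / (real n + 2)" for n
  have r: "0 < r n" "r n < 1" for n by (auto simp: r_def field_simps)
  have rl: "r \<longlonglongrightarrow> 1" unfolding r_def by real_asymp
  have I: "(\<integral>\<^sup>+w. energy_kernel z (of_real (r n) * w) \<partial>circle_haar) = ennreal (ln 2)" for n
  proof -
    \<comment> \<open>On the circle \<open>z - r w\<close> and \<open>1 - r (cnj z) w\<close> have
      the same modulus, but the latter has positive real part in a disc of radius larger than 1, so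
      its logarithm is holomorphic there. Its value at 0 is 0.\<close>
    define h where "h w = Ln (1 - of_real (r n) * cnj z * w)" for w :: complex
    have h: "h holomorphic_on ball 0 (1 / r n)"
      unfolding h_def
    proof (intro holomorphic_intros)
      fix w :: complex assume "w \<in> ball 0 (1 / r n)"
      then have "cmod (of_real (r n) * cnj z * w) < 1"
        using r[of n] z by (simp add: norm_mult field_simps)
      then have "0 < Re (1 - of_real (r n) * cnj z * w)"
        using complex_Re_le_cmod[of "of_real (r n) * cnj z * w"] by simp
      then show "1 - of_real (r n) * cnj z * w \<notin> \<real>\<^sub>\<le>\<^sub>0"
        by (auto simp: complex_nonpos_Reals_iff)
    qed
    have r1: "1 / r n > 1" using r[of n] by simp
    have "continuous_on (sphere 0 1) h"
      using r1 by (intro continuous_on_subset[OF holomorphic_on_imp_continuous_on[OF h]]) auto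
    then have hi: "integrable circle_haar h" by (rule integrable_circle_haar_continuous)
    have Reh: "Re (h w) = ln (cmod (z - of_real (r n) * w))" and nz: "z \<noteq> of_real (r n) * w" if "cmod w = 1" for w
    proof -
      have zz: "z * cnj z = 1" using z by (simp add: complex_norm_square[symmetric])
      show nz: "z \<noteq> of_real (r n) * w"
      proof
        assume "z = of_real (r n) * w"
        then have "cmod z = r n" using that r[of n] by (simp add: norm_mult)
        then show False using z r[of n] by simp
      qed
      have "1 - of_real (r n) * cnj z * w = cnj z * (z - of_real (r n) * w)"
        using zz by (simp add: algebra_simps)
      then have "cmod (1 - of_real (r n) * cnj z * w) = cmod (z - of_real (r n) * w)"
        using z by (simp add: norm_mult)
      moreover from this have "1 - of_real (r n) * cnj z * w \<noteq> 0" using nz by (metis norm_eq_zero right_minus_eq)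
      ultimately show "Re (h w) = ln (cmod (z - of_real (r n) * w))" unfolding h_def by (simp add: Re_Ln)
    qed
    have "(\<integral>w. h w \<partial>circle_haar) = 0"
      unfolding mean_value_haar[OF h r1] by (simp add: h_def)
    then have "(\<integral>w. Re (h w) \<partial>circle_haar) = 0"
      using hi by simp
    then have "(\<integral>w. ln 2 - Re (h w) \<partial>circle_haar) = ln 2"
      using hi haar.prob_space by simp
    have le: "Re (h w) \<le> ln 2" if "cmod w = 1" for w
      unfolding Reh[OF that] using z that r[of n] nz[OF that] by (intro ln_norm_diff_circle_le) (auto simp: norm_mult)
    have "(\<integral>\<^sup>+w. energy_kernel z (of_real (r n) * w) \<partial>circle_haar) = (\<integral>\<^sup>+w. ennreal (ln 2 - Re (h w)) \<partial>circle_haar)"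
      by (intro nn_integral_cong) (auto simp: energy_kernel_def Reh nz)
    also have "\<dots> = ennreal (\<integral>w. ln 2 - Re (h w) \<partial>circle_haar)"
      using hi le by (intro nn_integral_eq_integral) (auto intro!: AE_I2)
    finally show ?thesis using \<open>(\<integral>w. ln 2 - Re (h w) \<partial>circle_haar) = ln 2\<close> by simp
  qed
  have "(\<integral>\<^sup>+w. energy_kernel z w \<partial>circle_haar) \<le> (\<integral>\<^sup>+w. liminf (\<lambda>n. energy_kernel z (of_real (r n) * w)) \<partial>circle_haar)"
  proof (intro nn_integral_mono energy_kernel_lsc tendsto_const)
    fix w :: complex
    have "(\<lambda>n. of_real (r n) * w) \<longlonglongrightarrow> of_real 1 * w" by (intro tendsto_intros rl)
    then show "(\<lambda>n. of_real (r n) * w) \<longlonglongrightarrow> w" by simp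
  qed
  also have "\<dots> \<le> liminf (\<lambda>n. \<integral>\<^sup>+w. energy_kernel z (of_real (r n) * w) \<partial>circle_haar)"
    by (intro nn_integral_liminf) measurable
  also have "\<dots> = ennreal (ln 2)" unfolding I by (simp add: Liminf_const)
  finally show ?thesis .
qed

text \<open>A Schur-type bound: \<open>p z * p w\<close> is at most the sum of the two squares, and
  each square is then integrated against a potential bounded by \<open>ln 2\<close>.\<close>

lemma log_energy_density_finite:
  assumes [measurable]: "p \<in> borel_measurable circle_borel" and p0: "\<And>z. 0 \<le> p z"
    and p2: "integrable circle_haar (\<lambda>z. (p z)\<^sup>2)"
  shows "log_energy (density circle_haar (\<lambda>z. ennreal (p z))) < \<infinity>"
proof -
  interpret pair_prob_space circle_haar circle_haar by unfold_locales
  have "log_energy (density circle_haar (\<lambda>z. ennreal (p z))) = (\<integral>\<^sup>+z. ennreal (p z) * (\<integral>\<^sup>+w. ennreal (p w) * energy_kernel z w \<partial>circle_haar) \<partial>circle_haar)"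
    unfolding log_energy_def by (simp add: nn_integral_density)
  also have "\<dots> = (\<integral>\<^sup>+z. (\<integral>\<^sup>+w. ennreal (p z) * (ennreal (p w) * energy_kernel z w) \<partial>circle_haar) \<partial>circle_haar)"
    by (intro nn_integral_cong nn_integral_cmult[symmetric]) measurable
  also have "\<dots> \<le> (\<integral>\<^sup>+z. (\<integral>\<^sup>+w. ennreal ((p z)\<^sup>2) * energy_kernel z w + ennreal ((p w)\<^sup>2) * energy_kernel z w \<partial>circle_haar) \<partial>circle_haar)"
  proof (intro nn_integral_mono)
    fix z w
    have "p z * p w \<le> (p z)\<^sup>2 + (p w)\<^sup>2"
      using zero_le_power2[of "p z - p w"] mult_nonneg_nonneg[OF p0 p0, of z w] by (simp add: power2_eq_square algebra_simps)
    then have "ennreal (p z) * ennreal (p w) \<le> ennreal ((p z)\<^sup>2) + ennreal ((p w)\<^sup>2)"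
      using p0 by (simp add: ennreal_leI flip: ennreal_mult ennreal_plus)
    then show "ennreal (p z) * (ennreal (p w) * energy_kernel z w) \<le> ennreal ((p z)\<^sup>2) * energy_kernel z w + ennreal ((p w)\<^sup>2) * energy_kernel z w"
      by (subst mult.assoc[symmetric], subst distrib_right[symmetric]) (rule mult_right_mono, auto)
  qed
  also have "\<dots> = (\<integral>\<^sup>+z. (\<integral>\<^sup>+w. ennreal ((p z)\<^sup>2) * energy_kernel z w \<partial>circle_haar) \<partial>circle_haar) + (\<integral>\<^sup>+z. (\<integral>\<^sup>+w. ennreal ((p w)\<^sup>2) * energy_kernel z w \<partial>circle_haar) \<partial>circle_haar)"
    by (subst nn_integral_add[symmetric], measurable, intro nn_integral_cong nn_integral_add) measurable
  also have "(\<integral>\<^sup>+z. (\<integral>\<^sup>+w. ennreal ((p w)\<^sup>2) * energy_kernel z w \<partial>circle_haar) \<partial>circle_haar) = (\<integral>\<^sup>+w. (\<integral>\<^sup>+z. ennreal ((p w)\<^sup>2) * energy_kernel z w \<partial>circle_haar) \<partial>circle_haar)"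
    by (intro Fubini'[symmetric]) measurable
  also have "\<dots> = (\<integral>\<^sup>+z. (\<integral>\<^sup>+w. ennreal ((p z)\<^sup>2) * energy_kernel z w \<partial>circle_haar) \<partial>circle_haar)"
    by (simp add: energy_kernel_commute)
  also have "(\<integral>\<^sup>+z. (\<integral>\<^sup>+w. ennreal ((p z)\<^sup>2) * energy_kernel z w \<partial>circle_haar) \<partial>circle_haar) \<le> (\<integral>\<^sup>+z. ennreal ((p z)\<^sup>2) * ennreal (ln 2) \<partial>circle_haar)"
    by (intro nn_integral_mono, subst nn_integral_cmult) (auto intro!: mult_left_mono nn_integral_energy_kernel_haar)
  also have "(\<integral>\<^sup>+z. ennreal ((p z)\<^sup>2) * ennreal (ln 2) \<partial>circle_haar) = ennreal (\<integral>z. (p z)\<^sup>2 \<partial>circle_haar) * ennreal (ln 2)"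
    using p2 by (subst nn_integral_multc) (auto simp: nn_integral_eq_integral)
  finally show ?thesis
    by (auto simp: ennreal_mult_less_top le_less_trans add_mono)
qed

section \<open>Monotone couplings\<close>

text \<open>The fraction is the weight that regularises the cotangent: it lies between 0 and 1 for
  the radii used and tends to 1 off the diagonal as \<open>r\<close> tends to 1.\<close>

lemma conj_poisson_cis:
  assumes d: "cis x \<noteq> cis y"
  shows "conj_poisson (of_real r * cis x) (cis y)
    = cot ((x - y) / 2) * (r * (cmod (cis x - cis y))\<^sup>2 / ((1 - r)\<^sup>2 + r * (cmod (cis x - cis y))\<^sup>2))"
proof -
  define t where "t = x - y"
  define s c where "s = sin (t / 2)" and "c = cos (t / 2)"
  define D where "D = (1 - r)\<^sup>2 + 4 * r * s\<^sup>2"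
  have d2: "(cmod (cis x - cis y))\<^sup>2 = 4 * s\<^sup>2"
    by (simp add: norm_cis_diff power_mult_distrib s_def t_def)
  have s0: "s \<noteq> 0" using d d2 by auto
  have st: "sin t = 2 * s * c"
    using sin_double[of "t/2"] by (simp add: s_def c_def)
  have "cis y = cis x * cis (- t)" by (simp add: cis_mult t_def)
  then have "conj_poisson (of_real r * cis x) (cis y) = conj_poisson (of_real r) (cis (- t))"
    by (simp only: herglotz_rotate[OF cis_neq_zero])
  also have "\<dots> = 2 * r * sin t / D"
    unfolding D_def s_def by (rule poisson_kernels_cis(2))
  also have "\<dots> = c / s * (r * (4 * s\<^sup>2) / D)"
    using s0 by (simp add: st power2_eq_square)
  also have "c / s = cot (t / 2)" by (simp add: cot_def s_def c_def)
  finally show ?thesis by (simp add: d2 D_def t_def mult_ac)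
qed

text \<open>The second derivative of \<open>ln sin\<close> is at most \<open>-1\<close>; this uniform concavity is what
  compensates a negative \<open>\<rho>\<close>.\<close>

lemma ln_sin_tangent:
  assumes u: "0 < u" "u < pi" and q: "0 < q" "q < pi"
  shows "ln (sin q) - ln (sin u) + (q - u)\<^sup>2 / 2 \<le> (q - u) * cot u"
proof -
  \<comment> \<open>Concavity of \<open>ln sin\<close> with modulus 1 is plain convexity of this
    function, whose second derivative is 1 / sin^2 - 1. The claim is its tangent inequality at
    \<open>u\<close>.\<close>
  define f where "f x = - ln (sin x) - x\<^sup>2 / 2" for x :: real
  have s: "0 < sin x" if "x \<in> {0<..<pi}" for x using that by (intro sin_gt_zero) auto
  have d1: "(f has_real_derivative - (cos x / sin x) - x) (at x)" if "x \<in> {0<..<pi}" for x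
    unfolding f_def using s[OF that] by (auto intro!: derivative_eq_intros)
  have d2: "((\<lambda>x. - (cos x / sin x) - x) has_real_derivative (1 / (sin x)\<^sup>2 - 1)) (at x)" if "x \<in> {0<..<pi}" for x
  proof -
    have "((\<lambda>x. - (cos x / sin x) - x) has_real_derivative - ((- sin x * sin x - cos x * cos x) / (sin x * sin x)) - 1) (at x)"
      using s[OF that] by (auto intro!: derivative_eq_intros)
    moreover have "- sin x * sin x - cos x * cos x = -1"
      using sin_cos_squared_add[of x] by (simp add: power2_eq_square)
    ultimately show ?thesis by (simp add: power2_eq_square)
  qed
  have cv: "convex_on {0<..<pi} f"
  proof (rule f''_ge0_imp_convex)
    show "0 \<le> 1 / (sin x)\<^sup>2 - 1" if "x \<in> {0<..<pi}" for x
      using s[OF that] by (simp add: field_simps power_le_one abs_square_le_1)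
    show "convex {0<..<pi}" by (rule convex_real_interval)
  qed (fact d1 d2)+
  have "(- (cos u / sin u) - u) * (q - u) \<le> f q - f u"
  proof (rule convex_on_imp_above_tangent[OF cv])
    show "(f has_real_derivative - (cos u / sin u) - u) (at u within {0<..<pi})"
      by (rule has_field_derivative_at_within[OF d1]) (use u in simp)
  qed (use u q in \<open>auto simp: interior_open\<close>)
  moreover have "(- (cos u / sin u) - u) * (q - u) = - ((q - u) * cot u) - q * u + u\<^sup>2"
    by (simp add: cot_def power2_eq_square algebra_simps)
  moreover have "(q - u)\<^sup>2 / 2 = q\<^sup>2 / 2 - q * u + u\<^sup>2 / 2"
    by (simp add: power2_eq_square field_simps)
  ultimately show ?thesis unfolding f_def by linarith
qed

lemma cis_neq_imp_half_diff:
  assumes "0 \<le> x - y" "x - y \<le> 2 * pi" "cis x \<noteq> cis y"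
  shows "0 < (x - y) / 2" "(x - y) / 2 < pi"
proof -
  have "x - y \<noteq> 0" using assms by auto
  moreover have "x - y \<noteq> 2 * pi"
  proof
    assume "x - y = 2 * pi"
    then have "x = y + 2 * pi" by simp
    then show False using assms by simp
  qed
  ultimately show "0 < (x - y) / 2" "(x - y) / 2 < pi" using assms by auto
qed

text \<open>In the ordered case the half increments \<open>u\<close> and \<open>q\<close> lie in (0,
  pi) and the chords are \<open>2 * sin u\<close> and \<open>2 * sin q\<close>. The tangent
  inequality is multiplied by the weight, which turns \<open>cot u\<close> into the conjugate
  Poisson kernel.\<close>

lemma transport_kernel_le_aux:
  assumes r: "0 \<le> r" "r < 1"
    and x: "x' \<le> x" "x \<le> x' + 2 * pi" "cis x \<noteq> cis x'"
    and y: "y' \<le> y" "y \<le> y' + 2 * pi" "cis y \<noteq> cis y'"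
  shows "r * (cmod (cis x - cis x'))\<^sup>2 / ((1 - r)\<^sup>2 + r * (cmod (cis x - cis x'))\<^sup>2)
      * (ln (cmod (cis y - cis y')) - ln (cmod (cis x - cis x')) + (((y - x) - (y' - x')) / 2)\<^sup>2 / 2)
    \<le> ((y - x) - (y' - x')) / 2 * conj_poisson (of_real r * cis x) (cis x')"
proof -
  define u q where "u = (x - x') / 2" and "q = (y - y') / 2"
  have u: "0 < u" "u < pi" unfolding u_def using x by (intro cis_neq_imp_half_diff; simp)+
  have q: "0 < q" "q < pi" unfolding q_def using y by (intro cis_neq_imp_half_diff; simp)+
  have su: "0 < sin u" "0 < sin q" using u q by (auto intro: sin_gt_zero)
  have n: "cmod (cis x - cis x') = 2 * sin u" "cmod (cis y - cis y') = 2 * sin q"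
    using su by (auto simp: norm_cis_diff u_def q_def)
  have v: "((y - x) - (y' - x')) / 2 = q - u" by (simp add: u_def q_def field_simps)
  define om where "om = r * (cmod (cis x - cis x'))\<^sup>2 / ((1 - r)\<^sup>2 + r * (cmod (cis x - cis x'))\<^sup>2)"
  have om: "0 \<le> om" unfolding om_def using r by (intro divide_nonneg_nonneg add_nonneg_nonneg mult_nonneg_nonneg) auto
  have "ln (2 * sin q) - ln (2 * sin u) + (q - u)\<^sup>2 / 2 \<le> (q - u) * cot u"
    using ln_sin_tangent[OF u q] su by (simp add: ln_mult)
  then have "om * (ln (2 * sin q) - ln (2 * sin u) + (q - u)\<^sup>2 / 2) \<le> om * ((q - u) * cot u)"
    by (intro mult_left_mono om)
  also have "\<dots> = (q - u) * conj_poisson (of_real r * cis x) (cis x')"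
    unfolding conj_poisson_cis[OF x(3)] om_def[symmetric] u_def[symmetric] by simp
  finally show ?thesis unfolding om_def[symmetric] v unfolding n .
qed

text \<open>The disjunction is what a monotone coupling provides for a pair of parameters.
  Exchanging the parameters changes the sign of both the increment of the displacement and the
  kernel, so the product on the right is unchanged.\<close>

lemma transport_kernel_le:
  assumes r: "0 \<le> r" "r < 1"
    and mono: "(x' \<le> x \<and> x \<le> x' + 2 * pi \<and> y' \<le> y \<and> y \<le> y' + 2 * pi) \<or> (x \<le> x' \<and> x' \<le> x + 2 * pi \<and> y \<le> y' \<and> y' \<le> y + 2 * pi)"
    and ne: "cis x \<noteq> cis x'" "cis y \<noteq> cis y'"
  shows "r * (cmod (cis x - cis x'))\<^sup>2 / ((1 - r)\<^sup>2 + r * (cmod (cis x - cis x'))\<^sup>2)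
      * (ln (cmod (cis y - cis y')) - ln (cmod (cis x - cis x')) + (((y - x) - (y' - x')) / 2)\<^sup>2 / 2)
    \<le> ((y - x) - (y' - x')) / 2 * conj_poisson (of_real r * cis x) (cis x')"
  using mono
proof (elim disjE conjE)
  assume "x' \<le> x" "x \<le> x' + 2 * pi" "y' \<le> y" "y \<le> y' + 2 * pi"
  then show ?thesis using r ne by (intro transport_kernel_le_aux) auto
next
  assume *: "x \<le> x'" "x' \<le> x + 2 * pi" "y \<le> y'" "y' \<le> y + 2 * pi"
  have "conj_poisson (of_real r * cis x) (cis x') = - conj_poisson (of_real r * cis x') (cis x)"
    by (subst herglotz_swap) auto
  moreover have "((y - x) - (y' - x')) / 2 = - (((y' - x') - (y - x)) / 2)" by (simp add: field_simps)
  moreover have "cmod (cis x - cis x') = cmod (cis x' - cis x)" "cmod (cis y - cis y') = cmod (cis y' - cis y)"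
    by (simp_all add: norm_minus_commute)
  moreover note transport_kernel_le_aux[OF r *(1,2) ne(1)[symmetric] *(3,4) ne(2)[symmetric]]
  ultimately show ?thesis
    by (simp only: minus_mult_minus power2_minus)
qed

section \<open>Quantile functions and their lifts to the line\<close>

definition unit_measure :: "real measure" where
  "unit_measure = restrict_space lborel {0..<1}"

lemma space_unit_measure [simp]: "space unit_measure = {0..<1}"
  by (simp add: unit_measure_def space_restrict_space)

lemma prob_space_unit_measure: "prob_space unit_measure"
  unfolding unit_measure_def by (intro prob_spaceI) (simp add: emeasure_restrict_space space_restrict_space)

lemma measurable_unit_measure: "f \<in> borel_measurable borel \<Longrightarrow> f \<in> borel_measurable unit_measure"
  unfolding unit_measure_def by (intro measurable_restrict_space1) simp

lemma nn_integral_unit_measure: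
  "(\<integral>\<^sup>+s. f s \<partial>unit_measure) = (\<integral>\<^sup>+s. f s * indicator {0..<1} s \<partial>lborel)"
  unfolding unit_measure_def by (subst nn_integral_restrict_space) auto

lemma nn_integral_unit_shift:
  fixes G :: "real \<Rightarrow> ennreal"
  assumes [measurable]: "G \<in> borel_measurable borel" and per: "\<And>s. G (s + 1) = G s"
  shows "(\<integral>\<^sup>+s. G (s + a) \<partial>unit_measure) = (\<integral>\<^sup>+s. G s \<partial>unit_measure)"
proof -
  have "(\<integral>\<^sup>+s. G s \<partial>unit_measure) = (\<integral>\<^sup>+s. G s * indicator {a..<a + 1} s \<partial>lborel)"
    unfolding nn_integral_unit_measure
    using nn_integral_periodic_shift[of G 1 0 a] per by simp
  also have "\<dots> = (\<integral>\<^sup>+s. G (a + 1 * s) * indicator {a..<a + 1} (a + 1 * s) \<partial>lborel)"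
    by (subst nn_integral_real_affine[where c=1 and t=a]) auto
  also have "\<dots> = (\<integral>\<^sup>+s. G (s + a) \<partial>unit_measure)"
    unfolding nn_integral_unit_measure by (intro nn_integral_cong) (auto simp: add.commute split: split_indicator)
  finally show ?thesis by simp
qed

lemma (in real_distribution) cdf_eq_0_of_support:
  assumes "prob {a<..b} = 1" shows "cdf M a = 0"
proof -
  have "prob (UNIV - {a<..b}) = 1 - prob {a<..b}" by (subst prob_compl[symmetric]) auto
  then have "prob (UNIV - {a<..b}) = 0" using assms by simp
  moreover have "prob {..a} \<le> prob (UNIV - {a<..b})" by (intro finite_measure_mono) auto
  ultimately show ?thesis unfolding cdf_def using measure_nonneg[of M "{..a}"] by linarith
qed

lemma quantile_function:
  assumes M: "M \<in> circle_prob_measures"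
  obtains X where "mono X" "\<And>t. -pi \<le> X t" "\<And>t. X t \<le> pi" "distr unit_measure circle_borel (\<lambda>s. cis (X s)) = M"
proof -
  interpret rd: cdf_distribution "arg_distr M"
    unfolding cdf_distribution_def by (rule arg_distr_real_distribution[OF M])
  have sup: "rd.prob {-pi<..pi} = 1" by (rule arg_distr_support[OF M])
  have lo: "-pi \<le> rd.I w" and hi: "rd.I w \<le> pi" if w: "0 < w" "w < 1" for w
  proof -
    have "rd.prob {-pi<..pi} \<le> rd.C pi"
      unfolding cdf_def by (intro rd.finite_measure_mono) auto
    then have "w \<le> rd.C pi" using sup w by simp
    then show "rd.I w \<le> pi" by (rule iffD1[OF rd.pseudoinverse[OF w]])
    have "\<not> w \<le> rd.C (- pi)" using rd.cdf_eq_0_of_support[OF sup] w by simp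
    then have "\<not> rd.I w \<le> - pi" using iffD2[OF rd.pseudoinverse[OF w]] by blast
    then show "-pi \<le> rd.I w" by simp
  qed
  \<comment> \<open>The generalised inverse of the distribution function is controlled only on the
    open unit interval. The constants outside keep \<open>X\<close> monotone and between -pi and pi
    on the whole line; the value at 0 concerns a null set.\<close>
  define X where "X t = (if t \<le> 0 then -pi else if t < 1 then rd.I t else pi)" for t
  have mono: "mono X"
  proof (rule monoI)
    fix s t :: real assume st: "s \<le> t"
    consider "s \<le> 0" | "1 \<le> t" | "0 < s" "t < 1" by linarith
    then show "X s \<le> X t"
    proof cases
      case 1
      then show ?thesis using lo[of t] by (auto simp: X_def)
    next
      case 2
      then show ?thesis using hi[of s] by (auto simp: X_def)
    next
      case 3
      have "s < 1" "0 < t" using 3 st by auto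
      moreover have "rd.I s \<le> rd.I t"
        by (rule mono_onD[OF rd.mono_I]) (use 3 st in auto)
      ultimately show ?thesis using 3 by (simp add: X_def)
    qed
  qed
  have Xm [measurable]: "X \<in> borel_measurable borel" by (rule borel_measurable_mono[OF mono])
  then have Xu [measurable]: "X \<in> borel_measurable unit_measure" by (rule measurable_unit_measure)
  have "distr unit_measure borel X = arg_distr M"
  proof (rule measure_eqI)
    fix A assume "A \<in> sets (distr unit_measure borel X)"
    then have A [measurable]: "A \<in> sets borel" by simp
    have "emeasure (distr unit_measure borel X) A = (\<integral>\<^sup>+x. indicator A x \<partial>distr unit_measure borel X)"
      by simp
    also have "\<dots> = (\<integral>\<^sup>+s. indicator A (X s) * indicator {0..<1} s \<partial>lborel)"
      by (subst nn_integral_distr) (auto simp: nn_integral_unit_measure)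
    also have "\<dots> = (\<integral>\<^sup>+s. indicator A (rd.I s) * indicator {0<..<1} s \<partial>lborel)"
      using AE_lborel_singleton[of 0]
      by (intro nn_integral_cong_AE, eventually_elim) (auto simp: X_def split: split_indicator)
    also have "\<dots> = (\<integral>\<^sup>+s. indicator A (rd.I s) \<partial>restrict_space lborel {0<..<1})"
      by (subst nn_integral_restrict_space) auto
    also have "\<dots> = (\<integral>\<^sup>+x. indicator A x \<partial>distr (restrict_space lborel {0<..<1}) borel rd.I)"
      by (subst nn_integral_distr) auto
    also have "\<dots> = emeasure (arg_distr M) A"
      unfolding rd.distr_I_eq_M by simp
    finally show "emeasure (distr unit_measure borel X) A = emeasure (arg_distr M) A" .
  qed simp
  then have "distr (distr unit_measure borel X) circle_borel cis = M"
    using distr_cis_arg_distr[OF M] by simp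
  then have "distr unit_measure circle_borel (\<lambda>s. cis (X s)) = M"
    by (subst (asm) distr_distr) (auto simp: o_def)
  moreover have "-pi \<le> X t" "X t \<le> pi" for t
    using lo[of t] hi[of t] by (auto simp: X_def)
  ultimately show thesis using mono that by blast
qed

text \<open>The lift of degree one, growing by 2\<pi> per unit of the parameter. It stays monotone
  because the values of \<open>Y\<close> on one period span at most 2\<pi>, and it allows the
  parameter to be shifted.\<close>

definition quasi_periodic :: "(real \<Rightarrow> real) \<Rightarrow> real \<Rightarrow> real" where
  "quasi_periodic Y s = Y (frac s) + 2 * pi * of_int \<lfloor>s\<rfloor>"

context
  fixes Y :: "real \<Rightarrow> real"
  assumes Y: "mono Y" "\<And>t. -pi \<le> Y t" "\<And>t. Y t \<le> pi"
begin

lemma quasi_periodic_mono: "mono (quasi_periodic Y)"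
proof (rule monoI)
  fix s t :: real assume st: "s \<le> t"
  show "quasi_periodic Y s \<le> quasi_periodic Y t"
  proof (cases "\<lfloor>s\<rfloor> = \<lfloor>t\<rfloor>")
    case True
    then show ?thesis
      using monoD[OF Y(1), of "frac s" "frac t"] st by (simp add: quasi_periodic_def frac_def)
  next
    case False
    then have "\<lfloor>s\<rfloor> + 1 \<le> \<lfloor>t\<rfloor>" using floor_mono[OF st] by linarith
    then have "(of_int \<lfloor>s\<rfloor> + 1 :: real) \<le> of_int \<lfloor>t\<rfloor>" by linarith
    then have "2 * pi * (of_int \<lfloor>s\<rfloor> + 1) \<le> 2 * pi * of_int \<lfloor>t\<rfloor>" by (intro mult_left_mono) auto
    then have "pi + 2 * pi * of_int \<lfloor>s\<rfloor> \<le> - pi + 2 * pi * of_int \<lfloor>t\<rfloor>" by (simp add: algebra_simps)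
    then show ?thesis
      using Y(3)[of "frac s"] Y(2)[of "frac t"] unfolding quasi_periodic_def by linarith
  qed
qed

lemma quasi_periodic_plus_1: "quasi_periodic Y (s + 1) = quasi_periodic Y s + 2 * pi"
  by (simp add: quasi_periodic_def frac_def algebra_simps)

lemma quasi_periodic_unit: "s \<in> {0..<1} \<Longrightarrow> quasi_periodic Y s = Y s"
proof -
  assume s: "s \<in> {0..<1}"
  then have "\<lfloor>s\<rfloor> = 0" by (simp add: floor_eq_iff)
  then show ?thesis by (simp add: quasi_periodic_def frac_def)
qed

lemma quasi_periodic_measurable: "quasi_periodic Y \<in> borel_measurable borel"
  by (rule borel_measurable_mono[OF quasi_periodic_mono])

lemma quasi_periodic_increment:
  assumes "s \<le> t" "t \<le> s + 1"
  shows "quasi_periodic Y s \<le> quasi_periodic Y t" "quasi_periodic Y t \<le> quasi_periodic Y s + 2 * pi"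
  using monoD[OF quasi_periodic_mono assms(1)] monoD[OF quasi_periodic_mono assms(2)] quasi_periodic_plus_1[of s] by auto

lemma quasi_periodic_linear_bound: "\<bar>quasi_periodic Y s - 2 * pi * s\<bar> \<le> 3 * pi"
proof -
  have "quasi_periodic Y s - 2 * pi * s = Y (frac s) - 2 * pi * frac s"
    by (simp add: quasi_periodic_def frac_def algebra_simps)
  moreover have "0 \<le> 2 * pi * frac s" "2 * pi * frac s \<le> 2 * pi"
    using frac_lt_1[of s] by (auto intro: less_imp_le)
  ultimately show ?thesis using Y(2)[of "frac s"] Y(3)[of "frac s"] by linarith
qed

text \<open>\<open>cis\<close> does not see the jumps by 2\<pi>, so the composition is periodic with
  period 1 and a shift of the parameter does not change the image measure.\<close>

lemma distr_quasi_periodic_shift: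
  "distr unit_measure circle_borel (\<lambda>s. cis (quasi_periodic Y (s + a))) = distr unit_measure circle_borel (\<lambda>s. cis (Y s))"
proof (rule measure_eqI)
  note [measurable] = quasi_periodic_measurable borel_measurable_mono[OF Y(1)]
  have 1: "(\<lambda>s. cis (quasi_periodic Y (s + a))) \<in> unit_measure \<rightarrow>\<^sub>M circle_borel"
    by (intro measurable_compose[OF measurable_unit_measure cis_measurable] measurable_compose[OF _ quasi_periodic_measurable]) measurable
  have 2: "(\<lambda>s. cis (Y s)) \<in> unit_measure \<rightarrow>\<^sub>M circle_borel"
    by (rule measurable_compose[OF measurable_unit_measure cis_measurable]) measurable
  fix A assume "A \<in> sets (distr unit_measure circle_borel (\<lambda>s. cis (quasi_periodic Y (s + a))))"
  then have A [measurable]: "A \<in> sets circle_borel" by simp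
  have "emeasure (distr unit_measure circle_borel (\<lambda>s. cis (quasi_periodic Y (s + a)))) A = (\<integral>\<^sup>+z. indicator A z \<partial>distr unit_measure circle_borel (\<lambda>s. cis (quasi_periodic Y (s + a))))"
    by simp
  also have "\<dots> = (\<integral>\<^sup>+s. indicator A (cis (quasi_periodic Y (s + a))) \<partial>unit_measure)"
    by (rule nn_integral_distr[OF 1]) simp
  also have "\<dots> = (\<integral>\<^sup>+s. indicator A (cis (quasi_periodic Y s)) \<partial>unit_measure)"
    by (rule nn_integral_unit_shift[where G="\<lambda>s. indicator A (cis (quasi_periodic Y s))"])
       (auto simp: quasi_periodic_plus_1)
  also have "\<dots> = (\<integral>\<^sup>+s. indicator A (cis (Y s)) \<partial>unit_measure)"
    by (intro nn_integral_cong) (simp add: quasi_periodic_unit)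
  also have "\<dots> = (\<integral>\<^sup>+z. indicator A z \<partial>distr unit_measure circle_borel (\<lambda>s. cis (Y s)))"
    by (rule nn_integral_distr[OF 2, symmetric]) simp
  finally show "emeasure (distr unit_measure circle_borel (\<lambda>s. cis (quasi_periodic Y (s + a)))) A = emeasure (distr unit_measure circle_borel (\<lambda>s. cis (Y s))) A"
    by simp
qed simp

text \<open>Without its slope the lift is bounded and periodic, so the mean of that part ignores the
  shift and the change is that of the linear part. The summand \<open>3 * pi\<close> in
  \<open>G\<close> only ensures nonnegativity.\<close>

lemma integral_quasi_periodic_shift:
  "(\<integral>s. quasi_periodic Y (s + a) \<partial>unit_measure) = (\<integral>s. Y s \<partial>unit_measure) + 2 * pi * a"
proof -
  interpret U: prob_space unit_measure by (rule prob_space_unit_measure)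
  define G where "G s = quasi_periodic Y s - 2 * pi * s + 3 * pi" for s
  have G0: "0 \<le> G s" "G s \<le> 6 * pi" for s using quasi_periodic_linear_bound[of s] unfolding G_def by linarith+
  have Gp: "G (s + 1) = G s" for s
    unfolding G_def quasi_periodic_plus_1 by (simp add: algebra_simps)
  have Gm [measurable]: "G \<in> borel_measurable borel"
    unfolding G_def by (intro borel_measurable_add borel_measurable_diff quasi_periodic_measurable) measurable
  have Gam: "(\<lambda>s. G (s + a)) \<in> borel_measurable unit_measure" for a
    by (intro measurable_unit_measure measurable_compose[OF _ Gm]) measurable
  have Gi: "integrable unit_measure (\<lambda>s. G (s + a))" for a
    using G0 by (intro U.integrable_const_bound[of _ "6 * pi"] Gam AE_I2) auto
  have si: "integrable unit_measure (\<lambda>s. s)"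
    by (intro U.integrable_const_bound[of _ 1] measurable_unit_measure AE_I2) auto
  have shift: "(\<integral>s. G (s + a) \<partial>unit_measure) = (\<integral>s. G s \<partial>unit_measure)"
    using nn_integral_unit_shift[of "\<lambda>s. ennreal (G s)" a] Gp G0 Gam[of 0] Gam[of a]
    by (simp add: integral_eq_nn_integral)
  have e: "quasi_periodic Y (s + a) = G (s + a) + 2 * pi * s + (2 * pi * a - 3 * pi)" for s a
    by (simp add: G_def algebra_simps)
  have I: "(\<integral>s. quasi_periodic Y (s + a) \<partial>unit_measure) = (\<integral>s. G (s + a) \<partial>unit_measure) + 2 * pi * (\<integral>s. s \<partial>unit_measure) + (2 * pi * a - 3 * pi)" for a
    unfolding e using Gi[of a] si U.prob_space by simp
  have "(\<integral>s. quasi_periodic Y (s + 0) \<partial>unit_measure) = (\<integral>s. Y s \<partial>unit_measure)"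
    by (intro Bochner_Integration.integral_cong) (simp_all add: quasi_periodic_unit)
  then show ?thesis
    using I[of a] I[of 0] shift by simp
qed

end

text \<open>Two circle measures are coupled through a common parameter \<open>s \<in> [0, 1)\<close> by lifted quantile
  functions. Rotating the parameter of \<open>Y\<close> by \<open>a\<close> moves its mean by \<open>2 \<pi> a\<close>, so the means
  can be made equal.\<close>

lemma centered_coupling:
  assumes \<mu>: "\<mu> \<in> circle_prob_measures" and \<nu>: "\<nu> \<in> circle_prob_measures"
  obtains X Y :: "real \<Rightarrow> real" and B where
    "X \<in> borel_measurable unit_measure" "Y \<in> borel_measurable unit_measure"
    "\<And>s. s \<in> {0..<1} \<Longrightarrow> \<bar>X s\<bar> \<le> B" "\<And>s. s \<in> {0..<1} \<Longrightarrow> \<bar>Y s\<bar> \<le> B"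
    "distr unit_measure circle_borel (\<lambda>s. cis (X s)) = \<mu>" "distr unit_measure circle_borel (\<lambda>s. cis (Y s)) = \<nu>"
    "(\<integral>s. Y s \<partial>unit_measure) = (\<integral>s. X s \<partial>unit_measure)"
    "\<And>s t. 0 \<le> s \<Longrightarrow> s \<le> t \<Longrightarrow> t < 1 \<Longrightarrow> X s \<le> X t \<and> X t \<le> X s + 2 * pi \<and> Y s \<le> Y t \<and> Y t \<le> Y s + 2 * pi"
proof -
  obtain X where X: "mono X" "\<And>t. -pi \<le> X t" "\<And>t. X t \<le> pi" "distr unit_measure circle_borel (\<lambda>s. cis (X s)) = \<mu>"
    using quantile_function[OF \<mu>] by blast
  obtain Y where Y: "mono Y" "\<And>t. -pi \<le> Y t" "\<And>t. Y t \<le> pi" "distr unit_measure circle_borel (\<lambda>s. cis (Y s)) = \<nu>"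
    using quantile_function[OF \<nu>] by blast
  define a where "a = ((\<integral>s. X s \<partial>unit_measure) - (\<integral>s. Y s \<partial>unit_measure)) / (2 * pi)"
  define Z where "Z s = quasi_periodic Y (s + a)" for s
  define B where "B = 3 * pi + 2 * pi * (1 + \<bar>a\<bar>)"
  show thesis
  proof (rule that[of X Z B])
    show "X \<in> borel_measurable unit_measure" by (rule measurable_unit_measure[OF borel_measurable_mono[OF X(1)]])
    show "Z \<in> borel_measurable unit_measure"
      unfolding Z_def
      by (intro measurable_unit_measure measurable_compose[OF _ quasi_periodic_measurable[OF Y(1-3)]]) measurable
    show "\<bar>X s\<bar> \<le> B" if "s \<in> {0..<1}" for s
    proof -
      have "0 \<le> 2 * pi * (1 + \<bar>a\<bar>)" by simp
      then show ?thesis using X(2)[of s] X(3)[of s] unfolding B_def by linarith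
    qed
    show "\<bar>Z s\<bar> \<le> B" if s: "s \<in> {0..<1}" for s
    proof -
      have "\<bar>2 * pi * (s + a)\<bar> = 2 * pi * \<bar>s + a\<bar>" by (simp add: abs_mult)
      also have "\<dots> \<le> 2 * pi * (1 + \<bar>a\<bar>)" using s by (intro mult_left_mono) auto
      finally show ?thesis
        using quasi_periodic_linear_bound[OF Y(1-3), of "s + a"] unfolding Z_def B_def by linarith
    qed
    show "distr unit_measure circle_borel (\<lambda>s. cis (X s)) = \<mu>" by (rule X(4))
    show "distr unit_measure circle_borel (\<lambda>s. cis (Z s)) = \<nu>"
      unfolding Z_def distr_quasi_periodic_shift[OF Y(1-3)] by (rule Y(4))
    show "(\<integral>s. Z s \<partial>unit_measure) = (\<integral>s. X s \<partial>unit_measure)"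
      unfolding Z_def integral_quasi_periodic_shift[OF Y(1-3)] by (simp add: a_def)
    show "X s \<le> X t \<and> X t \<le> X s + 2 * pi \<and> Z s \<le> Z t \<and> Z t \<le> Z s + 2 * pi" if "0 \<le> s" "s \<le> t" "t < 1" for s t
      using monoD[OF X(1) that(2)] X(3)[of t] X(2)[of s] that
        quasi_periodic_increment[OF Y(1-3), of "s + a" "t + a"] by (auto simp: Z_def)
  qed
qed

lemma square_integrable_mult:
  fixes f h :: "'a \<Rightarrow> real"
  assumes [measurable]: "f \<in> borel_measurable M" "h \<in> borel_measurable M"
    and f2: "integrable M (\<lambda>x. (f x)\<^sup>2)" and h2: "integrable M (\<lambda>x. (h x)\<^sup>2)"
  shows "integrable M (\<lambda>x. f x * h x)"
    and "(\<integral>x. \<bar>f x * h x\<bar> \<partial>M)\<^sup>2 \<le> (\<integral>x. (f x)\<^sup>2 \<partial>M) * (\<integral>x. (h x)\<^sup>2 \<partial>M)"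
proof -
  show i: "integrable M (\<lambda>x. f x * h x)"
  proof (rule Bochner_Integration.integrable_bound)
    show "integrable M (\<lambda>x. (f x)\<^sup>2 + (h x)\<^sup>2)" using f2 h2 by simp
    have "\<bar>a * b\<bar> \<le> a\<^sup>2 + b\<^sup>2" for a b :: real
    proof -
      have "0 \<le> \<bar>a\<bar> * \<bar>b\<bar>" by simp
      moreover have "2 * (\<bar>a\<bar> * \<bar>b\<bar>) \<le> a\<^sup>2 + b\<^sup>2"
        using zero_le_power2[of "\<bar>a\<bar> - \<bar>b\<bar>"] by (simp add: power2_diff mult.assoc)
      ultimately show ?thesis unfolding abs_mult by linarith
    qed
    then show "AE x in M. norm (f x * h x) \<le> norm ((f x)\<^sup>2 + (h x)\<^sup>2)"
      by (intro AE_I2) simp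
  qed simp
  have "(\<integral>\<^sup>+x. ennreal \<bar>f x\<bar> * ennreal \<bar>h x\<bar> \<partial>M)\<^sup>2 \<le> (\<integral>\<^sup>+x. (ennreal \<bar>f x\<bar>)\<^sup>2 \<partial>M) * (\<integral>\<^sup>+x. (ennreal \<bar>h x\<bar>)\<^sup>2 \<partial>M)"
    by (rule Cauchy_Schwarz_nn_integral) measurable
  also have "(\<integral>\<^sup>+x. (ennreal \<bar>f x\<bar>)\<^sup>2 \<partial>M) = ennreal (\<integral>x. (f x)\<^sup>2 \<partial>M)"
    using f2 by (subst nn_integral_eq_integral[symmetric]) (auto simp: ennreal_power)
  also have "(\<integral>\<^sup>+x. (ennreal \<bar>h x\<bar>)\<^sup>2 \<partial>M) = ennreal (\<integral>x. (h x)\<^sup>2 \<partial>M)"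
    using h2 by (subst nn_integral_eq_integral[symmetric]) (auto simp: ennreal_power)
  also have "(\<integral>\<^sup>+x. ennreal \<bar>f x\<bar> * ennreal \<bar>h x\<bar> \<partial>M) = (\<integral>\<^sup>+x. ennreal \<bar>f x * h x\<bar> \<partial>M)"
    by (intro nn_integral_cong) (simp add: abs_mult ennreal_mult')
  also have "\<dots> = ennreal (\<integral>x. \<bar>f x * h x\<bar> \<partial>M)"
    using i by (intro nn_integral_eq_integral) auto
  finally show "(\<integral>x. \<bar>f x * h x\<bar> \<partial>M)\<^sup>2 \<le> (\<integral>x. (f x)\<^sup>2 \<partial>M) * (\<integral>x. (h x)\<^sup>2 \<partial>M)"
    by (simp add: ennreal_power flip: ennreal_mult)
qed

text \<open>Finite energy excludes atoms: almost every pair has distinct images on the circle, so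
  the value \<open>ln 0 = 0\<close> of HOL matters only on a null set. Since
  \<open>ln 2 - ln (d x)\<close> is nonnegative, finiteness makes the logarithm integrable.\<close>

lemma log_energy_pair:
  fixes X :: "'a \<Rightarrow> real"
  assumes S: "prob_space S" and [measurable]: "X \<in> borel_measurable S"
    and fin: "log_energy (distr S circle_borel (\<lambda>s. cis (X s))) < \<infinity>"
  shows "AE x in S \<Otimes>\<^sub>M S. cis (X (fst x)) \<noteq> cis (X (snd x))"
    and "integrable (S \<Otimes>\<^sub>M S) (\<lambda>x. ln (cmod (cis (X (fst x)) - cis (X (snd x)))))"
    and "log_energy (distr S circle_borel (\<lambda>s. cis (X s)))
      = ennreal (ln 2 - (\<integral>x. ln (cmod (cis (X (fst x)) - cis (X (snd x)))) \<partial>(S \<Otimes>\<^sub>M S)))"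
    and "(\<integral>x. ln (cmod (cis (X (fst x)) - cis (X (snd x)))) \<partial>(S \<Otimes>\<^sub>M S)) \<le> ln 2"
proof -
  interpret S: prob_space S by fact
  interpret SS: pair_prob_space S S by unfold_locales
  have cm [measurable]: "cis \<in> borel_measurable borel"
    by (intro borel_measurable_continuous_onI continuous_intros)
  define d where "d x = cmod (cis (X (fst x)) - cis (X (snd x)))" for x
  have [measurable]: "d \<in> borel_measurable (S \<Otimes>\<^sub>M S)" unfolding d_def by measurable
  have ek: "(\<lambda>x. energy_kernel (cis (X (fst x))) (cis (X (snd x)))) \<in> borel_measurable (S \<Otimes>\<^sub>M S)"
    by measurable
  have L: "log_energy (distr S circle_borel (\<lambda>s. cis (X s))) = (\<integral>\<^sup>+x. energy_kernel (cis (X (fst x))) (cis (X (snd x))) \<partial>(S \<Otimes>\<^sub>M S))"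
    using S.nn_integral_fst[OF ek] by (simp add: log_energy_distr[OF S])
  have "AE x in S \<Otimes>\<^sub>M S. energy_kernel (cis (X (fst x))) (cis (X (snd x))) \<noteq> \<infinity>"
    using fin ek by (intro nn_integral_PInf_AE) (auto simp: L)
  then show ne: "AE x in S \<Otimes>\<^sub>M S. cis (X (fst x)) \<noteq> cis (X (snd x))"
    by eventually_elim (auto simp: energy_kernel_def)
  have d0: "AE x in S \<Otimes>\<^sub>M S. 0 \<le> ln 2 - ln (d x)"
    using ne
  proof eventually_elim
    case (elim x)
    then show ?case using ln_norm_diff_circle_le[of "cis (X (fst x))" "cis (X (snd x))"] by (simp add: d_def)
  qed
  have eq: "(\<integral>\<^sup>+x. ennreal (ln 2 - ln (d x)) \<partial>(S \<Otimes>\<^sub>M S)) = log_energy (distr S circle_borel (\<lambda>s. cis (X s)))"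
    unfolding L by (intro nn_integral_cong_AE, use ne in eventually_elim) (auto simp: energy_kernel_def d_def)
  have i: "integrable (S \<Otimes>\<^sub>M S) (\<lambda>x. ln 2 - ln (d x))"
    by (rule integrableI_nonneg) (use d0 fin eq in auto)
  have "integrable (S \<Otimes>\<^sub>M S) (\<lambda>x. ln 2 - (ln 2 - ln (d x)))"
    by (intro Bochner_Integration.integrable_diff i) simp
  then show ld: "integrable (S \<Otimes>\<^sub>M S) (\<lambda>x. ln (cmod (cis (X (fst x)) - cis (X (snd x)))))"
    by (simp add: d_def)
  have I: "(\<integral>x. ln 2 - ln (d x) \<partial>(S \<Otimes>\<^sub>M S)) = ln 2 - (\<integral>x. ln (d x) \<partial>(S \<Otimes>\<^sub>M S))"
    using ld SS.P.prob_space by (simp add: d_def)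
  show "log_energy (distr S circle_borel (\<lambda>s. cis (X s)))
      = ennreal (ln 2 - (\<integral>x. ln (cmod (cis (X (fst x)) - cis (X (snd x)))) \<partial>(S \<Otimes>\<^sub>M S)))"
    using nn_integral_eq_integral[OF i d0] unfolding eq I by (simp add: d_def)
  have "0 \<le> (\<integral>x. ln 2 - ln (d x) \<partial>(S \<Otimes>\<^sub>M S))" by (rule integral_nonneg_AE[OF d0])
  then show "(\<integral>x. ln (cmod (cis (X (fst x)) - cis (X (snd x)))) \<partial>(S \<Otimes>\<^sub>M S)) \<le> ln 2"
    unfolding I by (simp add: d_def)
qed

section \<open>The transport inequality\<close>

text \<open>\<open>S\<close> is the common parameter space of the coupling. \<open>g\<close> stands
  for the Hilbert transform of \<open>p\<close> and is known only as the mean-square limit of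
  conjugate Poisson integrals along the radii \<open>r\<close>.\<close>

locale circle_transport = S: prob_space S for S :: "real measure" +
  fixes X Y :: "real \<Rightarrow> real" and B :: real and p g :: "complex \<Rightarrow> real" and r :: "nat \<Rightarrow> real" and \<mu> \<nu> :: "complex measure"
  assumes X [measurable]: "X \<in> borel_measurable S" and Y [measurable]: "Y \<in> borel_measurable S"
    and XB: "\<And>s. s \<in> space S \<Longrightarrow> \<bar>X s\<bar> \<le> B" and YB: "\<And>s. s \<in> space S \<Longrightarrow> \<bar>Y s\<bar> \<le> B"
    and \<mu>: "distr S circle_borel (\<lambda>s. cis (X s)) = \<mu>" and \<nu>: "distr S circle_borel (\<lambda>s. cis (Y s)) = \<nu>"
    and mean: "(\<integral>s. Y s \<partial>S) = (\<integral>s. X s \<partial>S)"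
    and mono: "\<And>s t. s \<in> space S \<Longrightarrow> t \<in> space S \<Longrightarrow>
      (X t \<le> X s \<and> X s \<le> X t + 2 * pi \<and> Y t \<le> Y s \<and> Y s \<le> Y t + 2 * pi) \<or>
      (X s \<le> X t \<and> X t \<le> X s + 2 * pi \<and> Y s \<le> Y t \<and> Y t \<le> Y s + 2 * pi)"
    and p [measurable]: "p \<in> borel_measurable circle_borel" and p0: "\<And>z. 0 \<le> p z"
    and p1: "integrable circle_haar p" and p2: "integrable circle_haar (\<lambda>z. (p z)\<^sup>2)"
    and \<mu>_density: "\<mu> = density circle_haar (\<lambda>z. ennreal (p z))"
    and fin_\<mu>: "log_energy \<mu> < \<infinity>" and fin_\<nu>: "log_energy \<nu> < \<infinity>"
    and g [measurable]: "g \<in> borel_measurable circle_borel" and g2: "integrable circle_haar (\<lambda>z. (g z)\<^sup>2)"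
    and r: "\<And>n. 0 < r n" "\<And>n. r n < 1" and r_lim: "r \<longlonglongrightarrow> 1"
    and vg_int: "\<And>n. integrable circle_haar (\<lambda>z. (Im (herglotz_int p (of_real (r n) * z)) - g z)\<^sup>2)"
    and vg_lim: "(\<lambda>n. \<integral>z. (Im (herglotz_int p (of_real (r n) * z)) - g z)\<^sup>2 \<partial>circle_haar) \<longlonglongrightarrow> 0"
begin

sublocale SS: pair_prob_space S S by unfold_locales

abbreviation "Z s \<equiv> cis (X s)"
abbreviation "W s \<equiv> cis (Y s)"
abbreviation "\<theta> s \<equiv> Y s - X s"
definition v where "v n z = Im (herglotz_int p (of_real (r n) * z))"
definition K where "K n s t = conj_poisson (of_real (r n) * Z s) (Z t)"

lemma Z_measurable [measurable]: "Z \<in> S \<rightarrow>\<^sub>M circle_borel"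
  by measurable

lemma ZW_borel [measurable]: "Z \<in> borel_measurable S" "W \<in> borel_measurable S"
proof -
  have [measurable]: "cis \<in> borel_measurable borel"
    by (intro borel_measurable_continuous_onI continuous_intros)
  show "Z \<in> borel_measurable S" "W \<in> borel_measurable S" by measurable
qed

lemma v_measurable [measurable]: "v n \<in> borel_measurable circle_borel"
  unfolding v_def by measurable

lemma \<theta>_bound: "s \<in> space S \<Longrightarrow> \<bar>\<theta> s\<bar> \<le> 2 * B"
  using XB[of s] YB[of s] by linarith

lemma \<theta>_integrable: "integrable S \<theta>" "integrable S (\<lambda>s. (\<theta> s)\<^sup>2)"
proof -
  show "integrable S \<theta>" by (rule S.integrable_const_bound[of _ "2 * B"]) (use \<theta>_bound in auto)
  show "integrable S (\<lambda>s. (\<theta> s)\<^sup>2)"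
  proof (rule S.integrable_const_bound[of _ "(2 * B)\<^sup>2"])
    show "AE s in S. norm ((\<theta> s)\<^sup>2) \<le> (2 * B)\<^sup>2"
    proof (rule AE_I2)
      fix s assume "s \<in> space S"
      then have "\<bar>\<theta> s\<bar> \<le> \<bar>2 * B\<bar>" using \<theta>_bound[of s] by linarith
      then have "(\<theta> s)\<^sup>2 \<le> (2 * B)\<^sup>2" by (rule iffD1[OF abs_le_square_iff])
      then show "norm ((\<theta> s)\<^sup>2) \<le> (2 * B)\<^sup>2" by simp
    qed
  qed measurable
qed

lemma integral_\<theta>: "(\<integral>s. \<theta> s \<partial>S) = 0"
proof -
  have "integrable S X" "integrable S Y"
    by (rule S.integrable_const_bound[of _ B]; use XB YB in auto)+
  then show ?thesis using mean by simp
qed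

text \<open>As the density \<open>p\<close> is square integrable, Cauchy-Schwarz bounds the mean of
  \<open>h\<close> under \<mu> by its mean square under the Haar measure. So mean-square convergence
  for the Haar measure can be used under \<mu>.\<close>

lemma transfer_integrable:
  fixes h :: "complex \<Rightarrow> real"
  assumes [measurable]: "h \<in> borel_measurable circle_borel" and h2: "integrable circle_haar (\<lambda>z. (h z)\<^sup>2)"
  shows "integrable S (\<lambda>s. h (Z s))" and "(\<integral>s. \<bar>h (Z s)\<bar> \<partial>S)\<^sup>2 \<le> (\<integral>z. (p z)\<^sup>2 \<partial>circle_haar) * (\<integral>z. (h z)\<^sup>2 \<partial>circle_haar)"
proof -
  note ph = square_integrable_mult[of p circle_haar h, OF _ _ p2 h2]
  have "integrable \<mu> h"
    unfolding \<mu>_density using ph(1) p0 by (subst integrable_density) auto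
  then show "integrable S (\<lambda>s. h (Z s))"
    unfolding \<mu>[symmetric] by (subst (asm) integrable_distr_eq) auto
  have "(\<integral>s. \<bar>h (Z s)\<bar> \<partial>S) = (\<integral>z. \<bar>h z\<bar> \<partial>\<mu>)"
    unfolding \<mu>[symmetric] by (subst integral_distr) auto
  also have "\<dots> = (\<integral>z. \<bar>p z * h z\<bar> \<partial>circle_haar)"
    unfolding \<mu>_density using p0 by (subst integral_density) (auto simp: abs_mult)
  finally show "(\<integral>s. \<bar>h (Z s)\<bar> \<partial>S)\<^sup>2 \<le> (\<integral>z. (p z)\<^sup>2 \<partial>circle_haar) * (\<integral>z. (h z)\<^sup>2 \<partial>circle_haar)"
    using ph(2) by simp
qed

lemma K_measurable [measurable]: "(\<lambda>x. K n (fst x) (snd x)) \<in> borel_measurable (S \<Otimes>\<^sub>M S)"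
  unfolding K_def by measurable

lemma K_bound: "\<bar>K n s t\<bar> \<le> 2 / (1 - r n)"
proof -
  have "cmod (of_real (r n) * Z s) = r n" using r(1)[of n] by (simp add: norm_mult)
  then have "cmod (herglotz (of_real (r n) * Z s) (Z t)) \<le> 2 / (1 - r n)"
    using norm_herglotz_le[of "of_real (r n) * Z s" "Z t"] r(2)[of n] by simp
  then show ?thesis unfolding K_def using abs_Im_le_cmod order_trans by blast
qed

lemma K_antisym: "K n t s = - K n s t"
  unfolding K_def by (subst herglotz_swap) auto

lemma K_integral: "(\<integral>t. K n s t \<partial>S) = v n (Z s)"
proof -
  have rz: "cmod (of_real (r n) * Z s) < 1" using r(1)[of n] r(2)[of n] by (simp add: norm_mult)
  have "(\<integral>t. K n s t \<partial>S) = (\<integral>w. conj_poisson (of_real (r n) * Z s) w \<partial>\<mu>)"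
    unfolding K_def \<mu>[symmetric] by (subst integral_distr) auto
  also have "\<dots> = (\<integral>w. p w * conj_poisson (of_real (r n) * Z s) w \<partial>circle_haar)"
    unfolding \<mu>_density using p0 by (subst integral_density) auto
  also have "\<dots> = v n (Z s)"
    unfolding v_def by (rule Im_herglotz_int[OF p1 rz, symmetric])
  finally show ?thesis .
qed

lemma integrable_bounded_K:
  assumes [measurable]: "f \<in> borel_measurable S" and fB: "\<And>s. s \<in> space S \<Longrightarrow> \<bar>f s\<bar> \<le> C"
  shows "integrable (S \<Otimes>\<^sub>M S) (\<lambda>x. f (fst x) * K n (fst x) (snd x))"
    and "integrable (S \<Otimes>\<^sub>M S) (\<lambda>x. f (snd x) * K n (fst x) (snd x))"
proof -
  have b: "\<bar>f s * K n s' t'\<bar> \<le> C * (2 / (1 - r n))" if "s \<in> space S" for s s' t'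
    unfolding abs_mult using fB[OF that] K_bound[of n s' t'] by (intro mult_mono) auto
  show "integrable (S \<Otimes>\<^sub>M S) (\<lambda>x. f (fst x) * K n (fst x) (snd x))"
    using b by (intro SS.P.integrable_const_bound[of _ "C * (2 / (1 - r n))"] AE_I2) (auto simp: space_pair_measure)
  show "integrable (S \<Otimes>\<^sub>M S) (\<lambda>x. f (snd x) * K n (fst x) (snd x))"
    using b by (intro SS.P.integrable_const_bound[of _ "C * (2 / (1 - r n))"] AE_I2) (auto simp: space_pair_measure)
qed

text \<open>By antisymmetry of \<open>K\<close> the term with \<open>f (snd x)\<close> is the
  negative of the one with \<open>f (fst x)\<close>, so the double integral collapses to a single
  one against \<open>v n\<close>.\<close>

lemma integral_diff_K:
  assumes [measurable]: "f \<in> borel_measurable S" and fB: "\<And>s. s \<in> space S \<Longrightarrow> \<bar>f s\<bar> \<le> C"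
  shows "(\<integral>x. (f (fst x) - f (snd x)) / 2 * K n (fst x) (snd x) \<partial>(S \<Otimes>\<^sub>M S)) = (\<integral>s. f s * v n (Z s) \<partial>S)"
proof -
  note i = integrable_bounded_K[OF assms, where n=n]
  have 1: "(\<integral>x. f (fst x) * K n (fst x) (snd x) \<partial>(S \<Otimes>\<^sub>M S)) = (\<integral>s. f s * v n (Z s) \<partial>S)"
    using SS.integral_fst'[OF i(1)] by (simp add: K_integral)
  have i2: "integrable (S \<Otimes>\<^sub>M S) (\<lambda>(s, t). f t * K n s t)"
    using i(2) by (simp add: case_prod_beta')
  have 2: "(\<integral>x. f (snd x) * K n (fst x) (snd x) \<partial>(S \<Otimes>\<^sub>M S)) = - (\<integral>s. f s * v n (Z s) \<partial>S)"
  proof -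
    have "(\<integral>x. f (snd x) * K n (fst x) (snd x) \<partial>(S \<Otimes>\<^sub>M S)) = (\<integral>t. (\<integral>s. f t * K n s t \<partial>S) \<partial>S)"
      using SS.integral_snd[OF i2] by (simp add: case_prod_beta')
    also have "\<dots> = (\<integral>t. (\<integral>s. - (f t * K n t s) \<partial>S) \<partial>S)"
      by (subst K_antisym) simp
    also have "\<dots> = - (\<integral>s. f s * v n (Z s) \<partial>S)"
      by (simp add: K_integral)
    finally show ?thesis .
  qed
  have "(\<integral>x. (f (fst x) - f (snd x)) / 2 * K n (fst x) (snd x) \<partial>(S \<Otimes>\<^sub>M S))
      = (\<integral>x. (1 / 2) * (f (fst x) * K n (fst x) (snd x) - f (snd x) * K n (fst x) (snd x)) \<partial>(S \<Otimes>\<^sub>M S))"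
    by (intro Bochner_Integration.integral_cong) (auto simp: algebra_simps diff_divide_distrib)
  also have "\<dots> = (1 / 2) * ((\<integral>x. f (fst x) * K n (fst x) (snd x) \<partial>(S \<Otimes>\<^sub>M S)) - (\<integral>x. f (snd x) * K n (fst x) (snd x) \<partial>(S \<Otimes>\<^sub>M S)))"
    using i by simp
  finally show ?thesis unfolding 1 2 by simp
qed

text \<open>A bounded factor costs only its bound in the Cauchy-Schwarz estimate. The lemma is
  applied to the displacement and to the constant 1.\<close>

lemma tendsto_integral_v:
  assumes [measurable]: "f \<in> borel_measurable S" and fB: "\<And>s. s \<in> space S \<Longrightarrow> \<bar>f s\<bar> \<le> C"
  shows "(\<lambda>n. \<integral>s. f s * v n (Z s) \<partial>S) \<longlonglongrightarrow> (\<integral>s. f s * g (Z s) \<partial>S)"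
proof (rule LIM_zero_cancel, rule Lim_null_comparison)
  define A where "A = (\<integral>z. (p z)\<^sup>2 \<partial>circle_haar)"
  define e where "e = (\<lambda>n. \<integral>z. (v n z - g z)\<^sup>2 \<partial>circle_haar)"
  have "e \<longlonglongrightarrow> 0" using vg_lim by (simp add: e_def v_def)
  from tendsto_mult_left[OF tendsto_real_sqrt[OF tendsto_mult_left[OF this, of A]], of "\<bar>C\<bar>"]
  show "(\<lambda>n. \<bar>C\<bar> * sqrt (A * e n)) \<longlonglongrightarrow> 0" by simp
  show "\<forall>\<^sub>F n in sequentially. norm ((\<integral>s. f s * v n (Z s) \<partial>S) - (\<integral>s. f s * g (Z s) \<partial>S)) \<le> \<bar>C\<bar> * sqrt (A * e n)"
  proof (intro always_eventually allI)
    fix n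
    have vm: "(\<lambda>z. v n z - g z) \<in> borel_measurable circle_borel" by measurable
    note t = transfer_integrable[OF vm vg_int[of n, folded v_def]]
    have gi: "integrable S (\<lambda>s. g (Z s))" by (rule transfer_integrable(1)[OF g g2])
    have vi: "integrable S (\<lambda>s. v n (Z s))" using Bochner_Integration.integrable_add[OF t(1) gi] by simp
    have fi: "integrable S (\<lambda>s. f s * h s)" if h: "integrable S h" for h :: "real \<Rightarrow> real"
    proof (rule Bochner_Integration.integrable_bound)
      show "integrable S (\<lambda>s. C * \<bar>h s\<bar>)" using h by simp
      show "(\<lambda>s. f s * h s) \<in> borel_measurable S" using borel_measurable_integrable[OF h] by measurable
      show "AE s in S. norm (f s * h s) \<le> norm (C * \<bar>h s\<bar>)"
      proof (rule AE_I2)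
        fix s assume "s \<in> space S"
        then have "\<bar>f s\<bar> \<le> \<bar>C\<bar>" using fB[of s] by simp
        then show "norm (f s * h s) \<le> norm (C * \<bar>h s\<bar>)" by (simp add: abs_mult mult_right_mono)
      qed
    qed
    have "(\<integral>s. f s * v n (Z s) \<partial>S) - (\<integral>s. f s * g (Z s) \<partial>S) = (\<integral>s. f s * (v n (Z s) - g (Z s)) \<partial>S)"
      using fi[OF vi] fi[OF gi] by (simp add: right_diff_distrib)
    also have "norm \<dots> \<le> (\<integral>s. \<bar>C\<bar> * \<bar>v n (Z s) - g (Z s)\<bar> \<partial>S)"
      unfolding real_norm_def
    proof (rule order_trans[OF integral_abs_bound], rule integral_mono_AE)
      show "AE s in S. \<bar>f s * (v n (Z s) - g (Z s))\<bar> \<le> \<bar>C\<bar> * \<bar>v n (Z s) - g (Z s)\<bar>"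
      proof (rule AE_I2)
        fix s assume "s \<in> space S"
        then have "\<bar>f s\<bar> \<le> \<bar>C\<bar>" using fB[of s] by simp
        then show "\<bar>f s * (v n (Z s) - g (Z s))\<bar> \<le> \<bar>C\<bar> * \<bar>v n (Z s) - g (Z s)\<bar>" by (simp add: abs_mult mult_right_mono)
      qed
      show "integrable S (\<lambda>s. \<bar>f s * (v n (Z s) - g (Z s))\<bar>)" by (intro integrable_abs fi t)
      show "integrable S (\<lambda>s. \<bar>C\<bar> * \<bar>v n (Z s) - g (Z s)\<bar>)" using t(1) by simp
    qed
    also have "\<dots> = \<bar>C\<bar> * (\<integral>s. \<bar>v n (Z s) - g (Z s)\<bar> \<partial>S)" by simp
    also have "\<dots> \<le> \<bar>C\<bar> * sqrt (A * e n)"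
      using t(2) by (intro mult_left_mono real_le_rsqrt) (auto simp: A_def e_def)
    finally show "norm ((\<integral>s. f s * v n (Z s) \<partial>S) - (\<integral>s. f s * g (Z s) \<partial>S)) \<le> \<bar>C\<bar> * sqrt (A * e n)" .
  qed
qed

text \<open>For a constant function the symmetrised double integral is identically 0, and this
  passes to the limit.\<close>

lemma integral_g: "(\<integral>s. g (Z s) \<partial>S) = 0"
proof -
  have "(\<integral>s. 1 * v n (Z s) \<partial>S) = 0" for n
    using integral_diff_K[of "\<lambda>_. 1" 1 n] by simp
  then show ?thesis
    using tendsto_integral_v[of "\<lambda>_. 1" 1] by (simp add: LIMSEQ_const_iff)
qed

text \<open>The cross term vanishes because \<theta> is centred. The factor 2, together with the 1/8
  of the pointwise inequality, gives the 1/4 of the transport estimate.\<close>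

lemma integral_\<theta>_diff_square:
  "integrable (S \<Otimes>\<^sub>M S) (\<lambda>x. (\<theta> (fst x) - \<theta> (snd x))\<^sup>2)"
  "(\<integral>x. (\<theta> (fst x) - \<theta> (snd x))\<^sup>2 \<partial>(S \<Otimes>\<^sub>M S)) = 2 * (\<integral>s. (\<theta> s)\<^sup>2 \<partial>S)"
proof -
  have i: "integrable (S \<Otimes>\<^sub>M S) (\<lambda>x. (\<theta> (fst x) - \<theta> (snd x))\<^sup>2)"
  proof (rule SS.P.integrable_const_bound[of _ "(4 * B)\<^sup>2"])
    show "AE x in S \<Otimes>\<^sub>M S. norm ((\<theta> (fst x) - \<theta> (snd x))\<^sup>2) \<le> (4 * B)\<^sup>2"
    proof (rule AE_I2)
      fix x assume "x \<in> space (S \<Otimes>\<^sub>M S)"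
      then have "fst x \<in> space S" "snd x \<in> space S" by (auto simp: space_pair_measure)
      then have "\<bar>\<theta> (fst x) - \<theta> (snd x)\<bar> \<le> \<bar>4 * B\<bar>" using \<theta>_bound[of "fst x"] \<theta>_bound[of "snd x"] by linarith
      then have "(\<theta> (fst x) - \<theta> (snd x))\<^sup>2 \<le> (4 * B)\<^sup>2" by (rule iffD1[OF abs_le_square_iff])
      then show "norm ((\<theta> (fst x) - \<theta> (snd x))\<^sup>2) \<le> (4 * B)\<^sup>2" by simp
    qed
  qed measurable
  then show "integrable (S \<Otimes>\<^sub>M S) (\<lambda>x. (\<theta> (fst x) - \<theta> (snd x))\<^sup>2)" .
  have "(\<integral>x. (\<theta> (fst x) - \<theta> (snd x))\<^sup>2 \<partial>(S \<Otimes>\<^sub>M S)) = (\<integral>s. (\<integral>t. (\<theta> s - \<theta> t)\<^sup>2 \<partial>S) \<partial>S)"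
    using SS.integral_fst'[OF i] by simp
  also have "\<dots> = (\<integral>s. (\<theta> s)\<^sup>2 + (\<integral>t. (\<theta> t)\<^sup>2 \<partial>S) \<partial>S)"
  proof (intro Bochner_Integration.integral_cong refl)
    fix s
    have "(\<integral>t. (\<theta> s - \<theta> t)\<^sup>2 \<partial>S) = (\<integral>t. (\<theta> s)\<^sup>2 - 2 * \<theta> s * \<theta> t + (\<theta> t)\<^sup>2 \<partial>S)"
      by (intro Bochner_Integration.integral_cong) (auto simp: power2_eq_square algebra_simps)
    also have "\<dots> = (\<theta> s)\<^sup>2 - 2 * \<theta> s * (\<integral>t. \<theta> t \<partial>S) + (\<integral>t. (\<theta> t)\<^sup>2 \<partial>S)"
      using \<theta>_integrable S.prob_space
      by (subst Bochner_Integration.integral_add, simp, simp, subst Bochner_Integration.integral_diff, simp, simp, subst integral_mult_right_zero, simp)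
    also have "\<dots> = (\<theta> s)\<^sup>2 + (\<integral>t. (\<theta> t)\<^sup>2 \<partial>S)" unfolding integral_\<theta> by simp
    finally show "(\<integral>t. (\<theta> s - \<theta> t)\<^sup>2 \<partial>S) = (\<theta> s)\<^sup>2 + (\<integral>t. (\<theta> t)\<^sup>2 \<partial>S)" .
  qed
  also have "\<dots> = 2 * (\<integral>s. (\<theta> s)\<^sup>2 \<partial>S)"
    using \<theta>_integrable S.prob_space by (subst Bochner_Integration.integral_add) auto
  finally show "(\<integral>x. (\<theta> (fst x) - \<theta> (snd x))\<^sup>2 \<partial>(S \<Otimes>\<^sub>M S)) = 2 * (\<integral>s. (\<theta> s)\<^sup>2 \<partial>S)" .
qed

text \<open>\<open>NX\<close> and \<open>NY\<close> are \<open>ln 2\<close> minus the two entropies,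
  so \<open>NX - NY\<close> is the entropy of \<nu> minus that of \<mu>. The weighted pointwise
  inequality is integrated for each \<open>n\<close> and both sides are passed to the limit.\<close>

lemma log_energy_transport:
  obtains NX NY where "0 \<le> NX" "0 \<le> NY" "log_energy \<mu> = ennreal NX" "log_energy \<nu> = ennreal NY"
    "NX - NY + (\<integral>s. (\<theta> s)\<^sup>2 \<partial>S) / 4 \<le> (\<integral>s. \<theta> s * g (Z s) \<partial>S)"
proof -
  define dZ where "dZ x = cmod (Z (fst x) - Z (snd x))" for x
  define dW where "dW x = cmod (W (fst x) - W (snd x))" for x
  have [measurable]: "dZ \<in> borel_measurable (S \<Otimes>\<^sub>M S)" "dW \<in> borel_measurable (S \<Otimes>\<^sub>M S)"
    unfolding dZ_def dW_def by measurable
  note eX = log_energy_pair[OF S.prob_space_axioms X fin_\<mu>[folded \<mu>], unfolded \<mu>, folded dZ_def]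
  note eY = log_energy_pair[OF S.prob_space_axioms Y fin_\<nu>[folded \<nu>], unfolded \<nu>, folded dW_def]
  define NX where "NX = ln 2 - (\<integral>x. ln (dZ x) \<partial>(S \<Otimes>\<^sub>M S))"
  define NY where "NY = ln 2 - (\<integral>x. ln (dW x) \<partial>(S \<Otimes>\<^sub>M S))"
  \<comment> \<open>Half of the difference of displacements, squared and halved again, produces the
    8.\<close>
  define D where "D x = ln (dW x) - ln (dZ x) + (\<theta> (fst x) - \<theta> (snd x))\<^sup>2 / 8" for x
  define om where "om n x = r n * (dZ x)\<^sup>2 / ((1 - r n)\<^sup>2 + r n * (dZ x)\<^sup>2)" for n x
  have [measurable]: "D \<in> borel_measurable (S \<Otimes>\<^sub>M S)" "om n \<in> borel_measurable (S \<Otimes>\<^sub>M S)" for n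
    unfolding D_def om_def by measurable
  have Di: "integrable (S \<Otimes>\<^sub>M S) D"
    unfolding D_def using eX(2) eY(2) integral_\<theta>_diff_square(1) by simp
  have DI: "(\<integral>x. D x \<partial>(S \<Otimes>\<^sub>M S)) = NX - NY + (\<integral>s. (\<theta> s)\<^sup>2 \<partial>S) / 4"
  proof -
    have "(\<integral>x. D x \<partial>(S \<Otimes>\<^sub>M S)) = (\<integral>x. ln (dW x) \<partial>(S \<Otimes>\<^sub>M S)) - (\<integral>x. ln (dZ x) \<partial>(S \<Otimes>\<^sub>M S))
       + (\<integral>x. (\<theta> (fst x) - \<theta> (snd x))\<^sup>2 \<partial>(S \<Otimes>\<^sub>M S)) / 8"
      unfolding D_def using eX(2) eY(2) integral_\<theta>_diff_square(1)
      by (subst Bochner_Integration.integral_add, simp, simp, subst Bochner_Integration.integral_diff) auto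
    then show ?thesis unfolding integral_\<theta>_diff_square(2) NX_def NY_def by simp
  qed
  have om01: "0 \<le> om n x" "om n x \<le> 1" for n x
  proof -
    have 1: "0 < (1 - r n)\<^sup>2" using r(2)[of n] by simp
    have 2: "0 \<le> r n * (dZ x)\<^sup>2" using r(1)[of n] by simp
    have 3: "0 < (1 - r n)\<^sup>2 + r n * (dZ x)\<^sup>2" using 1 2 by linarith
    show "0 \<le> om n x" unfolding om_def using 2 3 by (intro divide_nonneg_pos)
    show "om n x \<le> 1" unfolding om_def divide_le_eq_1_pos[OF 3] using 1 by simp
  qed
  \<comment> \<open>The weights tend to 1 off the diagonal, which is null by finite energy;
    \<open>\<bar>D x\<bar>\<close> dominates, and it is integrable because both energies are
    finite.\<close>
  have lim: "(\<lambda>n. \<integral>x. om n x * D x \<partial>(S \<Otimes>\<^sub>M S)) \<longlonglongrightarrow> (\<integral>x. D x \<partial>(S \<Otimes>\<^sub>M S))"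
  proof (rule integral_dominated_convergence[where w="\<lambda>x. \<bar>D x\<bar>"])
    show "AE x in S \<Otimes>\<^sub>M S. (\<lambda>n. om n x * D x) \<longlonglongrightarrow> D x"
      using eX(1)
    proof eventually_elim
      case (elim x)
      then have "dZ x \<noteq> 0" by (simp add: dZ_def)
      then have "(\<lambda>n. om n x * D x) \<longlonglongrightarrow> 1 * (dZ x)\<^sup>2 / ((1 - 1)\<^sup>2 + 1 * (dZ x)\<^sup>2) * D x"
        unfolding om_def by (intro tendsto_intros r_lim) auto
      then show ?case using \<open>dZ x \<noteq> 0\<close> by simp
    qed
    show "AE x in S \<Otimes>\<^sub>M S. norm (om n x * D x) \<le> \<bar>D x\<bar>" for n
      using om01 by (intro AE_I2) (simp add: abs_mult mult_left_le_one_le)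
  qed (use Di in auto)
  have le: "(\<integral>x. om n x * D x \<partial>(S \<Otimes>\<^sub>M S)) \<le> (\<integral>s. \<theta> s * v n (Z s) \<partial>S)" for n
  proof -
    have "(\<integral>x. om n x * D x \<partial>(S \<Otimes>\<^sub>M S)) \<le> (\<integral>x. (\<theta> (fst x) - \<theta> (snd x)) / 2 * K n (fst x) (snd x) \<partial>(S \<Otimes>\<^sub>M S))"
    proof (rule integral_mono_AE)
      show "integrable (S \<Otimes>\<^sub>M S) (\<lambda>x. om n x * D x)"
        by (rule Bochner_Integration.integrable_bound[OF Di]) (use om01 in \<open>auto simp: abs_mult mult_left_le_one_le intro!: AE_I2\<close>)
      have "integrable (S \<Otimes>\<^sub>M S) (\<lambda>x. (1 / 2) * (\<theta> (fst x) * K n (fst x) (snd x) - \<theta> (snd x) * K n (fst x) (snd x)))"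
        using \<theta>_bound by (intro integrable_mult_right Bochner_Integration.integrable_diff integrable_bounded_K[where C="2 * B"]) auto
      then show "integrable (S \<Otimes>\<^sub>M S) (\<lambda>x. (\<theta> (fst x) - \<theta> (snd x)) / 2 * K n (fst x) (snd x))"
        by (rule Bochner_Integration.integrable_cong[THEN iffD1, rotated -1]) (auto simp: left_diff_distrib diff_divide_distrib)
      show "AE x in S \<Otimes>\<^sub>M S. om n x * D x \<le> (\<theta> (fst x) - \<theta> (snd x)) / 2 * K n (fst x) (snd x)"
        using eX(1) eY(1) AE_space
      proof eventually_elim
        case (elim x)
        then have sp: "fst x \<in> space S" "snd x \<in> space S" by (auto simp: space_pair_measure)
        have sq: "(a / 2)\<^sup>2 / 2 = a\<^sup>2 / 8" for a :: real by (simp add: power_divide)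
        from transport_kernel_le[OF less_imp_le[OF r(1)[of n]] r(2)[of n] mono[OF sp] elim(1,2)]
        show ?case unfolding sq om_def D_def K_def dZ_def dW_def .
      qed
    qed
    also have "\<dots> = (\<integral>s. \<theta> s * v n (Z s) \<partial>S)"
      by (rule integral_diff_K[where C="2 * B"]) (use \<theta>_bound in auto)
    finally show ?thesis .
  qed
  have "(\<lambda>n. \<integral>s. \<theta> s * v n (Z s) \<partial>S) \<longlonglongrightarrow> (\<integral>s. \<theta> s * g (Z s) \<partial>S)"
    by (rule tendsto_integral_v[where C="2 * B"]) (use \<theta>_bound in auto)
  from LIMSEQ_le[OF lim this] have "(\<integral>x. D x \<partial>(S \<Otimes>\<^sub>M S)) \<le> (\<integral>s. \<theta> s * g (Z s) \<partial>S)"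
    using le by blast
  then have main: "NX - NY + (\<integral>s. (\<theta> s)\<^sup>2 \<partial>S) / 4 \<le> (\<integral>s. \<theta> s * g (Z s) \<partial>S)" unfolding DI .
  show thesis
    by (rule that[OF _ _ _ _ main]) (use eX(3,4) eY(3,4) in \<open>auto simp: NX_def NY_def\<close>)
qed

end

section \<open>The logarithmic Sobolev inequality\<close>

text \<open>\<open>circle_deriv\<close> differentiates at the principal argument. Any other argument
  of the same point differs from it by a period of the function along \<open>cis\<close>, so the
  derivative there is the same.\<close>

lemma circle_C1:
  assumes "(\<lambda>t. Q (cis t)) C1_differentiable_on (UNIV :: real set)"
  obtains D where "continuous_on UNIV D" "\<And>t. ((\<lambda>t. Q (cis t)) has_real_derivative D t) (at t)"
    "\<And>t. circle_deriv Q (cis t) = D t"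
proof -
  from assms obtain D where D: "\<And>t. ((\<lambda>t. Q (cis t)) has_vector_derivative D t) (at t)" "continuous_on UNIV D"
    unfolding C1_differentiable_on_def by auto
  then have d: "((\<lambda>t. Q (cis t)) has_real_derivative D t) (at t)" for t
    by (simp add: has_real_derivative_iff_has_vector_derivative)
  have "circle_deriv Q (cis t) = D t" for t
  proof -
    define a where "a = Arg (cis t)"
    have "cis a = cis t" using cis_Arg_circle[of "cis t"] by (simp add: a_def)
    moreover have "cis (s + (a - t)) = cis s * (cis a / cis t)" for s
      by (simp add: cis_mult cis_divide)
    ultimately have "cis (s + (a - t)) = cis s" for s by simp
    then have "((\<lambda>s. Q (cis s)) has_real_derivative D a) (at t)"
      using d[of a] DERIV_shift[of "\<lambda>t. Q (cis t)" "D a" t "a - t"] by simp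
    then have "D a = D t" using d[of t] DERIV_unique by blast
    then show ?thesis using DERIV_imp_deriv[OF d[of a]] by (simp add: circle_deriv_def a_def)
  qed
  then show thesis using that D d by blast
qed

lemma convex_tangent_quadratic:
  fixes q D :: "real \<Rightarrow> real"
  assumes cv: "convex_on UNIV (\<lambda>t. q t - \<rho> / 2 * t\<^sup>2)" and d: "(q has_real_derivative D x) (at x)"
  shows "D x * (y - x) + \<rho> / 2 * (y - x)\<^sup>2 \<le> q y - q x"
proof -
  have "((\<lambda>t. q t - \<rho> / 2 * t\<^sup>2) has_real_derivative D x - \<rho> * x) (at x)"
    by (auto intro!: derivative_eq_intros d)
  from convex_on_imp_above_tangent[OF cv _ _ _ this, of y]
  have "(D x - \<rho> * x) * (y - x) \<le> (q y - \<rho> / 2 * y\<^sup>2) - (q x - \<rho> / 2 * x\<^sup>2)" by simp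
  moreover have "(D x - \<rho> * x) * (y - x) + \<rho> / 2 * y\<^sup>2 - \<rho> / 2 * x\<^sup>2 = D x * (y - x) + \<rho> / 2 * (y - x)\<^sup>2"
    by (simp add: power2_eq_square field_simps)
  ultimately show ?thesis by linarith
qed

text \<open>Extracts what the analysis uses: a real density in L1 and L2. The Radon-Nikodym
  derivative is finite almost everywhere, so passing to real values does not change the measure, and
  the square is bounded by x + x^3.\<close>

lemma has_L3_densityD:
  assumes M: "M \<in> circle_prob_measures" and L3: "has_L3_density M"
  shows "circle_density M \<in> borel_measurable circle_borel"
    and "M = density circle_haar (\<lambda>z. ennreal (circle_density M z))"
    and "integrable circle_haar (circle_density M)"
    and "integrable circle_haar (\<lambda>z. (circle_density M z)\<^sup>2)"
proof -
  interpret M: prob_space M by (rule circle_prob_space[OF M])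
  have ac: "absolutely_continuous circle_haar M" and p3: "integrable circle_haar (\<lambda>z. circle_density M z ^ 3)"
    using L3 by (auto simp: has_L3_density_def)
  have sM: "sets M = sets circle_haar" using circle_prob_sets[OF M] by simp
  have "RN_deriv circle_haar M \<in> borel_measurable circle_borel"
    using borel_measurable_RN_deriv[of circle_haar M] by simp
  then show p [measurable]: "circle_density M \<in> borel_measurable circle_borel"
    unfolding circle_density_def[abs_def] by measurable
  have p0: "0 \<le> circle_density M z" for z by (simp add: circle_density_def)
  have "AE z in circle_haar. RN_deriv circle_haar M z \<noteq> \<infinity>"
    by (rule haar.RN_deriv_finite[OF M.sigma_finite_measure_axioms ac sM])
  then have "AE z in circle_haar. RN_deriv circle_haar M z = ennreal (circle_density M z)"
    by eventually_elim (simp add: circle_density_def less_top)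
  then have "density circle_haar (RN_deriv circle_haar M) = density circle_haar (\<lambda>z. ennreal (circle_density M z))"
    by (intro density_cong) auto
  then show dM: "M = density circle_haar (\<lambda>z. ennreal (circle_density M z))"
    using haar.density_RN_deriv[OF ac sM] by simp
  have "(\<integral>\<^sup>+z. ennreal (circle_density M z) \<partial>circle_haar) = emeasure M (space M)"
    using sets.top[of circle_borel]
    by (subst dM, subst emeasure_density) (auto simp: circle_prob_space_eq[OF M] intro!: nn_integral_cong)
  then have "(\<integral>\<^sup>+z. ennreal (circle_density M z) \<partial>circle_haar) < \<infinity>"
    by (simp add: M.emeasure_space_1)
  then show p1: "integrable circle_haar (circle_density M)"
    by (intro integrableI_nonneg) (auto simp: p0)
  show "integrable circle_haar (\<lambda>z. (circle_density M z)\<^sup>2)"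
  proof (rule Bochner_Integration.integrable_bound)
    show "integrable circle_haar (\<lambda>z. circle_density M z + circle_density M z ^ 3)" using p1 p3 by simp
    have "x\<^sup>2 \<le> x + x ^ 3" if "0 \<le> x" for x :: real
    proof -
      have "0 \<le> x * ((x - 1)\<^sup>2 + x)" using that by simp
      also have "\<dots> = x + x ^ 3 - x\<^sup>2" by (simp add: power2_eq_square power3_eq_cube algebra_simps)
      finally show ?thesis by simp
    qed
    then show "AE z in circle_haar. norm ((circle_density M z)\<^sup>2) \<le> norm (circle_density M z + circle_density M z ^ 3)"
      using p0 by (intro AE_I2) simp
  qed simp
qed

text \<open>Completing the square, with optimum at x = 2 k / c. Here \<open>x\<close> will be the
  displacement and \<open>c / 4\<close> the total curvature.\<close>

lemma young_quadratic:
  fixes c k x :: real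
  assumes "c > 0" shows "x * k - c / 4 * x\<^sup>2 \<le> k\<^sup>2 / c"
proof -
  have "0 \<le> (2 * k - c * x)\<^sup>2 / (4 * c)" using assms by simp
  also have "\<dots> = k\<^sup>2 / c - (x * k - c / 4 * x\<^sup>2)"
    using assms by (simp add: power2_eq_square field_simps)
  finally show ?thesis by simp
qed

theorem theorem3p3:
  fixes Q :: "complex \<Rightarrow> real" and \<rho> :: real and \<mu> :: "complex measure"
  assumes "(\<lambda>t. Q (cis t)) C1_differentiable_on UNIV"
    and "convex_on UNIV (\<lambda>t. Q (cis t) - \<rho> / 2 * t\<^sup>2)"
    and "\<rho> > - 1 / 2"
    and "\<mu> \<in> circle_prob_measures"
  shows "rel_free_entropy Q \<mu> \<le> ereal (1 / (1 + 2 * \<rho>)) * rel_free_fisher Q \<mu>"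
proof -
  \<comment> \<open>Chosen so that \<open>c / 4\<close> is the sum of 1/4 from the transport
    estimate and \<open>\<rho> / 2\<close> from the convexity bound.\<close>
  define c where "c = 1 + 2 * \<rho>"
  have c: "c > 0" using assms(3) by (simp add: c_def)
  then have c': "0 < 1 / (1 + 2 * \<rho>)" by (simp add: c_def)
  interpret \<mu>: prob_space \<mu> by (rule circle_prob_space[OF assms(4)])
  show ?thesis
  proof (cases "has_L3_density \<mu>")
    case False
    then show ?thesis using c' by (simp add: rel_free_fisher_def)
  next
    case L3: True
    define p where "p = circle_density \<mu>"
    note pD = has_L3_densityD[OF assms(4) L3, folded p_def]
    have p0: "0 \<le> p z" for z by (simp add: p_def circle_density_def)
    obtain g r where g [measurable]: "g \<in> borel_measurable circle_borel" and g2: "integrable circle_haar (\<lambda>z. (g z)\<^sup>2)"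
      and r: "\<And>n::nat. 0 < r n" "\<And>n. r n < 1" "r \<longlonglongrightarrow> 1"
      and vg: "\<And>n. integrable circle_haar (\<lambda>z. (Im (herglotz_int p (of_real (r n) * z)) - g z)\<^sup>2)"
        "(\<lambda>n. \<integral>z. (Im (herglotz_int p (of_real (r n) * z)) - g z)\<^sup>2 \<partial>circle_haar) \<longlonglongrightarrow> 0"
      and hil: "AE z in circle_haar. circle_hilbert p z = g z"
      by (rule conj_poisson_L2_limit[OF pD(3,4)]) (rule that; assumption)
    obtain D where D: "continuous_on UNIV D" "\<And>t. ((\<lambda>t. Q (cis t)) has_real_derivative D t) (at t)"
      "\<And>t. circle_deriv Q (cis t) = D t"
      using circle_C1[OF assms(1)] by blast
    have Qc: "continuous_on UNIV (\<lambda>t. Q (cis t))"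
      by (intro continuous_at_imp_continuous_on ballI DERIV_isCont[OF D(2)])
    have Dc: "continuous_on UNIV (\<lambda>t. circle_deriv Q (cis t))" using D(1,3) by simp
    note Qm [measurable] = measurable_circle_of_cis[OF Qc] measurable_circle_of_cis[OF Dc]
    obtain C where C: "\<And>z. cmod z = 1 \<Longrightarrow> \<bar>Q z\<bar> \<le> C" using bounded_circle_of_cis[OF Qc] by blast
    obtain C1 where C1: "\<And>z. cmod z = 1 \<Longrightarrow> \<bar>circle_deriv Q z\<bar> \<le> C1" using bounded_circle_of_cis[OF Dc] by blast
    define h where "h z = g z - circle_deriv Q z" for z
    have [measurable]: "h \<in> borel_measurable circle_borel" unfolding h_def by measurable
    define m where "m = (\<integral>z. circle_deriv Q z \<partial>\<mu>)"
    define I where "I = (\<integral>\<^sup>+z. ennreal ((h z)\<^sup>2) \<partial>\<mu>)"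
    \<comment> \<open>An equality almost everywhere for the Haar measure passes to \<mu> because
      \<mu> has a density.\<close>
    have "AE z in \<mu>. circle_hilbert p z = g z"
      using hil pD(1) by (subst pD(2), subst AE_density) (auto elim!: eventually_mono)
    then have fisher: "rel_free_fisher Q \<mu> = enn2ereal I - ereal (m\<^sup>2)"
      unfolding rel_free_fisher_def I_def m_def p_def[symmetric] h_def using L3
      by (simp, intro arg_cong2[where f="(-)"] arg_cong[where f=enn2ereal] nn_integral_cong_AE) (auto elim!: eventually_mono)
    have fin_\<mu>: "log_energy \<mu> < \<infinity>"
      by (subst pD(2)) (rule log_energy_density_finite[OF pD(1) p0 pD(4)])
    define \<nu> where "\<nu> = equilibrium_measure Q"
    have \<nu>: "\<nu> \<in> circle_prob_measures" unfolding \<nu>_def by (rule equilibrium_measure_mem[OF Qc])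
    have entropy: "rel_free_entropy Q \<mu> = - (ereal (ln 2) - enn2ereal (log_energy \<mu>)) + ereal (\<integral>z. Q z \<partial>\<mu>)
        + ((ereal (ln 2) - enn2ereal (log_energy \<nu>)) - ereal (\<integral>z. Q z \<partial>\<nu>))"
      unfolding rel_free_entropy_def equilibrium_const_def \<nu>_def[symmetric] free_entropy_eq[OF assms(4)] free_entropy_eq[OF \<nu>] ..
    obtain NX0 where NX0: "log_energy \<mu> = ennreal NX0" "0 \<le> NX0" using fin_\<mu> by (cases "log_energy \<mu>") auto
    \<comment> \<open>Degenerate cases: an infinite \<open>I\<close> makes the right side infinite,
      and infinite energy of \<nu> makes \<open>equilibrium_const\<close>, hence the left side,
      equal to -\<infinity>. Only the third case needs the coupling.\<close>
    consider "I = \<infinity>" | "log_energy \<nu> = \<infinity>" | "I < \<infinity>" "log_energy \<nu> < \<infinity>"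
      by (metis infinity_ennreal_def less_top)
    then show ?thesis
    proof cases
      case 1
      then show ?thesis unfolding fisher using c' by simp
    next
      case 2
      then show ?thesis unfolding entropy NX0(1) using NX0(2) by (simp add: enn2ereal_ennreal)
    next
      case 3
      obtain X Y B where XY: "X \<in> borel_measurable unit_measure" "Y \<in> borel_measurable unit_measure"
        "\<And>s. s \<in> {0..<1} \<Longrightarrow> \<bar>X s\<bar> \<le> B" "\<And>s. s \<in> {0..<1} \<Longrightarrow> \<bar>Y s\<bar> \<le> B"
        "distr unit_measure circle_borel (\<lambda>s. cis (X s)) = \<mu>" "distr unit_measure circle_borel (\<lambda>s. cis (Y s)) = \<nu>"
        "(\<integral>s. Y s \<partial>unit_measure) = (\<integral>s. X s \<partial>unit_measure)"
        "\<And>s t. 0 \<le> s \<Longrightarrow> s \<le> t \<Longrightarrow> t < 1 \<Longrightarrow> X s \<le> X t \<and> X t \<le> X s + 2 * pi \<and> Y s \<le> Y t \<and> Y t \<le> Y s + 2 * pi"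
        by (rule centered_coupling[OF assms(4) \<nu>]) (rule that; assumption)
      interpret U: prob_space unit_measure by (rule prob_space_unit_measure)
      interpret circle_transport unit_measure X Y B p g r \<mu> \<nu>
      proof unfold_locales
        show "(X t \<le> X s \<and> X s \<le> X t + 2 * pi \<and> Y t \<le> Y s \<and> Y s \<le> Y t + 2 * pi) \<or>
          (X s \<le> X t \<and> X t \<le> X s + 2 * pi \<and> Y s \<le> Y t \<and> Y t \<le> Y s + 2 * pi)"
          if "s \<in> space unit_measure" "t \<in> space unit_measure" for s t
          using XY(8)[of s t] XY(8)[of t s] that by (cases "s \<le> t") auto
      qed (use XY pD p0 fin_\<mu> 3 g2 r vg in simp_all)
      have bounded_int: "integrable unit_measure (\<lambda>s. f (cis (X s)))" "integrable unit_measure (\<lambda>s. f (cis (Y s)))"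
        if "f \<in> borel_measurable circle_borel" "\<And>z. cmod z = 1 \<Longrightarrow> \<bar>f z\<bar> \<le> C'" for f :: "complex \<Rightarrow> real" and C'
        using that measurable_compose[OF measurable_compose[OF XY(1) cis_measurable] that(1)]
          measurable_compose[OF measurable_compose[OF XY(2) cis_measurable] that(1)]
        by (auto intro!: U.integrable_const_bound[of _ C'])
      note Qi = bounded_int[OF Qm(1) C] and Di = bounded_int(1)[OF Qm(2) C1]
      have hm: "(\<lambda>s. h (cis (X s))) \<in> borel_measurable unit_measure" by measurable
      have I: "I = (\<integral>\<^sup>+s. ennreal ((h (cis (X s)))\<^sup>2) \<partial>unit_measure)"
        unfolding I_def XY(5)[symmetric] by (subst nn_integral_distr) auto
      have h2: "integrable unit_measure (\<lambda>s. (h (cis (X s)))\<^sup>2)"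
        by (rule integrableI_nonneg) (use 3 hm in \<open>auto simp: I\<close>)
      define H where "H = (\<integral>s. (h (cis (X s)))\<^sup>2 \<partial>unit_measure)"
      have IH: "I = ennreal H" unfolding I H_def using h2 by (intro nn_integral_eq_integral) auto
      have H0: "0 \<le> H" by (simp add: H_def)
      have hi: "integrable unit_measure (\<lambda>s. h (cis (X s)))"
        by (rule U.square_expectation_abs_le(1)[OF h2 hm])
      have m: "m = (\<integral>s. circle_deriv Q (cis (X s)) \<partial>unit_measure)"
        unfolding m_def XY(5)[symmetric] by (subst integral_distr) auto
      have gi: "integrable unit_measure (\<lambda>s. g (cis (X s)))" by (rule transfer_integrable(1)[OF g g2])
      have hI: "(\<integral>s. h (cis (X s)) \<partial>unit_measure) = - m"
        unfolding h_def m using gi Di integral_g by simp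
      have bdi: "integrable unit_measure (\<lambda>s. (Y s - X s) * f s)" if f: "integrable unit_measure f" for f
      proof (rule Bochner_Integration.integrable_bound)
        show "integrable unit_measure (\<lambda>s. (2 * B) * \<bar>f s\<bar>)" using f by simp
        show "(\<lambda>s. (Y s - X s) * f s) \<in> borel_measurable unit_measure" using borel_measurable_integrable[OF f] by measurable
        show "AE s in unit_measure. norm ((Y s - X s) * f s) \<le> norm ((2 * B) * \<bar>f s\<bar>)"
        proof (rule AE_I2)
          fix s assume "s \<in> space unit_measure"
          then have "\<bar>Y s - X s\<bar> \<le> \<bar>2 * B\<bar>" using \<theta>_bound[of s] by linarith
          then have "\<bar>Y s - X s\<bar> * \<bar>f s\<bar> \<le> \<bar>2 * B\<bar> * \<bar>f s\<bar>" by (rule mult_right_mono) simp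
          then show "norm ((Y s - X s) * f s) \<le> norm ((2 * B) * \<bar>f s\<bar>)" by (simp only: real_norm_def abs_mult abs_abs)
        qed
      qed
      define T where "T = (\<integral>s. (Y s - X s)\<^sup>2 \<partial>unit_measure)"
      \<comment> \<open>The tangent inequality is used on the line, between the lifted points
        \<open>X s\<close> and \<open>Y s\<close>. The convex function is not periodic unless \<rho>
        = 0, so the quadratic term depends on the choice of lifts.\<close>
      have Q_ineq: "(\<integral>s. (Y s - X s) * circle_deriv Q (cis (X s)) \<partial>unit_measure) + \<rho> / 2 * T \<le> (\<integral>z. Q z \<partial>\<nu>) - (\<integral>z. Q z \<partial>\<mu>)"
      proof -
        have "(\<integral>s. (Y s - X s) * circle_deriv Q (cis (X s)) \<partial>unit_measure) + \<rho> / 2 * T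
            = (\<integral>s. (Y s - X s) * circle_deriv Q (cis (X s)) + \<rho> / 2 * (Y s - X s)\<^sup>2 \<partial>unit_measure)"
          unfolding T_def using bdi[OF Di] \<theta>_integrable(2) by simp
        also have "\<dots> \<le> (\<integral>s. Q (cis (Y s)) - Q (cis (X s)) \<partial>unit_measure)"
        proof (rule integral_mono)
          show "(Y s - X s) * circle_deriv Q (cis (X s)) + \<rho> / 2 * (Y s - X s)\<^sup>2 \<le> Q (cis (Y s)) - Q (cis (X s))" for s
            using convex_tangent_quadratic[where q="\<lambda>t. Q (cis t)" and D=D and x="X s" and y="Y s", OF assms(2) D(2)] by (simp add: D(3) mult.commute)
        qed (use bdi[OF Di] \<theta>_integrable(2) Qi in auto)
        also have "\<dots> = (\<integral>s. Q (cis (Y s)) \<partial>unit_measure) - (\<integral>s. Q (cis (X s)) \<partial>unit_measure)"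
          using Qi by simp
        also have "\<dots> = (\<integral>z. Q z \<partial>\<nu>) - (\<integral>z. Q z \<partial>\<mu>)"
          unfolding XY(5)[symmetric] XY(6)[symmetric] by (subst (1 2) integral_distr) auto
        finally show ?thesis .
      qed
      obtain NX NY where N: "0 \<le> NX" "0 \<le> NY" "log_energy \<mu> = ennreal NX" "log_energy \<nu> = ennreal NY"
        "NX - NY + T / 4 \<le> (\<integral>s. (Y s - X s) * g (cis (X s)) \<partial>unit_measure)"
        using log_energy_transport unfolding T_def by blast
      have "(\<integral>s. (Y s - X s) * g (cis (X s)) \<partial>unit_measure) - (\<integral>s. (Y s - X s) * circle_deriv Q (cis (X s)) \<partial>unit_measure)
          = (\<integral>s. (Y s - X s) * h (cis (X s)) \<partial>unit_measure)"
        unfolding h_def using bdi[OF gi] bdi[OF Di] by (simp add: right_diff_distrib)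
      \<comment> \<open>The displacement has mean zero, so adding \<open>m\<close> times it is free.
        This replaces \<open>h\<close>, whose mean is \<open>- m\<close>, by its centred
        version.\<close>
      moreover have "(\<integral>s. (Y s - X s) * h (cis (X s)) \<partial>unit_measure) - c / 4 * T
          = (\<integral>s. (Y s - X s) * (h (cis (X s)) + m) - c / 4 * (Y s - X s)\<^sup>2 \<partial>unit_measure)"
      proof -
        have "(\<integral>s. (Y s - X s) * (h (cis (X s)) + m) - c / 4 * (Y s - X s)\<^sup>2 \<partial>unit_measure)
          = (\<integral>s. ((Y s - X s) * h (cis (X s)) + m * (Y s - X s)) - c / 4 * (Y s - X s)\<^sup>2 \<partial>unit_measure)"
          by (intro Bochner_Integration.integral_cong) (auto simp: algebra_simps)
        also have "\<dots> = ((\<integral>s. (Y s - X s) * h (cis (X s)) \<partial>unit_measure) + m * (\<integral>s. (Y s - X s) \<partial>unit_measure)) - c / 4 * T"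
          unfolding T_def using bdi[OF hi] \<theta>_integrable
          by (subst Bochner_Integration.integral_diff, simp, simp, subst Bochner_Integration.integral_add, simp, simp,
              subst (1 2) integral_mult_right_zero) simp
        finally show ?thesis unfolding integral_\<theta> by simp
      qed
      moreover have "\<dots> \<le> (\<integral>s. (h (cis (X s)) + m)\<^sup>2 / c \<partial>unit_measure)"
      proof (rule integral_mono)
        show "integrable unit_measure (\<lambda>s. (Y s - X s) * (h (cis (X s)) + m) - c / 4 * (Y s - X s)\<^sup>2)"
          by (intro Bochner_Integration.integrable_diff bdi Bochner_Integration.integrable_add hi integrable_mult_right \<theta>_integrable) simp
        show "integrable unit_measure (\<lambda>s. (h (cis (X s)) + m)\<^sup>2 / c)"
          unfolding power2_sum using hi h2 by simp
        show "(Y s - X s) * (h (cis (X s)) + m) - c / 4 * (Y s - X s)\<^sup>2 \<le> (h (cis (X s)) + m)\<^sup>2 / c" for s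
          by (rule young_quadratic[OF c])
      qed
      \<comment> \<open>The variance of \<open>h\<close>, which is where the squared mean of the
        derivative of Q gets subtracted.\<close>
      moreover have "(\<integral>s. (h (cis (X s)) + m)\<^sup>2 / c \<partial>unit_measure) = (H - m\<^sup>2) / c"
      proof -
        have "(\<integral>s. (h (cis (X s)) + m)\<^sup>2 \<partial>unit_measure) = H + m\<^sup>2 + 2 * (\<integral>s. h (cis (X s)) \<partial>unit_measure) * m"
          unfolding power2_sum H_def using hi h2 U.prob_space by simp
        then show ?thesis unfolding hI by (simp add: power2_eq_square)
      qed
      moreover have "c / 4 * T = T / 4 + \<rho> / 2 * T" by (simp add: c_def field_simps)
      ultimately have "NX + (\<integral>z. Q z \<partial>\<mu>) - NY - (\<integral>z. Q z \<partial>\<nu>) \<le> (H - m\<^sup>2) / c"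
        using Q_ineq N(5) by linarith
      then show ?thesis
        unfolding entropy fisher N(3,4) IH using N(1,2) H0 by (simp add: enn2ereal_ennreal c_def)
    qed
  qed
qed

end
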